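(* Let $\Lambda$ be a planar lattice with $m$-fold symmetry, $m\geq 2$, in which all degrees are even. Then there is a finitary $\mathrm{Aut}(\Lambda)$-factor of $\left([0,1]^{V(\Lambda)},\mu_\Lambda\right)$ which is almost surely a balanced orientation of $\Lambda$.
   Context: **Planar lattice.** A planar lattice $\Lambda$ is a connected, locally finite plane graph, with $V(\Lambda)$ a discrete subset of $\mathbb{R}^2$ (no accumulation points), such that there are translations $T_{v_1},T_{v_2}$ through two linearly independent vectors $v_1,v_2$, both of which act on $\Lambda$ as graph isomorphisms. For $m\ge 2$, $\Lambda$ has $m$-fold symmetry if the rotation about the origin through an angle of $2\pi/m$ maps the plane graph $\Lambda$ into itself. **Balanced orientation.** An orientation of the edges of a graph with all degrees even is balanced if the indegree of every vertex equals its outdegree. **Factors.** $\mu_\Lambda$ is the product measure on $[0,1]^{V(\Lambda)}$ with each coordinate Lebesgue. $\mathrm{Aut}(\Lambda)$ acts on $[0,1]^{V(\Lambda)}$ by $(\gamma.f)(v)=f(\gamma^{-1}.v)$ and naturally on the measurable space of orientations of $\Lambda$. An $\mathrm{Aut}(\Lambda)$-factor is a measurable map $\Phi$ from $[0,1]^{V(\Lambda)}$ (possibly undefined on a null set) to orientations of $\Lambda$ that is equivariant: $\gamma.\Phi(\omega)=\Phi(\gamma.\omega)$. It is finitary if, for each vertex $x$ and almost all $\omega$, there exists $R\in\mathbb{N}$ (depending on $\omega$) such that the restriction of $\Phi(\omega)$ to the edges incident to $x$ is already determined by $\omega|_{B_\Lambda(x,R)}$, i.e. changing $\omega$ outside the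 ball $B_\Lambda(x,R)$ does not change the orientation around $x$. *)

theory Defs
  imports "HOL-Probability.Probability"
begin

text \<open>
  The plane is \<^typ>\<open>complex\<close>, so that a rotation about the origin is a multiplication.
  A plane graph is given by its vertex set \<open>V\<close> and its edge set \<open>E\<close>, each edge being an arc,
  taken as a set of points.
\<close>

definition is_arc :: "complex set \<Rightarrow> bool" where
  "is_arc e \<longleftrightarrow> (\<exists>g. arc g \<and> path_image g = e)"

text \<open>
  An arc determines its two end points, whichever parametrisation is used; reversing a
  parametrisation turns the last point into the first.
\<close>

definition arc_ends :: "complex set \<Rightarrow> complex set" where
  "arc_ends e = {pathstart g | g. arc g \<and> path_image g = e}"

text \<open>
  Plane graphs are simple: arcs have two distinct end points, which excludes loops, and
  different edges have different sets of end points. They may be infinite.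
\<close>

definition plane_graph :: "complex set \<Rightarrow> complex set set \<Rightarrow> bool" where
  "plane_graph V E \<longleftrightarrow>
     (\<forall>e\<in>E. is_arc e \<and> arc_ends e \<subseteq> V) \<and>
     inj_on arc_ends E \<and>
     (\<forall>e\<in>E. (e - arc_ends e) \<inter> V = {} \<and>
            (\<forall>e'\<in>E. e' \<noteq> e \<longrightarrow> (e - arc_ends e) \<inter> e' = {}))"

text \<open>
  The abstract graph underlying a plane graph; below, \<open>F\<close> always stands for a set of
  two-element subsets of \<open>V\<close>.
\<close>

definition abs_edges :: "complex set set \<Rightarrow> complex set set" where
  "abs_edges E = arc_ends ` E"

definition vdegree :: "'a set set \<Rightarrow> 'a \<Rightarrow> nat" where
  "vdegree F x = card {e \<in> F. x \<in> e}"

definition locally_finite_graph :: "'a set \<Rightarrow> 'a set set \<Rightarrow> bool" where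
  "locally_finite_graph V F \<longleftrightarrow> (\<forall>x\<in>V. finite {e \<in> F. x \<in> e})"

definition adj_rel :: "'a set set \<Rightarrow> ('a \<times> 'a) set" where
  "adj_rel F = {(x, y). {x, y} \<in> F}"

definition connected_graph :: "'a set \<Rightarrow> 'a set set \<Rightarrow> bool" where
  "connected_graph V F \<longleftrightarrow> V \<noteq> {} \<and> (\<forall>x\<in>V. \<forall>y\<in>V. (x, y) \<in> (adj_rel F)\<^sup>*)"

definition graph_ball :: "'a set set \<Rightarrow> 'a \<Rightarrow> nat \<Rightarrow> 'a set" where
  "graph_ball F x R = {y. \<exists>n\<le>R. (x, y) \<in> adj_rel F ^^ n}"

text \<open>Only the values of an automorphism on \<open>V\<close> are relevant.\<close>

definition graph_Aut :: "'a set \<Rightarrow> 'a set set \<Rightarrow> ('a \<Rightarrow> 'a) set" where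
  "graph_Aut V F =
     {\<gamma>. bij_betw \<gamma> V V \<and> (\<forall>x\<in>V. \<forall>y\<in>V. {\<gamma> x, \<gamma> y} \<in> F \<longleftrightarrow> {x, y} \<in> F)}"

text \<open>
  The two translations are only required to act as isomorphisms of the underlying abstract graph,
  while the rotation in \<open>fold_symmetric\<close> has to map edges, as subsets of the plane, to edges.
\<close>

definition planar_lattice :: "complex set \<Rightarrow> complex set set \<Rightarrow> bool" where
  "planar_lattice V E \<longleftrightarrow>
     plane_graph V E \<and>
     connected_graph V (abs_edges E) \<and>
     locally_finite_graph V (abs_edges E) \<and>
     (\<forall>z. \<not> z islimpt V) \<and>
     (\<exists>v1 v2. v1 \<noteq> v2 \<and> independent {v1, v2} \<and>
        (\<lambda>z. z + v1) \<in> graph_Aut V (abs_edges E) \<and>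
        (\<lambda>z. z + v2) \<in> graph_Aut V (abs_edges E))"

definition rotation :: "nat \<Rightarrow> complex \<Rightarrow> complex" where
  "rotation m z = cis (2 * pi / real m) * z"

definition fold_symmetric :: "nat \<Rightarrow> complex set \<Rightarrow> complex set set \<Rightarrow> bool" where
  "fold_symmetric m V E \<longleftrightarrow>
     rotation m ` V \<subseteq> V \<and> (\<forall>e\<in>E. rotation m ` e \<in> E)"

text \<open>
  An orientation selects the head of every edge. The measurable space of orientations is the
  product over the edges of the two-point discrete spaces.
\<close>

definition orientations :: "'a set set \<Rightarrow> ('a set \<Rightarrow> 'a) measure" where
  "orientations F = PiM F (\<lambda>e. count_space e)"

definition indegree :: "'a set set \<Rightarrow> ('a set \<Rightarrow> 'a) \<Rightarrow> 'a \<Rightarrow> nat" where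
  "indegree F h x = card {e \<in> F. x \<in> e \<and> h e = x}"

definition outdegree :: "'a set set \<Rightarrow> ('a set \<Rightarrow> 'a) \<Rightarrow> 'a \<Rightarrow> nat" where
  "outdegree F h x = card {e \<in> F. x \<in> e \<and> h e \<noteq> x}"

definition balanced_orientation :: "'a set \<Rightarrow> 'a set set \<Rightarrow> ('a set \<Rightarrow> 'a) \<Rightarrow> bool" where
  "balanced_orientation V F h \<longleftrightarrow>
     h \<in> space (orientations F) \<and> (\<forall>x\<in>V. indegree F h x = outdegree F h x)"

definition iid_uniform :: "'a set \<Rightarrow> ('a \<Rightarrow> real) measure" where
  "iid_uniform V = PiM V (\<lambda>_. restrict_space lborel {0..1})"

definition act_labels :: "'a set \<Rightarrow> ('a \<Rightarrow> 'a) \<Rightarrow> ('a \<Rightarrow> real) \<Rightarrow> ('a \<Rightarrow> real)" where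
  "act_labels V \<gamma> \<omega> = (\<lambda>v\<in>V. \<omega> (inv_into V \<gamma> v))"

definition act_orientation ::
    "'a set \<Rightarrow> 'a set set \<Rightarrow> ('a \<Rightarrow> 'a) \<Rightarrow> ('a set \<Rightarrow> 'a) \<Rightarrow> ('a set \<Rightarrow> 'a)" where
  "act_orientation V F \<gamma> h = (\<lambda>e\<in>F. \<gamma> (h (inv_into V \<gamma> ` e)))"

text \<open>
  A factor is a partial map; \<open>D\<close> is its domain of definition, and the values of \<open>\<Phi>\<close> outside
  \<open>D\<close> are meaningless. Equivariance includes that the domain is invariant.
\<close>

definition Aut_factor ::
    "'a set \<Rightarrow> 'a set set \<Rightarrow> ('a \<Rightarrow> real) set \<Rightarrow> (('a \<Rightarrow> real) \<Rightarrow> ('a set \<Rightarrow> 'a)) \<Rightarrow> bool" where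
  "Aut_factor V F D \<Phi> \<longleftrightarrow>
     D \<subseteq> space (iid_uniform V) \<and>
     space (iid_uniform V) - D \<in> null_sets (iid_uniform V) \<and>
     \<Phi> \<in> measurable (restrict_space (iid_uniform V) D) (orientations F) \<and>
     (\<forall>\<gamma>\<in>graph_Aut V F. \<forall>\<omega>\<in>D.
        act_labels V \<gamma> \<omega> \<in> D \<and> \<Phi> (act_labels V \<gamma> \<omega>) = act_orientation V F \<gamma> (\<Phi> \<omega>))"

definition finitary_factor ::
    "'a set \<Rightarrow> 'a set set \<Rightarrow> ('a \<Rightarrow> real) set \<Rightarrow> (('a \<Rightarrow> real) \<Rightarrow> ('a set \<Rightarrow> 'a)) \<Rightarrow> bool" where
  "finitary_factor V F D \<Phi> \<longleftrightarrow>
     (\<forall>x\<in>V. AE \<omega> in iid_uniform V. \<omega> \<in> D \<and>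
        (\<exists>R. \<forall>\<omega>'\<in>D. (\<forall>v \<in> V \<inter> graph_ball F x R. \<omega>' v = \<omega> v) \<longrightarrow>
               (\<forall>e\<in>F. x \<in> e \<longrightarrow> \<Phi> \<omega>' e = \<Phi> \<omega> e)))"

end

theory Submission
  imports Defs "HOL-Library.Z2"
begin

text \<open>
  The argument lives in the abstract graph. Call a finite set of edges even if every vertex lies on
  an even number of its edges. A finite even set can be oriented so that it enters and leaves every
  vertex equally often (\<open>cyc_has_flow\<close>); hence a balanced orientation is obtained from any partition
  of the edge set into finite even sets, and the task is to find such a partition by a finitary and
  equivariant rule.

  Removing even sets greedily fails, since bi-infinite paths may be left over. What prevents this is
  the invariant \<open>coverable L H\<close> of the set \<open>H\<close> of edges that are still present: every finite subset of
  \<open>H\<close> lies in a sum modulo 2 of even subsets of \<open>H\<close> of diameter at most \<open>L\<close>. Omitting the summands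
  that miss the edges of a ball, one gets an even subset of \<open>H\<close> that contains all edges of \<open>H\<close> in the
  ball and exceeds the ball by at most \<open>L\<close> (\<open>coverable_near\<close>). Two facts carry the proof.

  \<^item> The whole graph is coverable (\<open>coverable_if_translation\<close>). By linear algebra over the field with
  two elements it is enough that a finite edge set \<open>\<psi>\<close> meeting every even set of bounded diameter in an
  even number of edges has even size. Counting \<open>\<psi>\<close> along the rays in the direction of a translation
  gives a potential \<open>\<phi>\<close> on the vertices whose differences along edges are \<open>\<psi>\<close>. The full lines carry the
  total 0 because a line far away does, so \<open>\<phi>\<close> has finite support, and the size of \<open>\<psi>\<close> is, modulo 2, the
  sum of the degrees over that support.

  \<^item> Removing even sets that lie in balls with far apart centres keeps the graph coverable, with a larger
  \<open>L\<close> (\<open>coverable_remove\<close>): in a sum that covers a removed set \<open>D\<close>, the summands touching \<open>D\<close> add up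
  to an even set that contains \<open>D\<close>, and \<open>D\<close> can be subtracted from it.

  So one proceeds in levels, with \<open>L\<close> multiplied by 12 each time. At every level the centres are the
  vertices whose label is largest within a certain radius, and around every centre an even set is
  removed that contains all remaining edges of a ball of comparable radius. All choices depend only on the
  order of the labels in a bounded window, which gives equivariance, measurability and finitarity at
  once (\<open>arcs_transfer\<close>). Since balls grow quadratically, an edge is caught at each level with
  a probability bounded below, nearly independently of the other levels, so almost surely every
  edge is caught (\<open>AE_exists_peak\<close>, \<open>AE_good\<close>).
\<close>

section \<open>Even edge sets and their sums\<close>

lemma sum_sym_diff:
  fixes f :: "'e \<Rightarrow> bit"
  assumes "finite A" "finite B"
  shows "sum f (sym_diff A B) = sum f A + sum f B"
proof -
  have "sum f A = sum f (A - B) + sum f (A \<inter> B)"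
    using assms by (metis finite_Diff sum.Int_Diff add.commute)
  moreover have "sum f B = sum f (B - A) + sum f (A \<inter> B)"
    using assms by (metis finite_Diff sum.Int_Diff add.commute Int_commute)
  moreover have "sum f (sym_diff A B) = sum f (A - B) + sum f (B - A)"
    using assms by (intro sum.union_disjoint) auto
  moreover have "sum f (A \<inter> B) + sum f (A \<inter> B) = 0"
    by (cases "sum f (A \<inter> B)") auto
  ultimately show ?thesis
    by (metis (no_types, lifting) add.assoc add.commute add.right_neutral)
qed

lemma even_iff_of_nat_bit: "even n \<longleftrightarrow> of_nat n = (0::bit)"
  by (metis bit_not_zero_iff even_of_nat even_zero odd_one of_nat_eq_0_iff zero_neq_one)

text \<open>
  The boundary of a chain with coefficients in the field with two elements. The type \<^typ>\<open>bit\<close> rather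
  than a parity predicate makes sums over edges and vertices commute. The finite even sets are the chains
  without boundary, that is, the cycle space.
\<close>

definition bdry :: "'a set set \<Rightarrow> 'a \<Rightarrow> bit" where
  "bdry c v = (\<Sum>e\<in>c. of_bool (v \<in> e))"

definition cyc :: "'a set set \<Rightarrow> bool" where
  "cyc c \<longleftrightarrow> finite c \<and> (\<forall>v. bdry c v = 0)"

lemma bdry_empty [simp]: "bdry {} v = 0"
  by (simp add: bdry_def)

lemma bdry_sym_diff: "finite A \<Longrightarrow> finite B \<Longrightarrow> bdry (sym_diff A B) v = bdry A v + bdry B v"
  unfolding bdry_def by (rule sum_sym_diff)

lemma cyc_sym_diff: "cyc A \<Longrightarrow> cyc B \<Longrightarrow> cyc (sym_diff A B)"
  by (auto simp: cyc_def bdry_sym_diff)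

lemma cyc_empty [simp]: "cyc {}"
  by (simp add: cyc_def)

lemma cyc_diff:
  assumes "cyc A" "cyc B" "B \<subseteq> A"
  shows "cyc (A - B)"
proof -
  have "sym_diff A B = A - B" using assms(3) by auto
  then show ?thesis using cyc_sym_diff[OF assms(1,2)] by simp
qed

text \<open>
  The subspace spanned by a family of sets, with symmetric difference as addition.
\<close>

inductive_set cspan :: "'e set set \<Rightarrow> 'e set set" for W where
  cspan_empty: "{} \<in> cspan W"
| cspan_add: "c \<in> W \<Longrightarrow> X \<in> cspan W \<Longrightarrow> sym_diff c X \<in> cspan W"

lemma cspan_base: "c \<in> W \<Longrightarrow> c \<in> cspan W"
  using cspan_add[OF _ cspan_empty, of c W] by simp

lemma cspan_sym_diff:
  assumes "X \<in> cspan W" "Y \<in> cspan W"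
  shows "sym_diff X Y \<in> cspan W"
  using assms(1)
proof induction
  case (cspan_add c X)
  have "sym_diff (sym_diff c X) Y = sym_diff c (sym_diff X Y)" by blast
  then show ?case using cspan_add cspan.cspan_add[of c W "sym_diff X Y"] by simp
qed (use assms(2) in simp)

lemma cspan_Union_subset: "X \<in> cspan W \<Longrightarrow> X \<subseteq> \<Union>W"
  by (induction rule: cspan.induct) auto

lemma cspan_cyc: "X \<in> cspan W \<Longrightarrow> (\<And>c. c \<in> W \<Longrightarrow> cyc c) \<Longrightarrow> cyc X"
  by (induction rule: cspan.induct) (auto intro: cyc_sym_diff)

lemma cspan_disjoint_UN:
  assumes "finite I" "\<And>i. i \<in> I \<Longrightarrow> d i \<in> cspan W"
    and "\<And>i j. i \<in> I \<Longrightarrow> j \<in> I \<Longrightarrow> i \<noteq> j \<Longrightarrow> d i \<inter> d j = {}"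
  shows "(\<Union>i\<in>I. d i) \<in> cspan W"
  using assms
proof (induction I)
  case (insert i I)
  have dj: "d i \<inter> (\<Union>i\<in>I. d i) = {}" using insert.hyps(2) insert.prems(2) by blast
  have "(\<Union>i\<in>I. d i) \<in> cspan W" using insert by (metis insertCI)
  then have "sym_diff (d i) (\<Union>i\<in>I. d i) \<in> cspan W"
    using cspan_sym_diff insert.prems(1) by blast
  moreover have "sym_diff (d i) (\<Union>i\<in>I. d i) = (\<Union>j\<in>insert i I. d j)"
    using dj by auto
  ultimately show ?case by simp
qed (auto intro: cspan.intros)

text \<open>
  Summands that miss \<open>C\<close> do not change the trace on \<open>C\<close>, so a sum that covers \<open>C\<close> can be kept close to \<open>C\<close>.
\<close>

lemma cspan_touching:
  assumes "X \<in> cspan W"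
  shows "\<exists>Y \<in> cspan {c \<in> W. c \<inter> C \<noteq> {}}. Y \<inter> C = X \<inter> C"
  using assms
proof induction
  case cspan_empty
  show ?case using cspan.cspan_empty by blast
next
  case (cspan_add c X)
  then obtain Y where Y: "Y \<in> cspan {c \<in> W. c \<inter> C \<noteq> {}}" "Y \<inter> C = X \<inter> C" by blast
  show ?case
  proof (cases "c \<inter> C = {}")
    case True
    then show ?thesis using Y by (intro bexI[of _ Y]) auto
  next
    case False
    then have "sym_diff c Y \<in> cspan {c \<in> W. c \<inter> C \<noteq> {}}"
      using cspan_add.hyps Y(1) by (intro cspan.cspan_add) auto
    then show ?thesis using Y(2) by (intro bexI[of _ "sym_diff c Y"]) auto
  qed
qed

text \<open>
  The all-one vector of \<open>C\<close> is a trace of the span unless some \<open>\<psi> \<subseteq> C\<close> of odd size is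
  orthogonal to the span. A minimal subset of \<open>C\<close> that is not covered serves as \<open>\<psi>\<close>: minimality makes all
  its subsets with one point missing traces, hence all its even subsets, and an odd trace would then
  produce the whole set.
\<close>

lemma cspan_cover_duality:
  assumes "finite C"
    and dual: "\<And>\<psi>. \<psi> \<subseteq> C \<Longrightarrow> (\<forall>X \<in> cspan W. even (card (\<psi> \<inter> X))) \<Longrightarrow> even (card \<psi>)"
  shows "\<exists>X \<in> cspan W. C \<subseteq> X"
proof (rule ccontr)
  assume nc: "\<not> ?thesis"
  define covered where "covered = (\<lambda>S. \<exists>X \<in> cspan W. S \<subseteq> X)"
  have "finite {S. S \<subseteq> C \<and> \<not> covered S}"
    by (rule finite_subset[of _ "Pow C"]) (use assms(1) in auto)
  moreover have "{S. S \<subseteq> C \<and> \<not> covered S} \<noteq> {}" using nc by (auto simp: covered_def)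
  ultimately have "\<exists>S\<in>{S. S \<subseteq> C \<and> \<not> covered S}. \<forall>T\<in>{S. S \<subseteq> C \<and> \<not> covered S}. T \<subseteq> S \<longrightarrow> S = T"
    by (rule finite_has_minimal)
  then obtain S where S': "S \<subseteq> C" "\<not> covered S"
    and min': "\<And>T. T \<subseteq> C \<Longrightarrow> \<not> covered T \<Longrightarrow> T \<subseteq> S \<Longrightarrow> S = T"
    by auto
  have nocover: "\<And>X. X \<in> cspan W \<Longrightarrow> S \<subseteq> X \<Longrightarrow> False" using S'(2) by (auto simp: covered_def)
  have min: "\<exists>X \<in> cspan W. T \<subseteq> X" if "T \<subset> S" for T
    using min'[of T] that S'(1) unfolding covered_def by fast
  have finS: "finite S" using S'(1) assms(1) by (rule finite_subset)
  have one: "\<exists>X \<in> cspan W. S \<inter> X = S - {x}" if "x \<in> S" for x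
  proof -
    have "S - {x} \<subset> S" using that by auto
    then obtain X where X: "X \<in> cspan W" "S - {x} \<subseteq> X" using min by meson
    have "x \<notin> X"
    proof
      assume "x \<in> X"
      then have "S \<subseteq> X" using X(2) by auto
      then show False by (rule nocover[OF X(1)])
    qed
    then have "S \<inter> X = S - {x}" using X(2) by auto
    then show ?thesis using X(1) by (rule_tac bexI[of _ X])
  qed
  have evens: "card A = 2 * n \<Longrightarrow> A \<subseteq> S \<Longrightarrow> \<exists>X \<in> cspan W. S \<inter> X = A" for n A
  proof (induction n arbitrary: A)
    case 0
    then have "A = {}" using finite_subset finS by fastforce
    then show ?case using cspan.cspan_empty by fastforce
  next
    case (Suc n)
    then obtain x where x: "x \<in> A" by fastforce
    then have "card (A - {x}) = 2 * n + 1" using Suc.prems finS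
      by (simp add: card_Diff_singleton)
    then have "A - {x} \<noteq> {}" by (metis add_is_0 card.empty one_neq_zero)
    then obtain y where y: "y \<in> A - {x}" by blast
    have "card (A - {x} - {y}) = 2 * n" 
      using y \<open>card (A - {x}) = 2 * n + 1\<close> by (subst card_Diff_singleton) auto
    then obtain Z where Z: "Z \<in> cspan W" "S \<inter> Z = A - {x} - {y}"
      using Suc.IH Suc.prems(2) by blast
    obtain X where X: "X \<in> cspan W" "S \<inter> X = S - {x}" using one x Suc.prems(2) by blast
    obtain Y where Y: "Y \<in> cspan W" "S \<inter> Y = S - {y}" using one y Suc.prems(2) by blast
    have "S \<inter> sym_diff (sym_diff X Y) Z = sym_diff (sym_diff (S \<inter> X) (S \<inter> Y)) (S \<inter> Z)" by blast
    also have "\<dots> = A" using x y Suc.prems(2) unfolding X(2) Y(2) Z(2) by auto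
    finally have "S \<inter> sym_diff (sym_diff X Y) Z = A" .
    moreover have "sym_diff (sym_diff X Y) Z \<in> cspan W"
      by (rule cspan_sym_diff[OF cspan_sym_diff[OF X(1) Y(1)] Z(1)])
    ultimately show ?case by (rule_tac bexI)
  qed
  have odd: "odd (card S)"
  proof
    assume "even (card S)"
    then obtain n where "card S = 2 * n" by blast
    then obtain X where X: "X \<in> cspan W" "S \<inter> X = S" using evens by blast
    show False by (rule nocover[OF X(1)]) (use X(2) in blast)
  qed
  moreover have "even (card (S \<inter> X))" if X: "X \<in> cspan W" for X
  proof (rule ccontr)
    assume o: "odd (card (S \<inter> X))"
    have "card S = card (S \<inter> X) + card (S - X)"
      using finS by (metis card_Int_Diff)
    then have "even (card (S - X))" using o odd by auto
    then obtain n where "card (S - X) = 2 * n" by blast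
    then obtain Y where Y: "Y \<in> cspan W" "S \<inter> Y = S - X" using evens by blast
    have "S \<subseteq> sym_diff X Y" using Y(2) by blast
    then show False by (rule nocover[OF cspan_sym_diff[OF X Y(1)]])
  qed
  ultimately show False using dual[OF S'(1)] by blast
qed

section \<open>Finite even edge sets have balanced orientations\<close>

definition undirected :: "('a \<times> 'a) set \<Rightarrow> 'a set set" where
  "undirected A = (\<lambda>(x, y). {x, y}) ` A"

definition antisym_arcs :: "('a \<times> 'a) set \<Rightarrow> bool" where
  "antisym_arcs A \<longleftrightarrow> (\<forall>x y. (x, y) \<in> A \<longrightarrow> (y, x) \<notin> A)"

definition flow :: "('a \<times> 'a) set \<Rightarrow> bool" where
  "flow A \<longleftrightarrow> finite A \<and> antisym_arcs A \<and>
     (\<forall>v. card {u. (u, v) \<in> A} = card {u. (v, u) \<in> A})"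

lemma undirected_pair_iff: "{x, y} \<in> undirected A \<longleftrightarrow> (x, y) \<in> A \<or> (y, x) \<in> A"
  by (auto simp: undirected_def doubleton_eq_iff image_iff split: prod.splits)

lemma finite_fibres:
  assumes "finite A"
  shows "finite {u. (u, v) \<in> A}" "finite {u. (v, u) \<in> A}"
proof -
  show "finite {u. (u, v) \<in> A}"
    by (rule finite_subset[of _ "fst ` A"]) (use assms in \<open>auto simp: image_iff\<close>, force)
  show "finite {u. (v, u) \<in> A}"
    by (rule finite_subset[of _ "snd ` A"]) (use assms in \<open>auto simp: image_iff\<close>, force)
qed

lemma bdry_undirected:
  assumes "finite A" "antisym_arcs A"
  shows "bdry (undirected A) v = of_nat (card {u. (u, v) \<in> A} + card {u. (v, u) \<in> A})"
proof -
  have inj: "inj_on (\<lambda>(x, y). {x, y}) A"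
    using assms(2) by (auto simp: inj_on_def antisym_arcs_def doubleton_eq_iff)
  have "bdry (undirected A) v = (\<Sum>a\<in>A. of_bool (v \<in> (case a of (x, y) \<Rightarrow> {x, y})))"
    unfolding bdry_def undirected_def by (subst sum.reindex[OF inj]) simp
  also have "\<dots> = of_nat (card {a \<in> A. v \<in> (case a of (x, y) \<Rightarrow> {x, y})})"
    using assms(1) by (simp add: of_bool_def sum.If_cases Int_def)
  also have "{a \<in> A. v \<in> (case a of (x, y) \<Rightarrow> {x, y})} =
      (\<lambda>u. (u, v)) ` {u. (u, v) \<in> A} \<union> (\<lambda>u. (v, u)) ` {u. (v, u) \<in> A}"
    by auto
  also have "card \<dots> = card {u. (u, v) \<in> A} + card {u. (v, u) \<in> A}"
  proof (subst card_Un_disjoint)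
    show "(\<lambda>u. (u, v)) ` {u. (u, v) \<in> A} \<inter> (\<lambda>u. (v, u)) ` {u. (v, u) \<in> A} = {}"
      using assms(2) by (auto simp: antisym_arcs_def)
  qed (use finite_fibres[OF assms(1)] in \<open>auto simp: card_image inj_on_def\<close>)
  finally show ?thesis .
qed

lemma flow_undirected_cyc: "flow A \<Longrightarrow> cyc (undirected A)"
proof -
  assume f: "flow A"
  then have "bdry (undirected A) v = 0" for v
    by (subst bdry_undirected) (auto simp: flow_def even_iff_of_nat_bit[symmetric])
  then show ?thesis using f by (auto simp: cyc_def undirected_def flow_def)
qed

text \<open>
  A maximal partial orientation that looks like a trail from \<open>s\<close> to \<open>t\<close>, as far as in- and outdegrees are
  concerned, is everything: while \<open>s \<noteq> t\<close> or an edge is left, one more arc can be attached at \<open>t\<close>. The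
  oriented edges need not be connected, so a new trail may begin anywhere once \<open>s = t\<close>.
\<close>

theorem cyc_has_flow:
  assumes "cyc X" and two: "\<And>e. e \<in> X \<Longrightarrow> \<exists>x y. x \<noteq> y \<and> e = {x, y}"
  shows "\<exists>A. flow A \<and> undirected A = X"
proof -
  define trail where "trail = (\<lambda>A s t. finite A \<and> antisym_arcs A \<and> undirected A \<subseteq> X \<and>
     (\<forall>v. int (card {u. (v, u) \<in> A}) - int (card {u. (u, v) \<in> A}) = of_bool (v = s) - of_bool (v = t)))"
  have finX: "finite X" and bX: "\<And>v. bdry X v = 0" using assms(1) by (auto simp: cyc_def)
  have extend: "trail (insert (t, u) A) s u"
    if tr: "trail A s t" and e: "{t, u} \<in> X" "{t, u} \<notin> undirected A" for A s t u
  proof -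
    from tr have A: "finite A" "antisym_arcs A" "undirected A \<subseteq> X"
      and bal: "\<And>v. int (card {u. (v, u) \<in> A}) - int (card {u. (u, v) \<in> A}) = of_bool (v = s) - of_bool (v = t)"
      by (auto simp: trail_def)
    have tu: "t \<noteq> u" using two[OF e(1)] by (auto simp: doubleton_eq_iff)
    have new: "(t, u) \<notin> A" "(u, t) \<notin> A" using e(2) by (auto simp: undirected_pair_iff)
    have o: "card {w. (v, w) \<in> insert (t, u) A} = card {w. (v, w) \<in> A} + of_bool (v = t)" for v
    proof (cases "v = t")
      case True
      then have "{w. (v, w) \<in> insert (t, u) A} = insert u {w. (v, w) \<in> A}" by auto
      then show ?thesis using True new finite_fibres[OF A(1)] by (simp add: card_insert_if)
    qed auto
    have i: "card {w. (w, v) \<in> insert (t, u) A} = card {w. (w, v) \<in> A} + of_bool (v = u)" for v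
    proof (cases "v = u")
      case True
      then have "{w. (w, v) \<in> insert (t, u) A} = insert t {w. (w, v) \<in> A}" by auto
      then show ?thesis using True new finite_fibres[OF A(1)] by (simp add: card_insert_if)
    qed auto
    have "int (card {w. (v, w) \<in> insert (t, u) A}) - int (card {w. (w, v) \<in> insert (t, u) A})
        = of_bool (v = s) - of_bool (v = u)" for v
      using bal[of v] unfolding o i by simp
    moreover have "antisym_arcs (insert (t, u) A)"
      using A(2) new tu by (auto simp: antisym_arcs_def)
    ultimately show ?thesis using A e(1) by (auto simp: trail_def undirected_def)
  qed
  have card_undirected: "card (undirected A) = card A" if "antisym_arcs A" for A :: "('a \<times> 'a) set"
    unfolding undirected_def by (rule card_image)
      (use that in \<open>auto simp: inj_on_def antisym_arcs_def doubleton_eq_iff\<close>)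
  let ?P = "\<lambda>n. \<exists>A s t. trail A s t \<and> card A = n"
  have ex0: "?P 0"
    by (intro exI[of _ "{}"] exI) (auto simp: trail_def antisym_arcs_def undirected_def)
  have bound: "n \<le> card X" if "?P n" for n
    using that card_undirected card_mono[OF finX] unfolding trail_def by metis
  obtain N where N: "?P N" "\<And>n. ?P n \<Longrightarrow> n \<le> N"
    using Greatest_le_nat[of ?P _ "card X"] GreatestI_ex_nat[of ?P "card X"] ex0 bound by blast
  then obtain A s t where tr: "trail A s t" "card A = N" by blast
  have A: "finite A" "antisym_arcs A" "undirected A \<subseteq> X"
    and bal: "\<And>v. int (card {u. (v, u) \<in> A}) - int (card {u. (u, v) \<in> A}) = of_bool (v = s) - of_bool (v = t)"
    using tr(1) by (auto simp: trail_def)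
  have maximal: False if "{t, u} \<in> X" "{t, u} \<notin> undirected A" "trail A s' t" for u s'
  proof -
    have "(t, u) \<notin> A" using that(2) by (auto simp: undirected_pair_iff)
    then have "card (insert (t, u) A) = Suc N" using tr(2) A(1) by simp
    then show False using extend[OF that(3,1,2)] N(2) by (metis Suc_n_not_le_n)
  qed
  have st: "s = t"
  proof (rule ccontr)
    assume "s \<noteq> t"
    then have "int (card {u. (u, t) \<in> A}) = int (card {u. (t, u) \<in> A}) + 1"
      using bal[of t] by simp
    then have "odd (card {u. (u, t) \<in> A} + card {u. (t, u) \<in> A})" by presburger
    then have "bdry (undirected A) t \<noteq> bdry X t"
      using bdry_undirected[OF A(1,2), of t] bX by (simp add: even_iff_of_nat_bit)
    then have "\<not> {e \<in> X. t \<in> e} \<subseteq> undirected A"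
    proof (rule contrapos_nn)
      assume "{e \<in> X. t \<in> e} \<subseteq> undirected A"
      then show "bdry (undirected A) t = bdry X t"
        unfolding bdry_def using A(3) finX by (intro sum.mono_neutral_left) auto
    qed
    then obtain e where e: "e \<in> X" "t \<in> e" "e \<notin> undirected A" by blast
    then obtain u where "e = {t, u}" using two[OF e(1)] by auto
    then show False using maximal[OF _ _ tr(1)] e by blast
  qed
  have "undirected A = X"
  proof (rule ccontr)
    assume "undirected A \<noteq> X"
    then obtain e where e: "e \<in> X" "e \<notin> undirected A" using A(3) by blast
    then obtain x y where xy: "e = {x, y}" using two by blast
    have tx: "trail A x x" using tr(1) st by (auto simp: trail_def)
    have "(x, y) \<notin> A" using e xy by (auto simp: undirected_pair_iff)
    then have "card (insert (x, y) A) = Suc N" using tr(2) A(1) by simp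
    then show False using extend[OF tx] e xy N(2) by (metis Suc_n_not_le_n)
  qed
  moreover have "flow A" using A bal st by (auto simp: flow_def)
  ultimately show ?thesis by blast
qed

section \<open>Locally finite graphs in which finite edge sets can be covered\<close>

locale lf_graph =
  fixes V :: "'a set" and F :: "'a set set"
  assumes edges: "e \<in> F \<Longrightarrow> \<exists>x\<in>V. \<exists>y\<in>V. x \<noteq> y \<and> e = {x, y}"
    and connected: "connected_graph V F"
    and locally_finite: "locally_finite_graph V F"
begin

abbreviation gball :: "'a \<Rightarrow> nat \<Rightarrow> 'a set" where
  "gball x R \<equiv> graph_ball F x R"

lemma edge_in_V: "{x, y} \<in> F \<Longrightarrow> x \<in> V \<and> y \<in> V \<and> x \<noteq> y"
  using edges[of "{x, y}"] by (auto simp: doubleton_eq_iff)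

lemma edge_nonempty: "e \<in> F \<Longrightarrow> e \<noteq> {}"
  using edges by blast

lemma adj_sym: "(x, y) \<in> adj_rel F \<Longrightarrow> (y, x) \<in> adj_rel F"
  by (simp add: adj_rel_def insert_commute)

lemma adj_pow_sym: "(x, y) \<in> adj_rel F ^^ n \<Longrightarrow> (y, x) \<in> adj_rel F ^^ n"
proof (induction n arbitrary: y)
  case (Suc n)
  then obtain z where "(x, z) \<in> adj_rel F ^^ n" "(z, y) \<in> adj_rel F" by auto
  then have "(z, x) \<in> adj_rel F ^^ n" "(y, z) \<in> adj_rel F" using Suc.IH adj_sym by auto
  then show ?case by (rule_tac relpow_Suc_I2)
qed simp

lemma ball_refl [simp]: "x \<in> gball x R"
  by (auto simp: graph_ball_def intro: exI[of _ 0])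

lemma ball_sym: "y \<in> gball x R \<Longrightarrow> x \<in> gball y R"
  using adj_pow_sym by (auto simp: graph_ball_def)

lemma ball_mono: "y \<in> gball x R \<Longrightarrow> R \<le> S \<Longrightarrow> y \<in> gball x S"
  by (auto simp: graph_ball_def) (meson le_trans)

lemma ball_trans: "y \<in> gball x R \<Longrightarrow> z \<in> gball y S \<Longrightarrow> z \<in> gball x (R + S)"
proof -
  assume "y \<in> gball x R" "z \<in> gball y S"
  then obtain m n where "m \<le> R" "(x, y) \<in> adj_rel F ^^ m" "n \<le> S" "(y, z) \<in> adj_rel F ^^ n"
    by (auto simp: graph_ball_def)
  then have "(x, z) \<in> adj_rel F ^^ (m + n)" "m + n \<le> R + S" by (auto simp: relpow_add)
  then show ?thesis by (auto simp: graph_ball_def)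
qed

lemma ball_trans_le: "y \<in> gball x R \<Longrightarrow> z \<in> gball y S \<Longrightarrow> R + S \<le> T \<Longrightarrow> z \<in> gball x T"
  using ball_trans ball_mono by blast

lemma ball_0 [simp]: "gball x 0 = {x}"
  by (auto simp: graph_ball_def)

lemma ball_Suc: "gball x (Suc R) = gball x R \<union> (\<Union>y\<in>gball x R. {z. {y, z} \<in> F})"
proof (intro equalityI subsetI)
  fix z assume "z \<in> gball x (Suc R)"
  then obtain n where n: "n \<le> Suc R" "(x, z) \<in> adj_rel F ^^ n" by (auto simp: graph_ball_def)
  show "z \<in> gball x R \<union> (\<Union>y\<in>gball x R. {z. {y, z} \<in> F})"
  proof (cases n)
    case 0
    then show ?thesis using n by simp
  next
    case (Suc m)
    then obtain y where "(x, y) \<in> adj_rel F ^^ m" "(y, z) \<in> adj_rel F" using n by auto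
    then show ?thesis using n Suc by (auto simp: graph_ball_def adj_rel_def)
  qed
next
  fix z assume "z \<in> gball x R \<union> (\<Union>y\<in>gball x R. {z. {y, z} \<in> F})"
  then show "z \<in> gball x (Suc R)"
  proof
    assume "z \<in> (\<Union>y\<in>gball x R. {z. {y, z} \<in> F})"
    then obtain y where "y \<in> gball x R" "(y, z) \<in> adj_rel F" by (auto simp: adj_rel_def)
    then have "y \<in> gball x R" "z \<in> gball y 1" by (auto simp: graph_ball_def intro!: exI[of _ 1])
    then show ?thesis using ball_trans by fastforce
  qed (auto intro: ball_mono)
qed

lemma ball_edge: "{x, y} \<in> F \<Longrightarrow> y \<in> gball x 1"
  using ball_Suc[of x 0] by auto

lemma ball_edge': "e \<in> F \<Longrightarrow> x \<in> e \<Longrightarrow> e \<subseteq> gball x 1"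
proof -
  assume e: "e \<in> F" "x \<in> e"
  then obtain u v where "e = {u, v}" using edges by blast
  then show ?thesis using e ball_edge[of u v] ball_edge[of v u] by (auto simp: insert_commute)
qed

lemma ball_subset_V: "x \<in> V \<Longrightarrow> gball x R \<subseteq> V"
  by (induction R) (auto simp: ball_Suc dest: edge_in_V)

lemma finite_nbrs: "finite {z. {y, z} \<in> F}"
proof (cases "y \<in> V")
  case True
  then have "finite {e \<in> F. y \<in> e}" using locally_finite by (auto simp: locally_finite_graph_def)
  moreover have "(\<lambda>z. {y, z}) ` {z. {y, z} \<in> F} \<subseteq> {e \<in> F. y \<in> e}" by auto
  moreover have "inj_on (\<lambda>z. {y, z}) {z. {y, z} \<in> F}" by (auto simp: inj_on_def doubleton_eq_iff)
  ultimately show ?thesis by (meson finite_subset inj_on_finite)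
next
  case False
  then have "{z. {y, z} \<in> F} = {}" using edge_in_V by blast
  then show ?thesis by simp
qed

lemma finite_ball [simp]: "finite (gball x R)"
  by (induction R) (simp_all add: ball_Suc finite_nbrs)

lemma ball_connects:
  assumes "x \<in> V" "y \<in> V"
  shows "\<exists>R. y \<in> gball x R"
proof -
  have "(x, y) \<in> (adj_rel F)\<^sup>*" using connected assms by (auto simp: connected_graph_def)
  then obtain n where "(x, y) \<in> adj_rel F ^^ n" using rtrancl_imp_relpow by blast
  then show ?thesis by (auto simp: graph_ball_def)
qed

lemma finite_edges_within: "finite B \<Longrightarrow> finite {e \<in> F. e \<subseteq> B}"
  by (rule finite_subset[of _ "Pow B"]) auto

definition short_cycles :: "'a set set \<Rightarrow> nat \<Rightarrow> 'a set set set" where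
  "short_cycles H L = {c. cyc c \<and> c \<subseteq> H \<and> (\<forall>u \<in> \<Union>c. \<forall>v \<in> \<Union>c. v \<in> gball u L)}"

text \<open>
  This is the invariant that survives the successive removal of even sets. Distances are always
  those of the whole graph, also when \<open>H\<close> is only a part of its edges.
\<close>

definition coverable :: "nat \<Rightarrow> 'a set set \<Rightarrow> bool" where
  "coverable L H \<longleftrightarrow> (\<forall>C. finite C \<longrightarrow> C \<subseteq> H \<longrightarrow> (\<exists>X \<in> cspan (short_cycles H L). C \<subseteq> X))"

lemma short_cycles_mono: "L \<le> L' \<Longrightarrow> H \<subseteq> H' \<Longrightarrow> short_cycles H L \<subseteq> short_cycles H' L'"
  unfolding short_cycles_def using ball_mono by blast

lemma coverable_near:
  assumes "coverable L H" "H \<subseteq> F"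
  shows "\<exists>X. cyc X \<and> X \<subseteq> H \<and> {e \<in> H. e \<subseteq> gball z r} \<subseteq> X \<and> (\<forall>e\<in>X. e \<subseteq> gball z (r + L))"
proof -
  let ?C = "{e \<in> H. e \<subseteq> gball z r}"
  have "finite ?C" using finite_edges_within[OF finite_ball, of z r] assms(2)
    by (auto intro: rev_finite_subset)
  then obtain X where X: "X \<in> cspan (short_cycles H L)" "?C \<subseteq> X"
    using assms(1) unfolding coverable_def by blast
  obtain Y where Y: "Y \<in> cspan {c \<in> short_cycles H L. c \<inter> ?C \<noteq> {}}" "Y \<inter> ?C = X \<inter> ?C"
    using cspan_touching[OF X(1), of ?C] by blast
  have "cyc Y" using cspan_cyc[OF Y(1)] by (auto simp: short_cycles_def)
  moreover have sub: "Y \<subseteq> \<Union>{c \<in> short_cycles H L. c \<inter> ?C \<noteq> {}}" by (rule cspan_Union_subset[OF Y(1)])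
  moreover from sub have "Y \<subseteq> H" by (auto simp: short_cycles_def)
  moreover have "?C \<subseteq> Y" using X(2) Y(2) by blast
  moreover have "e \<subseteq> gball z (r + L)" if "e \<in> Y" for e
  proof
    fix v assume v: "v \<in> e"
    obtain c f where c: "c \<in> short_cycles H L" "e \<in> c" "f \<in> c" "f \<in> ?C"
      using sub \<open>e \<in> Y\<close> by blast
    obtain u where u: "u \<in> f" using c(4) assms(2) edge_nonempty by blast
    have "v \<in> gball u L" using c(1,2,3) u v unfolding short_cycles_def by blast
    moreover have "u \<in> gball z r" using c(4) u by blast
    ultimately show "v \<in> gball z (r + L)" by (rule_tac ball_trans)
  qed
  ultimately show ?thesis by (intro exI[of _ Y]) blast
qed

text \<open>
  A sum that covers a finite set and all removed sets \<open>D z\<close> near it splits into summands that avoid the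
  removed sets and, for each \<open>z\<close>, the partial sum \<open>g z\<close> of those that touch \<open>D z\<close>. The separation keeps the
  \<open>g z\<close> disjoint, so \<open>g z\<close> contains \<open>D z\<close> if the whole sum does, and \<open>g z - D z\<close> is an even
  set that is still available. The \<open>g z\<close> with \<open>z\<close> far away can be dropped.
\<close>

lemma coverable_remove:
  assumes H: "H \<subseteq> F" and cov: "coverable L H"
    and D: "\<And>z. z \<in> Z \<Longrightarrow> cyc (D z)" "\<And>z. z \<in> Z \<Longrightarrow> D z \<subseteq> H"
      "\<And>z e. z \<in> Z \<Longrightarrow> e \<in> D z \<Longrightarrow> e \<subseteq> gball z (r + L)"
    and sep: "\<And>z z'. z \<in> Z \<Longrightarrow> z' \<in> Z \<Longrightarrow> z' \<in> gball z (2 * (r + 2 * L)) \<Longrightarrow> z = z'"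
  shows "coverable (2 * (r + 2 * L)) (H - (\<Union>z\<in>Z. D z))"
  unfolding coverable_def
proof (intro allI impI)
  let ?H' = "H - (\<Union>z\<in>Z. D z)" and ?L' = "2 * (r + 2 * L)"
  fix C assume finC: "finite C" and C: "C \<subseteq> ?H'"
  define N where "N = (\<lambda>z. {e \<in> F. e \<subseteq> gball z (r + 2 * L)})"
  have N_uniq: "z = z'" if zz: "z \<in> Z" "z' \<in> Z" "e \<in> N z" "e \<in> N z'" for z z' e
  proof -
    obtain u where "u \<in> e" using edge_nonempty zz(3) unfolding N_def by blast
    then have "u \<in> gball z (r + 2 * L)" "z' \<in> gball u (r + 2 * L)"
      using that ball_sym unfolding N_def by blast+
    then have "z' \<in> gball z ?L'" by (rule ball_trans_le) simp
    then show ?thesis using sep that by blast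
  qed
  have DN: "D z \<subseteq> N z" if "z \<in> Z" for z
  proof
    fix e assume e: "e \<in> D z"
    then have "e \<subseteq> gball z (r + L)" using D(3) that by blast
    then have "e \<subseteq> gball z (r + 2 * L)" using ball_mono[of _ z "r + L" "r + 2 * L"] by auto
    then show "e \<in> N z" using D(2)[OF that] H e by (auto simp: N_def)
  qed
  have near: "c \<subseteq> N z" if zc: "z \<in> Z" "c \<in> short_cycles H L" "c \<inter> D z \<noteq> {}" for c z
  proof
    fix e assume e: "e \<in> c"
    obtain f where f: "f \<in> c" "f \<in> D z" using zc(3) by blast
    obtain u where u: "u \<in> f" using f D(2)[OF zc(1)] H edge_nonempty by blast
    have "v \<in> gball z (r + 2 * L)" if v: "v \<in> e" for v
    proof -
      have "u \<in> gball z (r + L)" using D(3)[OF \<open>z \<in> Z\<close> f(2)] u by blast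
      moreover have "v \<in> gball u L" using \<open>c \<in> short_cycles H L\<close> e f(1) u v unfolding short_cycles_def by blast
      ultimately show ?thesis by (rule ball_trans_le) simp
    qed
    then show "e \<in> N z" using e that(2) H by (auto simp: N_def short_cycles_def)
  qed
  \<comment> \<open>The part \<open>Y\<close> uses remaining edges only, and \<open>g z\<close> collects the summands that touch \<open>D z\<close>.\<close>
  have decomp: "\<exists>Y g. Y \<in> cspan (short_cycles ?H' ?L') \<and> (\<forall>z\<in>Z. g z \<subseteq> N z \<inter> H \<and> cyc (g z)) \<and>
      X = sym_diff Y (\<Union>z\<in>Z. g z)" if "X \<in> cspan (short_cycles H L)" for X
    using that
  proof induction
    case cspan_empty
    show ?case by (intro exI[of _ "{}"] exI[of _ "\<lambda>_. {}"]) (auto intro: cspan.cspan_empty)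
  next
    case (cspan_add c X)
    then obtain Y g where Y: "Y \<in> cspan (short_cycles ?H' ?L')"
      and g: "\<And>z. z \<in> Z \<Longrightarrow> g z \<subseteq> N z \<inter> H" "\<And>z. z \<in> Z \<Longrightarrow> cyc (g z)"
      and X: "X = sym_diff Y (\<Union>z\<in>Z. g z)" by blast
    show ?case
    proof (cases "c \<inter> (\<Union>z\<in>Z. D z) = {}")
      case True
      have "c \<in> short_cycles ?H' L" using cspan_add.hyps(1) True by (auto simp: short_cycles_def)
      then have "c \<in> short_cycles ?H' ?L'" using short_cycles_mono[of L ?L' ?H' ?H'] by auto
      then have "sym_diff c Y \<in> cspan (short_cycles ?H' ?L')" using Y by (rule cspan.cspan_add)
      moreover have "sym_diff c X = sym_diff (sym_diff c Y) (\<Union>z\<in>Z. g z)" unfolding X by blast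
      ultimately show ?thesis using g by (intro exI[of _ "sym_diff c Y"] exI[of _ g]) blast
    next
      case False
      then obtain z where z: "z \<in> Z" "c \<inter> D z \<noteq> {}" by blast
      have cN: "c \<subseteq> N z" using near z cspan_add.hyps(1) by blast
      have c: "cyc c" "c \<subseteq> H" using cspan_add.hyps(1) by (auto simp: short_cycles_def)
      define g' where "g' = g(z := sym_diff c (g z))"
      have off: "c \<inter> (\<Union>w\<in>Z - {z}. g w) = {}"
        using cN g(1) N_uniq[OF z(1)] by fast
      have gz_off: "g z \<inter> (\<Union>w\<in>Z - {z}. g w) = {}"
        using g(1) N_uniq[OF z(1)] z(1) by fast
      have "(\<Union>w\<in>Z. g' w) = sym_diff c (g z) \<union> (\<Union>w\<in>Z - {z}. g w)"
        using z(1) by (auto simp: g'_def)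
      moreover have "(\<Union>w\<in>Z. g w) = g z \<union> (\<Union>w\<in>Z - {z}. g w)" using z(1) by auto
      ultimately have "(\<Union>w\<in>Z. g' w) = sym_diff c (\<Union>w\<in>Z. g w)" using off gz_off by auto
      then have "sym_diff c X = sym_diff Y (\<Union>w\<in>Z. g' w)" unfolding X by blast
      moreover have "\<forall>w\<in>Z. g' w \<subseteq> N w \<inter> H \<and> cyc (g' w)"
      proof
        fix w assume w: "w \<in> Z"
        show "g' w \<subseteq> N w \<inter> H \<and> cyc (g' w)"
        proof (cases "w = z")
          case True
          then show ?thesis using cN c g[OF z(1)] cyc_sym_diff[OF c(1) g(2)[OF z(1)]]
            by (auto simp: g'_def)
        next
          case False
          then show ?thesis using g[OF w] by (simp add: g'_def)
        qed
      qed
      ultimately show ?thesis using Y by (intro exI[of _ Y] exI[of _ g']) blast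
    qed
  qed
  \<comment> \<open>Only these removed sets can be touched by summands that matter for \<open>C\<close>.\<close>
  define I where "I = {z \<in> Z. N z \<inter> C \<noteq> {}}"
  have finI: "finite I"
  proof -
    have "I \<subseteq> (\<Union>e\<in>C. {z \<in> Z. e \<in> N z})" by (auto simp: I_def)
    moreover have "finite {z \<in> Z. e \<in> N z}" for e
    proof (cases "{z \<in> Z. e \<in> N z} = {}")
      case False
      then obtain z where "z \<in> Z" "e \<in> N z" by blast
      then have "{z \<in> Z. e \<in> N z} \<subseteq> {z}" using N_uniq by auto
      then show ?thesis using finite_subset by auto
    next
      case True
      then show ?thesis by (simp only: finite.emptyI)
    qed
    ultimately show ?thesis using finC by (meson finite_UN_I finite_subset)
  qed
  have "finite (C \<union> (\<Union>z\<in>I. D z))" using finC finI D(1) by (auto simp: I_def cyc_def)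
  moreover have "C \<union> (\<Union>z\<in>I. D z) \<subseteq> H" using C D(2) by (auto simp: I_def)
  ultimately obtain X where X: "X \<in> cspan (short_cycles H L)" "C \<union> (\<Union>z\<in>I. D z) \<subseteq> X"
    using cov unfolding coverable_def by meson
  then obtain Y g where Y: "Y \<in> cspan (short_cycles ?H' ?L')"
      and g: "\<And>z. z \<in> Z \<Longrightarrow> g z \<subseteq> N z \<inter> H" "\<And>z. z \<in> Z \<Longrightarrow> cyc (g z)"
      and XY: "X = sym_diff Y (\<Union>z\<in>Z. g z)" using decomp[OF X(1)] by blast
  have "Y \<subseteq> \<Union>(short_cycles ?H' ?L')" by (rule cspan_Union_subset[OF Y])
  then have YH: "Y \<subseteq> ?H'" unfolding short_cycles_def by blast
  have Dg: "D z \<subseteq> g z" if "z \<in> I" for z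
  proof
    fix e assume e: "e \<in> D z"
    have z: "z \<in> Z" using that by (simp add: I_def)
    have "e \<in> X" using X(2) e that by blast
    moreover have "e \<notin> Y" using YH e z by blast
    ultimately obtain w where w: "w \<in> Z" "e \<in> g w" unfolding XY by blast
    have "z = w" using N_uniq[OF z w(1)] e DN[OF z] g(1)[OF w(1)] w(2) by blast
    then show "e \<in> g z" using w(2) by simp
  qed
  have piece: "g z - D z \<in> short_cycles ?H' ?L'" if "z \<in> I" for z
  proof -
    have z: "z \<in> Z" using that by (simp add: I_def)
    have "cyc (g z - D z)" by (rule cyc_diff[OF g(2)[OF z] D(1)[OF z] Dg[OF that]])
    moreover have "e \<notin> D w" if "e \<in> g z" "e \<notin> D z" "w \<in> Z" for e w
      using N_uniq[OF z that(3), of e] g(1)[OF z] DN[OF that(3)] that by blast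
    then have "g z - D z \<subseteq> ?H'" using g(1)[OF z] by blast
    moreover have "v \<in> gball u ?L'" if "u \<in> \<Union>(g z - D z)" "v \<in> \<Union>(g z - D z)" for u v
    proof -
      have uv: "u \<in> gball z (r + 2 * L)" "v \<in> gball z (r + 2 * L)"
        using that g(1)[OF z] by (auto simp: N_def)
      show ?thesis by (rule ball_trans_le[OF ball_sym[OF uv(1)] uv(2)]) simp
    qed
    ultimately show ?thesis unfolding short_cycles_def by blast
  qed
  have disj: "(g z - D z) \<inter> (g w - D w) = {}" if "z \<in> I" "w \<in> I" "z \<noteq> w" for z w
    using N_uniq[of z w] g(1)[of z] g(1)[of w] that unfolding I_def by blast
  have "(\<Union>z\<in>I. g z - D z) \<in> cspan (short_cycles ?H' ?L')"
    by (rule cspan_disjoint_UN[OF finI]) (use piece cspan_base disj in auto)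
  then have "sym_diff Y (\<Union>z\<in>I. g z - D z) \<in> cspan (short_cycles ?H' ?L')"
    using Y cspan_sym_diff by auto
  moreover have "C \<subseteq> sym_diff Y (\<Union>z\<in>I. g z - D z)"
  proof
    fix e assume e: "e \<in> C"
    then have eD: "e \<notin> D w" if "w \<in> Z" for w using C that by blast
    have eX: "e \<in> X" using X(2) e by blast
    show "e \<in> sym_diff Y (\<Union>z\<in>I. g z - D z)"
    proof (cases "e \<in> Y")
      case True
      then have "e \<notin> (\<Union>z\<in>Z. g z)" using eX XY by blast
      then show ?thesis using True by (auto simp: I_def)
    next
      case False
      then obtain w where w: "w \<in> Z" "e \<in> g w" using eX XY by blast
      then have "w \<in> I" using g(1)[OF w(1)] e by (auto simp: I_def)
      then show ?thesis using False w eD by auto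
    qed
  qed
  ultimately show "\<exists>X \<in> cspan (short_cycles ?H' ?L'). C \<subseteq> X" by (rule_tac bexI)
qed

end

section \<open>Graphs with a translation are coverable\<close>

lemma bit_add_self_left [simp]: "(b::bit) + (b + c) = c"
  by (cases b; cases c) auto

lemma bit_square_sum: "((a::bit) + a') + (b + b') + ((a + b) + (a' + b')) = 0"
  by (cases a; cases a'; cases b; cases b') simp_all

lemma bit_eq_iff_add: "(a::bit) = b \<longleftrightarrow> a + b = 0"
  by (cases a; cases b) auto

context lf_graph begin

lemma chain_exists:
  assumes "x \<in> V" "y \<in> gball x n"
  shows "\<exists>P. finite P \<and> P \<subseteq> F \<and> (\<forall>e\<in>P. e \<subseteq> gball x n) \<and>
           (\<forall>u. bdry P u = of_bool (u = x) + of_bool (u = y))"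
  using assms(2)
proof (induction n arbitrary: y)
  case 0
  then show ?case by (intro exI[of _ "{}"]) auto
next
  case (Suc n)
  from Suc.prems consider "y \<in> gball x n" | w where "w \<in> gball x n" "{w, y} \<in> F"
    unfolding ball_Suc by blast
  then show ?case
  proof cases
    case 1
    obtain P where P: "finite P" "P \<subseteq> F" "\<And>e. e \<in> P \<Longrightarrow> e \<subseteq> gball x n"
      "\<And>u. bdry P u = of_bool (u = x) + of_bool (u = y)" using Suc.IH[OF 1] by blast
    have "e \<subseteq> gball x (Suc n)" if "e \<in> P" for e using P(3)[OF that] ball_mono[of _ x n "Suc n"] by auto
    then show ?thesis using P by (intro exI[of _ P]) blast
  next
    case 2
    obtain P where P: "finite P" "P \<subseteq> F" "\<And>e. e \<in> P \<Longrightarrow> e \<subseteq> gball x n"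
      "\<And>u. bdry P u = of_bool (u = x) + of_bool (u = w)" using Suc.IH[OF 2(1)] by blast
    let ?Q = "sym_diff P {{w, y}}"
    have wy: "w \<noteq> y" using edge_in_V 2(2) by blast
    have "bdry {{w, y}} u = of_bool (u = w) + of_bool (u = y)" for u
      using wy by (auto simp: bdry_def)
    then have "bdry ?Q u = of_bool (u = x) + of_bool (u = y)" for u
      using P(4)[of u] P(1) by (subst bdry_sym_diff) (auto simp: add.assoc)
    moreover have "e \<subseteq> gball x (Suc n)" if e: "e \<in> ?Q" for e
    proof (cases "e = {w, y}")
      case True
      have "w \<in> gball x (Suc n)" using ball_mono[OF 2(1)] by simp
      then show ?thesis using True Suc.prems by auto
    next
      case False
      then have "e \<in> P" using e by auto
      then show ?thesis using P(3) ball_mono[of _ x n "Suc n"] by fastforce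
    qed
    moreover have "finite ?Q" "?Q \<subseteq> F" using P(1,2) 2(2) by auto
    ultimately show ?thesis by (intro exI[of _ ?Q]) auto
  qed
qed

text \<open>
  The chain \<open>P v\<close> joins \<open>v\<close> to its translate, and \<open>p v\<close> counts \<open>\<psi>\<close> along it. For an edge \<open>v w\<close>, the two
  chains together with the edge and its translate bound a strip, an even set of bounded diameter
  (\<open>strip\<close>). Summed along the ray from \<open>v\<close> to infinity, the strips show that the potential \<open>\<phi>\<close> has
  differences \<open>\<psi>\<close> (\<open>d\<phi>\<close>); summed along the full line, that the line total does not depend on the line
  (\<open>total\<close>), so that it vanishes, as it does for a line that avoids all chains meeting \<open>\<psi>\<close>.
\<close>

theorem coverable_if_translation:
  fixes T :: "int \<Rightarrow> 'a \<Rightarrow> 'a"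
  assumes even_deg: "\<And>x. x \<in> V \<Longrightarrow> even (card {e \<in> F. x \<in> e})"
    and T_V: "\<And>k v. v \<in> V \<Longrightarrow> T k v \<in> V"
    and T_0: "\<And>v. v \<in> V \<Longrightarrow> T 0 v = v"
    and T_add: "\<And>i j v. v \<in> V \<Longrightarrow> T i (T j v) = T (i + j) v"
    and T_edge: "\<And>k x y. {x, y} \<in> F \<Longrightarrow> {T k x, T k y} \<in> F"
    and T_free: "\<And>i j v. v \<in> V \<Longrightarrow> T i v = T j v \<Longrightarrow> i = j"
    and T_disp: "\<And>v. v \<in> V \<Longrightarrow> T 1 v \<in> gball v l"
    and T_far: "\<And>U. finite U \<Longrightarrow> \<exists>v\<in>V. \<forall>k. T k v \<notin> U"
  shows "coverable (2 * (l + 1)) F"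
  unfolding coverable_def
proof (intro allI impI, rule cspan_cover_duality)
  let ?L = "2 * (l + 1)"
  fix C \<psi> assume "finite C" "C \<subseteq> F" "\<psi> \<subseteq> C"
    and orth: "\<forall>X \<in> cspan (short_cycles F ?L). even (card (\<psi> \<inter> X))"
  then have fin: "finite \<psi>" and \<psi>F: "\<psi> \<subseteq> F" by (auto intro: finite_subset)
  define q :: "'a set \<Rightarrow> bit" where "q = (\<lambda>e. of_bool (e \<in> \<psi>))"
  have pair_zero: "sum q c = 0" if c: "c \<in> short_cycles F ?L" for c
  proof -
    have "finite c" using c by (simp add: short_cycles_def cyc_def)
    then have "sum q c = of_nat (card (\<psi> \<inter> c))"
      unfolding q_def by (simp add: of_bool_def sum.If_cases Int_def conj_commute)
    moreover have "even (card (\<psi> \<inter> c))" using orth cspan_base[OF c] by blast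
    ultimately show ?thesis by (simp add: even_iff_of_nat_bit)
  qed
  have "\<exists>P. v \<in> V \<longrightarrow> finite P \<and> P \<subseteq> F \<and> (\<forall>e\<in>P. e \<subseteq> gball v l) \<and>
           (\<forall>u. bdry P u = of_bool (u = v) + of_bool (u = T 1 v))" for v
  proof (cases "v \<in> V")
    case True
    then show ?thesis using chain_exists[OF True T_disp[OF True]] by simp
  qed simp
  then have "\<forall>v. \<exists>P. v \<in> V \<longrightarrow> finite P \<and> P \<subseteq> F \<and> (\<forall>e\<in>P. e \<subseteq> gball v l) \<and>
           (\<forall>u. bdry P u = of_bool (u = v) + of_bool (u = T 1 v))" by (rule allI)
  then obtain P where P': "\<forall>v. v \<in> V \<longrightarrow> finite (P v) \<and> P v \<subseteq> F \<and> (\<forall>e\<in>P v. e \<subseteq> gball v l) \<and>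
           (\<forall>u. bdry (P v) u = of_bool (u = v) + of_bool (u = T 1 v))"
    by (rule choice[THEN exE])
  have P: "finite (P v)" "P v \<subseteq> F" "\<And>e. e \<in> P v \<Longrightarrow> e \<subseteq> gball v l"
    "\<And>u. bdry (P v) u = of_bool (u = v) + of_bool (u = T 1 v)" if "v \<in> V" for v
    using P' that by auto
  define p where "p = (\<lambda>v. sum q (P v))"
  have strip: "p v + p w = q {v, w} + q {T 1 v, T 1 w}" if e: "{v, w} \<in> F" for v w
  proof -
    have vw: "v \<in> V" "w \<in> V" "v \<noteq> w" using edge_in_V[OF e] by auto
    have e': "{T 1 v, T 1 w} \<in> F" by (rule T_edge[OF e])
    then have "T 1 v \<noteq> T 1 w" using edge_in_V by blast
    define c where "c = sym_diff (sym_diff (P v) (P w)) (sym_diff {{v, w}} {{T 1 v, T 1 w}})"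
    have b2: "bdry {{a, b}} u = of_bool (u = a) + of_bool (u = b)" if "a \<noteq> b" for a b u :: 'a
      using that by (auto simp: bdry_def)
    have fins: "finite (sym_diff (P v) (P w))" "finite (sym_diff {{v, w}} {{T 1 v, T 1 w}})"
      using P(1) vw by auto
    have "bdry c u = 0" for u
    proof -
      have "bdry c u = (bdry (P v) u + bdry (P w) u) + (bdry {{v, w}} u + bdry {{T 1 v, T 1 w}} u)"
        unfolding c_def using fins P(1) vw by (simp only: bdry_sym_diff finite.emptyI finite.insertI)
      also have "\<dots> = 0"
        unfolding P(4)[OF vw(1)] P(4)[OF vw(2)] b2[OF vw(3)] b2[OF \<open>T 1 v \<noteq> T 1 w\<close>]
        by (rule bit_square_sum)
      finally show ?thesis .
    qed
    then have "cyc c" using fins by (auto simp: cyc_def c_def)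
    moreover have "c \<subseteq> F" unfolding c_def using P(2) vw e e' by auto
    moreover have "f \<subseteq> gball v (l + 1)" if f: "f \<in> c" for f
    proof -
      have w1: "w \<in> gball v 1" using ball_edge[OF e] .
      consider "f \<in> P v" | "f \<in> P w" | "f = {v, w}" | "f = {T 1 v, T 1 w}" using f unfolding c_def by auto
      then show ?thesis
      proof cases
        case 1
        then show ?thesis using P(3)[OF vw(1)] ball_mono[of _ v l "l + 1"] by auto
      next
        case 2
        then show ?thesis using P(3)[OF vw(2)] ball_trans_le[OF w1, of _ l "l + 1"] by auto
      next
        case 3
        then show ?thesis using ball_mono[OF w1, of "l + 1"] by auto
      next
        case 4
        have "T 1 v \<in> gball v (l + 1)" using ball_mono[OF T_disp[OF vw(1)], of "l + 1"] by simp
        moreover have "T 1 w \<in> gball v (l + 1)" by (rule ball_trans_le[OF w1 T_disp[OF vw(2)]]) simp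
        ultimately show ?thesis using 4 by auto
      qed
    qed
    then have inU: "x \<in> gball v (l + 1)" if "x \<in> \<Union>c" for x
      using that by blast
    have "y \<in> gball x ?L" if "x \<in> \<Union>c" "y \<in> \<Union>c" for x y
      by (rule ball_trans_le[OF ball_sym[OF inU[OF that(1)]] inU[OF that(2)]]) simp
    ultimately have "c \<in> short_cycles F ?L"
      unfolding short_cycles_def mem_Collect_eq by (intro conjI ballI)
    then have "sum q c = 0" by (rule pair_zero)
    moreover have "sum q c = (p v + p w) + (q {v, w} + q {T 1 v, T 1 w})"
      unfolding c_def using fins P(1) vw by (simp only: sum_sym_diff finite.emptyI finite.insertI p_def) simp
    ultimately have "(p v + p w) + (q {v, w} + q {T 1 v, T 1 w}) = 0" by (simp only:)
    then show ?thesis by (rule bit_eq_iff_add[THEN iffD2])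
  qed
  define U where "U = {v \<in> V. p v \<noteq> 0}"
  have finU: "finite U"
  proof (rule finite_subset)
    show "U \<subseteq> (\<Union>e\<in>\<psi>. \<Union>u\<in>e. gball u l)"
    proof
      fix v assume v: "v \<in> U"
      then have "\<exists>e \<in> P v. q e \<noteq> 0" unfolding U_def p_def by (metis (mono_tags, lifting) mem_Collect_eq sum.neutral)
      then obtain e where e: "e \<in> P v" "e \<in> \<psi>" by (auto simp: q_def)
      then obtain u where "u \<in> e" using \<psi>F edge_nonempty by blast
      then show "v \<in> (\<Union>e\<in>\<psi>. \<Union>u\<in>e. gball u l)"
        using e P(3)[of v e] v ball_sym unfolding U_def by blast
    qed
    have "finite e" if "e \<in> \<psi>" for e using edges[of e] that \<psi>F by auto
    then show "finite (\<Union>e\<in>\<psi>. \<Union>u\<in>e. gball u l)" using fin by auto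
  qed
  have leaves: "\<exists>M::nat. \<forall>k. int M \<le> \<bar>k\<bar> \<longrightarrow> T k v \<notin> A" if "finite A" "v \<in> V" for A v
  proof -
    have "finite {k. T k v \<in> A}"
      by (rule finite_imageD[of "\<lambda>k. T k v"])
        (use that T_free in \<open>auto simp: inj_on_def intro: finite_subset[of _ A]\<close>)
    then have "finite ((\<lambda>k. nat \<bar>k\<bar>) ` {k. T k v \<in> A})" by simp
    then obtain M where "\<forall>n \<in> (\<lambda>k. nat \<bar>k\<bar>) ` {k. T k v \<in> A}. n < M"
      by (meson finite_nat_set_iff_bounded)
    then show ?thesis by (intro exI[of _ M]) (metis (mono_tags, lifting) imageI mem_Collect_eq nat_le_iff not_less nat_int nat_mono)
  qed
  have "finite e" if "e \<in> \<psi>" for e using edges[of e] that \<psi>F by auto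
  then have "finite (\<Union>\<psi>)" using fin by auto
  note leaves\<psi> = leaves[OF this]
  define S where "S = (\<lambda>v a n. \<Sum>k<n. p (T (a + int k) v))"
  \<comment> \<open>Consecutive strips share an edge, so only the first and the last edge survive.\<close>
  have tele: "S v a n + S w a n = q {T a v, T a w} + q {T (a + int n) v, T (a + int n) w}"
    if e: "{v, w} \<in> F" for v w a n
  proof (induction n)
    case (Suc n)
    have vw: "v \<in> V" "w \<in> V" using edge_in_V[OF e] by auto
    have "p (T (a + int n) v) + p (T (a + int n) w)
        = q {T (a + int n) v, T (a + int n) w} + q {T (a + int (Suc n)) v, T (a + int (Suc n)) w}"
      using strip[OF T_edge[OF e, of "a + int n"]] T_add vw by (simp add: ac_simps)
    moreover have "S v a (Suc n) + S w a (Suc n)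
        = (S v a n + S w a n) + (p (T (a + int n) v) + p (T (a + int n) w))"
      by (simp only: S_def sum.lessThan_Suc ac_simps)
    ultimately show ?case using Suc.IH by (simp only: add.assoc bit_add_self_left)
  qed (simp add: S_def)
  have S_split: "S v a (m + n) = S v a m + S v (a + int m) n" for v a m n
  proof (induction n)
    case (Suc n)
    have "S v a (m + Suc n) = S v a (m + n) + p (T (a + int m + int n) v)"
      by (simp add: S_def add.assoc)
    then show ?case unfolding Suc.IH by (simp only: S_def sum.lessThan_Suc add.assoc)
  qed (simp add: S_def)
  have S_zero: "S v a n = 0" if "\<And>k. k < n \<Longrightarrow> T (a + int k) v \<notin> U" "v \<in> V" for v a n
    unfolding S_def
  proof (rule sum.neutral, intro ballI)
    fix k assume "k \<in> {..<n}"
    then show "p (T (a + int k) v) = 0" using that(1)[of k] T_V[OF that(2)] unfolding U_def by auto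
  qed
  have "\<forall>v. \<exists>M::nat. v \<in> V \<longrightarrow> (\<forall>k. int M \<le> \<bar>k\<bar> \<longrightarrow> T k v \<notin> U)"
    by (intro allI) (metis leaves[OF finU])
  then obtain M where M': "\<forall>v. v \<in> V \<longrightarrow> (\<forall>k. int (M v) \<le> \<bar>k\<bar> \<longrightarrow> T k v \<notin> U)"
    by (rule choice[THEN exE])
  have M: "T k v \<notin> U" if "v \<in> V" "int (M v) \<le> \<bar>k\<bar>" for v k using M' that by blast
  define \<phi> where "\<phi> = (\<lambda>v. S v 0 (M v))"
  have \<phi>_eq: "\<phi> v = S v 0 n" if "v \<in> V" "M v \<le> n" for v n
  proof -
    have "S v (0 + int (M v)) (n - M v) = 0"
      by (rule S_zero) (use that M in auto)
    then show ?thesis using S_split[of v 0 "M v" "n - M v"] that(2) by (simp add: \<phi>_def)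
  qed
  have d\<phi>: "\<phi> v + \<phi> w = q {v, w}" if e: "{v, w} \<in> F" for v w
  proof -
    have vw: "v \<in> V" "w \<in> V" using edge_in_V[OF e] by auto
    obtain N where N: "\<And>k. int N \<le> \<bar>k\<bar> \<Longrightarrow> T k v \<notin> \<Union>\<psi>" using leaves\<psi>[OF vw(1)] by blast
    let ?n = "N + M v + M w"
    have "q {T (0 + int ?n) v, T (0 + int ?n) w} = 0"
      using N[of "int ?n"] by (auto simp: q_def)
    then have "S v 0 ?n + S w 0 ?n = q {v, w}" using tele[OF e, of 0 ?n] T_0 vw by simp
    then show ?thesis using \<phi>_eq[of v ?n] \<phi>_eq[of w ?n] vw by simp
  qed
  have total: "\<exists>N. \<forall>n\<ge>N. S v (- int n) (2 * n) = 0" if "v \<in> V" for v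
  proof -
    obtain v0 where v0: "v0 \<in> V" "\<And>k. T k v0 \<notin> U" using T_far[OF finU] by blast
    have "(v0, v) \<in> (adj_rel F)\<^sup>*" using connected v0(1) that by (auto simp: connected_graph_def)
    then show ?thesis
    proof induction
      case base
      show ?case using S_zero v0 by blast
    next
      case (step x y)
      have e: "{x, y} \<in> F" using step.hyps(2) by (simp add: adj_rel_def)
      obtain N where N: "\<And>n. n \<ge> N \<Longrightarrow> S x (- int n) (2 * n) = 0" using step.IH by blast
      obtain K where K: "\<And>k. int K \<le> \<bar>k\<bar> \<Longrightarrow> T k x \<notin> \<Union>\<psi>" using leaves\<psi> edge_in_V[OF e] by blast
      have "S y (- int n) (2 * n) = 0" if "n \<ge> N + K" for n
      proof -
        have "q {T (- int n) x, T (- int n) y} = 0" "q {T (int n) x, T (int n) y} = 0"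
          using K[of "- int n"] K[of "int n"] that by (auto simp: q_def)
        moreover have "- int n + int (2 * n) = int n" by simp
        ultimately show ?thesis using tele[OF e, of "- int n" "2 * n"] N[of n] that by simp
      qed
      then show ?case by blast
    qed
  qed
  \<comment> \<open>A vertex far behind the chains that meet \<open>\<psi>\<close> sees the whole line, whose total is 0, and one
    beyond them sees nothing.\<close>
  define Z where "Z = {v \<in> V. \<phi> v \<noteq> 0}"
  have finZ: "finite Z"
  proof -
    have "\<forall>u. \<exists>K. u \<in> V \<longrightarrow> (\<forall>n\<ge>K. S u (- int n) (2 * n) = 0) \<and> M u \<le> K"
    proof
      fix u
      show "\<exists>K. u \<in> V \<longrightarrow> (\<forall>n\<ge>K. S u (- int n) (2 * n) = 0) \<and> M u \<le> K"
      proof (cases "u \<in> V")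
        case True
        then obtain N where "\<forall>n\<ge>N. S u (- int n) (2 * n) = 0" using total by blast
        then show ?thesis by (intro exI[of _ "N + M u"]) auto
      qed simp
    qed
    then obtain K where K': "\<forall>u. u \<in> V \<longrightarrow> (\<forall>n\<ge>K u. S u (- int n) (2 * n) = 0) \<and> M u \<le> K u"
      by (rule choice[THEN exE])
    have K: "S u (- int n) (2 * n) = 0" "M u \<le> n" if "u \<in> V" "n \<ge> K u" for u n
      using K' that by (auto intro: le_trans)
    have "Z \<subseteq> (\<Union>u\<in>U. (\<lambda>k. T (- int k) u) ` {..<K u})"
    proof
      fix v assume v: "v \<in> Z"
      then have "v \<in> V" "S v 0 (M v) \<noteq> 0" by (auto simp: Z_def \<phi>_def)
      then obtain k where k: "T (int k) v \<in> U" using S_zero[of "M v" 0 v] by auto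
      define u where "u = T (int k) v"
      have u: "u \<in> U" "u \<in> V" using k by (auto simp: u_def U_def)
      have vu: "v = T (- int k) u" using T_add[OF \<open>v \<in> V\<close>] T_0[OF \<open>v \<in> V\<close>] by (simp add: u_def)
      have "k < K u"
      proof (rule ccontr)
        assume "\<not> k < K u"
        then have kK: "k \<ge> K u" by simp
        let ?n = "2 * k + M v"
        have "\<phi> v = S v 0 ?n" by (rule \<phi>_eq) (use \<open>v \<in> V\<close> in auto)
        also have "\<dots> = S u (- int k) ?n"
          unfolding S_def vu by (simp add: T_add u(2) ac_simps)
        also have "\<dots> = S u (- int k) (2 * k) + S u (- int k + int (2 * k)) (M v)" by (rule S_split)
        also have "S u (- int k) (2 * k) = 0" by (rule K(1)[OF u(2) kK])
        also have "S u (- int k + int (2 * k)) (M v) = 0"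
          by (rule S_zero) (use M[OF u(2)] K(2)[OF u(2) kK] u(2) in auto)
        finally show False using v by (simp add: Z_def)
      qed
      then show "v \<in> (\<Union>u\<in>U. (\<lambda>k. T (- int k) u) ` {..<K u})" using u(1) vu by blast
    qed
    then show ?thesis using finU by (auto intro: finite_subset)
  qed
  define EZ where "EZ = (\<Union>v\<in>Z. {e \<in> F. v \<in> e})"
  have finE: "finite {e \<in> F. v \<in> e}" if "v \<in> V" for v
    using locally_finite that by (simp add: locally_finite_graph_def)
  have finEZ: "finite EZ" unfolding EZ_def using finZ finE by (auto simp: Z_def)
  have q_sum: "q e = (\<Sum>v\<in>Z. of_bool (v \<in> e))" if eF: "e \<in> F" for e
  proof -
    obtain v w where e: "e = {v, w}" "v \<noteq> w" "v \<in> V" "w \<in> V" using edges[OF eF] by blast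
    have "(\<Sum>x\<in>Z. of_bool (x \<in> e)) = (\<Sum>x\<in>Z. of_bool (x = v)) + (\<Sum>x\<in>Z. (of_bool (x = w) :: bit))"
      unfolding sum.distrib[symmetric] using e by (intro sum.cong) auto
    also have "\<dots> = of_bool (v \<in> Z) + of_bool (w \<in> Z)"
      using finZ by (simp add: of_bool_def sum.delta)
    also have "\<dots> = \<phi> v + \<phi> w" using e(3,4) by (auto simp: Z_def)
    finally show ?thesis using d\<phi>[of v w] eF unfolding e(1) by (simp only:)
  qed
  have "\<psi> \<subseteq> EZ"
  proof
    fix e assume e: "e \<in> \<psi>"
    then have "(\<Sum>v\<in>Z. of_bool (v \<in> e)) = (1::bit)" using q_sum[of e] \<psi>F by (auto simp: q_def)
    then have "\<exists>v\<in>Z. v \<in> e" by (metis (mono_tags, lifting) of_bool_eq(1) sum.neutral zero_neq_one)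
    then show "e \<in> EZ" using e \<psi>F by (auto simp: EZ_def)
  qed
  then have "of_nat (card \<psi>) = (\<Sum>e\<in>EZ. q e)"
    using finEZ unfolding q_def by (simp add: of_bool_def sum.If_cases Int_absorb1)
  also have "\<dots> = (\<Sum>e\<in>EZ. \<Sum>v\<in>Z. of_bool (v \<in> e))"
    using q_sum by (intro sum.cong) (auto simp: EZ_def)
  also have "\<dots> = (\<Sum>v\<in>Z. \<Sum>e\<in>EZ. of_bool (v \<in> e))" by (rule sum.swap)
  also have "\<dots> = 0"
  proof (rule sum.neutral, intro ballI)
    fix v assume v: "v \<in> Z"
    then have "{e \<in> F. v \<in> e} = EZ \<inter> {e. v \<in> e}" by (auto simp: EZ_def)
    then have "even (card (EZ \<inter> {e. v \<in> e}))" using even_deg[of v] v by (simp add: Z_def)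
    then show "(\<Sum>e\<in>EZ. of_bool (v \<in> e)) = (0::bit)"
      using finEZ by (simp add: of_bool_def sum.If_cases even_iff_of_nat_bit)
  qed
  finally show "even (card \<psi>)" by (simp add: even_iff_of_nat_bit)
qed

end

section \<open>Successive removal of even sets\<close>

lemma undirected_map_prod: "undirected (map_prod f f ` A) = image f ` undirected A"
  by (force simp: undirected_def image_image)

lemma flow_map_prod:
  assumes "flow A" "A \<subseteq> S \<times> S" "inj_on f S"
  shows "flow (map_prod f f ` A)"
proof -
  have ff: "f x = f y \<longleftrightarrow> x = y" if "x \<in> S" "y \<in> S" for x y
    using assms(3) that by (auto simp: inj_on_def)
  have "card {u. (u, v) \<in> map_prod f f ` A} = card {u. (v, u) \<in> map_prod f f ` A}" for v
  proof (cases "v \<in> f ` S")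
    case True
    then obtain s where s: "s \<in> S" "v = f s" by blast
    have "{u. (u, v) \<in> map_prod f f ` A} = f ` {u. (u, s) \<in> A}"
      using assms(2) s ff by force
    moreover have "{u. (v, u) \<in> map_prod f f ` A} = f ` {u. (s, u) \<in> A}"
      using assms(2) s ff by force
    moreover have "inj_on f {u. (u, s) \<in> A}" "inj_on f {u. (s, u) \<in> A}"
      using assms(2) by (auto intro: inj_on_subset[OF assms(3)])
    ultimately show ?thesis using assms(1) by (simp add: card_image flow_def)
  next
    case False
    then have "{u. (u, v) \<in> map_prod f f ` A} = {}" "{u. (v, u) \<in> map_prod f f ` A} = {}"
      using assms(2) by auto
    then show ?thesis by simp
  qed
  moreover have "antisym_arcs (map_prod f f ` A)"
    unfolding antisym_arcs_def
  proof (intro allI impI notI)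
    fix x y assume "(x, y) \<in> map_prod f f ` A" "(y, x) \<in> map_prod f f ` A"
    then obtain a b c d where ab: "(a, b) \<in> A" "(c, d) \<in> A" "f a = f d" "f b = f c" by auto
    then have "a = d" "b = c" using assms(2) ff by blast+
    then show False using ab assms(1) by (auto simp: flow_def antisym_arcs_def)
  qed
  ultimately show ?thesis using assms(1) by (simp add: flow_def)
qed

text \<open>
  Replacing labels by ranks turns a labelled finite graph into a graph on natural numbers. A choice
  made there depends on the order of the labels only, and commutes with all isomorphisms.
\<close>

definition label_rank :: "('a \<Rightarrow> real) \<Rightarrow> 'a set \<Rightarrow> 'a \<Rightarrow> nat" where
  "label_rank \<omega> A x = card {y \<in> A. \<omega> y < \<omega> x}"

lemma inj_on_rank:
  assumes "finite A" "inj_on \<omega> A"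
  shows "inj_on (label_rank \<omega> A) A"
proof (rule inj_onI, rule ccontr)
  fix x y assume xy: "x \<in> A" "y \<in> A" "label_rank \<omega> A x = label_rank \<omega> A y" "x \<noteq> y"
  have less: "label_rank \<omega> A u < label_rank \<omega> A v" if "u \<in> A" "\<omega> u < \<omega> v" for u v
    unfolding label_rank_def using assms(1) that by (intro psubset_card_mono) auto
  have "\<omega> x \<noteq> \<omega> y" using assms(2) xy by (auto simp: inj_on_def)
  then show False using less[of x y] less[of y x] xy by linarith
qed

text \<open>
  A balanced orientation of some even set of edges of \<open>H\<close> within \<open>A\<close> that contains all those within
  \<open>B\<close>, chosen after the passage to ranks. The definition also makes sense for labels that are
  not injective, where the result is worthless but is still determined by the order of the labels; measurability
  then needs no exception.
\<close>

definition local_arcs :: "'a set set \<Rightarrow> 'a set \<Rightarrow> 'a set \<Rightarrow> ('a \<Rightarrow> real) \<Rightarrow> ('a \<times> 'a) set" where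
  "local_arcs H A B \<omega> = {(x, y). x \<in> A \<and> y \<in> A \<and> (label_rank \<omega> A x, label_rank \<omega> A y) \<in>
     (SOME Y. flow Y \<and> undirected Y \<subseteq> image (label_rank \<omega> A) ` {e \<in> H. e \<subseteq> A} \<and>
        image (label_rank \<omega> A) ` {e \<in> H. e \<subseteq> B} \<subseteq> undirected Y)}"

lemma local_arcs_props:
  assumes "finite A" "inj_on \<omega> A" "B \<subseteq> A"
    and H: "\<And>e. e \<in> H \<Longrightarrow> \<exists>x y. x \<noteq> y \<and> e = {x, y}"
    and X: "cyc X" "X \<subseteq> {e \<in> H. e \<subseteq> A}" "{e \<in> H. e \<subseteq> B} \<subseteq> X"
  shows "flow (local_arcs H A B \<omega>)"
    and "undirected (local_arcs H A B \<omega>) \<subseteq> {e \<in> H. e \<subseteq> A}"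
    and "{e \<in> H. e \<subseteq> B} \<subseteq> undirected (local_arcs H A B \<omega>)"
proof -
  define \<rho> where "\<rho> = label_rank \<omega> A"
  define g where "g = inv_into A \<rho>"
  have inj: "inj_on \<rho> A" unfolding \<rho>_def by (rule inj_on_rank[OF assms(1,2)])
  define Q where "Q = (\<lambda>Y. flow Y \<and> undirected Y \<subseteq> image \<rho> ` {e \<in> H. e \<subseteq> A} \<and>
        image \<rho> ` {e \<in> H. e \<subseteq> B} \<subseteq> undirected Y)"
  have "\<exists>x y. x \<noteq> y \<and> e = {x, y}" if "e \<in> X" for e by (rule H) (use X(2) that in blast)
  then obtain O' where O': "flow O'" "undirected O' = X" using cyc_has_flow[OF X(1)] by blast
  have "O' \<subseteq> A \<times> A"
  proof (rule subrelI)
    fix x y assume "(x, y) \<in> O'"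
    then have "{x, y} \<in> undirected O'" by (simp add: undirected_pair_iff)
    then have "{x, y} \<subseteq> A" using O'(2) X(2) by blast
    then show "(x, y) \<in> A \<times> A" by simp
  qed
  then have "flow (map_prod \<rho> \<rho> ` O')" using flow_map_prod[OF O'(1) _ inj] by blast
  then have "Q (map_prod \<rho> \<rho> ` O')" unfolding Q_def undirected_map_prod O'(2) using X(2,3) by blast
  then have QY: "Q (SOME Y. Q Y)" by (rule someI)
  define Y where "Y = (SOME Y. Q Y)"
  have Y: "flow Y" "undirected Y \<subseteq> image \<rho> ` {e \<in> H. e \<subseteq> A}" "image \<rho> ` {e \<in> H. e \<subseteq> B} \<subseteq> undirected Y"
    using QY unfolding Y_def[symmetric] by (auto simp: Q_def)
  have YA: "Y \<subseteq> \<rho> ` A \<times> \<rho> ` A"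
  proof (rule subrelI)
    fix x y assume "(x, y) \<in> Y"
    then have "{x, y} \<in> undirected Y" by (simp add: undirected_pair_iff)
    then obtain e where "e \<subseteq> A" "{x, y} = \<rho> ` e" using Y(2) by blast
    then have "{x, y} \<subseteq> \<rho> ` A" by blast
    then show "(x, y) \<in> \<rho> ` A \<times> \<rho> ` A" by simp
  qed
  have "local_arcs H A B \<omega> = {(x, y). x \<in> A \<and> y \<in> A \<and> (\<rho> x, \<rho> y) \<in> Y}"
    unfolding local_arcs_def Y_def Q_def \<rho>_def by simp
  also have "\<dots> = map_prod g g ` Y"
  proof (intro equalityI subsetI)
    fix a assume "a \<in> {(x, y). x \<in> A \<and> y \<in> A \<and> (\<rho> x, \<rho> y) \<in> Y}"
    then obtain x y where "a = (x, y)" "x \<in> A" "y \<in> A" "(\<rho> x, \<rho> y) \<in> Y" by blast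
    then have "a = map_prod g g (\<rho> x, \<rho> y)" using inj by (simp add: g_def)
    then show "a \<in> map_prod g g ` Y" using \<open>(\<rho> x, \<rho> y) \<in> Y\<close> by blast
  next
    fix a assume "a \<in> map_prod g g ` Y"
    then obtain i j where ij: "a = (g i, g j)" "(i, j) \<in> Y" by auto
    then have "i \<in> \<rho> ` A" "j \<in> \<rho> ` A" using YA by auto
    then show "a \<in> {(x, y). x \<in> A \<and> y \<in> A \<and> (\<rho> x, \<rho> y) \<in> Y}"
      using ij by (simp add: g_def f_inv_into_f inv_into_into)
  qed
  finally have eq: "local_arcs H A B \<omega> = map_prod g g ` Y" .
  have cancel: "g ` \<rho> ` e = e" if "e \<subseteq> A" for e
    unfolding g_def using inj that by (simp add: inv_into_image_cancel)
  show "flow (local_arcs H A B \<omega>)"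
    unfolding eq by (rule flow_map_prod[OF Y(1) YA]) (simp add: g_def inj_on_inv_into)
  show "undirected (local_arcs H A B \<omega>) \<subseteq> {e \<in> H. e \<subseteq> A}"
  proof
    fix e assume "e \<in> undirected (local_arcs H A B \<omega>)"
    then obtain d where "d \<in> undirected Y" "e = g ` d" unfolding eq undirected_map_prod by blast
    then obtain f where "f \<in> H" "f \<subseteq> A" "e = g ` \<rho> ` f" using Y(2) by blast
    then show "e \<in> {e \<in> H. e \<subseteq> A}" using cancel by simp
  qed
  show "{e \<in> H. e \<subseteq> B} \<subseteq> undirected (local_arcs H A B \<omega>)"
  proof
    fix e assume e: "e \<in> {e \<in> H. e \<subseteq> B}"
    then have "\<rho> ` e \<in> undirected Y" using Y(3) by blast
    then have "g ` \<rho> ` e \<in> undirected (local_arcs H A B \<omega>)" unfolding eq undirected_map_prod by blast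
    moreover have "g ` \<rho> ` e = e" by (rule cancel) (use e assms(3) in blast)
    ultimately show "e \<in> undirected (local_arcs H A B \<omega>)" by simp
  qed
qed

locale coverable_graph = lf_graph +
  fixes L0 :: nat
  assumes L0_pos: "L0 \<ge> 1" and coverable_F: "coverable L0 F"
begin

text \<open>
  The diameter bound \<open>L\<close> at level \<open>n\<close>. With balls of radius \<open>4 L\<close>, the even sets reach up to \<open>5 L\<close>, and
  \<open>2 * (4 L + 2 L) = 12 L\<close> is both the separation that \<open>coverable_remove\<close> asks for and the bound that it
  returns.
\<close>

definition lev :: "nat \<Rightarrow> nat" where
  "lev n = 12 ^ n * L0"

lemma lev_Suc: "lev (Suc n) = 12 * lev n"
  by (simp add: lev_def)

lemma lev_pos: "lev n \<ge> 1"
  using L0_pos by (simp add: lev_def)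

definition centres :: "('a \<Rightarrow> real) \<Rightarrow> nat \<Rightarrow> 'a set" where
  "centres \<omega> n = {z \<in> V. \<forall>y \<in> gball z (12 * lev n). \<not> \<omega> z < \<omega> y}"

primrec arcs :: "('a \<Rightarrow> real) \<Rightarrow> nat \<Rightarrow> ('a \<times> 'a) set" where
  "arcs \<omega> 0 = {}"
| "arcs \<omega> (Suc n) = arcs \<omega> n \<union> (\<Union>z\<in>centres \<omega> n.
     local_arcs (F - undirected (arcs \<omega> n)) (gball z (5 * lev n)) (gball z (4 * lev n)) \<omega>)"

lemma centres_separated:
  assumes "inj_on \<omega> V" "z \<in> centres \<omega> n" "w \<in> centres \<omega> n" "w \<in> gball z (12 * lev n)"
  shows "z = w"
proof -
  have "\<not> \<omega> z < \<omega> w" "\<not> \<omega> w < \<omega> z" "z \<in> V" "w \<in> V"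
    using assms(2-4) ball_sym[OF assms(4)] by (auto simp: centres_def)
  then show ?thesis using assms(1) by (auto simp: inj_on_def)
qed

lemma undirected_Un: "undirected (A \<union> B) = undirected A \<union> undirected B"
  by (auto simp: undirected_def)

lemma undirected_UN: "undirected (\<Union>i\<in>I. A i) = (\<Union>i\<in>I. undirected (A i))"
  by (auto simp: undirected_def)

text \<open>
  The three properties of the arcs say that the edges used so far carry a balanced orientation, and
  \<open>coverable\<close> is what makes the next level possible. Distinct centres have disjoint balls of radius
  \<open>5 * lev n\<close>, hence at most one new even set appears at each vertex.
\<close>

lemma arcs_invariant:
  assumes inj: "inj_on \<omega> V"
  shows "coverable (lev n) (F - undirected (arcs \<omega> n)) \<and> antisym_arcs (arcs \<omega> n) \<and> undirected (arcs \<omega> n) \<subseteq> F \<and>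
     (\<forall>v. card {u. (u, v) \<in> arcs \<omega> n} = card {u. (v, u) \<in> arcs \<omega> n})"
    and "z \<in> centres \<omega> n \<Longrightarrow> e \<in> F \<Longrightarrow> e \<subseteq> gball z (4 * lev n) \<Longrightarrow> e \<in> undirected (arcs \<omega> (Suc n))"
proof -
  define H where "H = (\<lambda>n. F - undirected (arcs \<omega> n))"
  define A where "A = (\<lambda>n z. local_arcs (H n) (gball z (5 * lev n)) (gball z (4 * lev n)) \<omega>)"
  have A_props: "flow (A n z)" "undirected (A n z) \<subseteq> {e \<in> H n. e \<subseteq> gball z (5 * lev n)}"
      "{e \<in> H n. e \<subseteq> gball z (4 * lev n)} \<subseteq> undirected (A n z)"
    if cov: "coverable (lev n) (H n)" and z: "z \<in> centres \<omega> n" for n z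
  proof -
    have zV: "z \<in> V" using z by (simp add: centres_def)
    have "H n \<subseteq> F" by (auto simp: H_def)
    then obtain X where X: "cyc X" "X \<subseteq> H n" "{e \<in> H n. e \<subseteq> gball z (4 * lev n)} \<subseteq> X"
      "\<forall>e\<in>X. e \<subseteq> gball z (4 * lev n + lev n)"
      using coverable_near[OF cov, of z "4 * lev n"] by blast
    have i: "inj_on \<omega> (gball z (5 * lev n))" by (rule inj_on_subset[OF inj ball_subset_V[OF zV]])
    have B: "gball z (4 * lev n) \<subseteq> gball z (5 * lev n)" using ball_mono[of _ z "4 * lev n" "5 * lev n"] by auto
    have two: "\<exists>x y. x \<noteq> y \<and> e = {x, y}" if "e \<in> H n" for e
      using edges[of e] that unfolding H_def by blast
    have XA: "X \<subseteq> {e \<in> H n. e \<subseteq> gball z (5 * lev n)}" using X(2,4) by (auto simp: algebra_simps)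
    show "flow (A n z)" "undirected (A n z) \<subseteq> {e \<in> H n. e \<subseteq> gball z (5 * lev n)}"
      "{e \<in> H n. e \<subseteq> gball z (4 * lev n)} \<subseteq> undirected (A n z)"
      using local_arcs_props[OF finite_ball i B two X(1) XA X(3)] by (simp_all add: A_def)
  qed
  have undirected_Suc: "undirected (arcs \<omega> (Suc n)) = undirected (arcs \<omega> n) \<union> (\<Union>z\<in>centres \<omega> n. undirected (A n z))" for n
    by (simp add: undirected_Un undirected_UN A_def H_def)
  have arcs_Suc: "arcs \<omega> (Suc n) = arcs \<omega> n \<union> (\<Union>z\<in>centres \<omega> n. A n z)" for n
    by (simp add: A_def H_def)
  have inv: "coverable (lev n) (F - undirected (arcs \<omega> n)) \<and> antisym_arcs (arcs \<omega> n) \<and> undirected (arcs \<omega> n) \<subseteq> F \<and>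
     (\<forall>v. card {u. (u, v) \<in> arcs \<omega> n} = card {u. (v, u) \<in> arcs \<omega> n})" for n
  proof (induction n)
    case 0
    then show ?case using coverable_F by (simp add: undirected_def antisym_arcs_def lev_def)
  next
    case (Suc n)
    have cov: "coverable (lev n) (H n)" using Suc.IH by (simp add: H_def)
    note props = A_props[OF cov]
    have HF: "H n \<subseteq> F" by (auto simp: H_def)
    have within: "x \<in> gball z (5 * lev n) \<and> y \<in> gball z (5 * lev n) \<and> {x, y} \<in> H n"
      if "z \<in> centres \<omega> n" "(x, y) \<in> A n z" for x y z
    proof -
      have "{x, y} \<in> undirected (A n z)" using that(2) by (simp add: undirected_pair_iff)
      then have "{x, y} \<in> {e \<in> H n. e \<subseteq> gball z (5 * lev n)}" using props(2)[OF that(1)] by blast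
      then show ?thesis by simp
    qed
    have same: "z = w" if zw: "z \<in> centres \<omega> n" "w \<in> centres \<omega> n" "v \<in> gball z (5 * lev n)" "v \<in> gball w (5 * lev n)" for z w v
      by (rule centres_separated[OF inj zw(1,2)]) (rule ball_trans_le[OF zw(3) ball_sym[OF zw(4)]], simp)
    have "coverable (2 * (4 * lev n + 2 * lev n)) (H n - (\<Union>z\<in>centres \<omega> n. undirected (A n z)))"
    proof (rule coverable_remove[OF HF cov])
      fix z assume z: "z \<in> centres \<omega> n"
      show "cyc (undirected (A n z))" by (rule flow_undirected_cyc[OF props(1)[OF z]])
      show "undirected (A n z) \<subseteq> H n" using props(2)[OF z] by blast
      show "e \<subseteq> gball z (4 * lev n + lev n)" if "e \<in> undirected (A n z)" for e
        using props(2)[OF z] that by (auto simp: algebra_simps)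
    next
      fix z w assume "z \<in> centres \<omega> n" "w \<in> centres \<omega> n" "w \<in> gball z (2 * (4 * lev n + 2 * lev n))"
      then show "z = w" using centres_separated[OF inj, of z n w] by (simp add: algebra_simps)
    qed
    moreover have "H n - (\<Union>z\<in>centres \<omega> n. undirected (A n z)) = F - undirected (arcs \<omega> (Suc n))"
      unfolding undirected_Suc by (auto simp: H_def)
    moreover have "2 * (4 * lev n + 2 * lev n) = lev (Suc n)" by (simp add: lev_Suc)
    ultimately have 1: "coverable (lev (Suc n)) (F - undirected (arcs \<omega> (Suc n)))" by metis
    have old_new: "\<not> ((x, y) \<in> arcs \<omega> n \<or> (y, x) \<in> arcs \<omega> n)"
      if "z \<in> centres \<omega> n" "(x, y) \<in> A n z" for x y z
      using within[OF that] by (auto simp: H_def undirected_pair_iff)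
    have 2: "antisym_arcs (arcs \<omega> (Suc n))"
      unfolding antisym_arcs_def
    proof (intro allI impI notI)
      fix x y assume xy: "(x, y) \<in> arcs \<omega> (Suc n)" "(y, x) \<in> arcs \<omega> (Suc n)"
      show False
      proof (cases "(x, y) \<in> arcs \<omega> n")
        case True
        then have "(y, x) \<notin> arcs \<omega> n" using Suc.IH by (simp add: antisym_arcs_def)
        then obtain z where "z \<in> centres \<omega> n" "(y, x) \<in> A n z" using xy(2) unfolding arcs_Suc by blast
        then show False using old_new True by blast
      next
        case False
        then obtain z where z: "z \<in> centres \<omega> n" "(x, y) \<in> A n z" using xy(1) unfolding arcs_Suc by blast
        then have "(y, x) \<notin> arcs \<omega> n" using old_new by blast
        then obtain w where w: "w \<in> centres \<omega> n" "(y, x) \<in> A n w" using xy(2) unfolding arcs_Suc by blast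
        have "z = w" using same[OF z(1) w(1), of x] within[OF z] within[OF w] by blast
        then show False using props(1)[OF z(1)] z w by (auto simp: flow_def antisym_arcs_def)
      qed
    qed
    have 3: "undirected (arcs \<omega> (Suc n)) \<subseteq> F"
    proof -
      have "undirected (A n z) \<subseteq> F" if "z \<in> centres \<omega> n" for z using props(2)[OF that] HF by blast
      then show ?thesis unfolding undirected_Suc using Suc.IH by blast
    qed
    have 4: "card {u. (u, v) \<in> arcs \<omega> (Suc n)} = card {u. (v, u) \<in> arcs \<omega> (Suc n)}" for v
    proof (cases "\<exists>z \<in> centres \<omega> n. v \<in> gball z (5 * lev n)")
      case False
      then have "{u. (u, v) \<in> arcs \<omega> (Suc n)} = {u. (u, v) \<in> arcs \<omega> n}"
        "{u. (v, u) \<in> arcs \<omega> (Suc n)} = {u. (v, u) \<in> arcs \<omega> n}"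
        using within unfolding arcs_Suc by blast+
      then show ?thesis using Suc.IH by simp
    next
      case True
      then obtain z where z: "z \<in> centres \<omega> n" "v \<in> gball z (5 * lev n)" by blast
      have only: "z = w" if "w \<in> centres \<omega> n" "(u, v) \<in> A n w \<or> (v, u) \<in> A n w" for u w
        using same[OF z(1) that(1) z(2)] within[OF that(1)] that(2) by blast
      have i: "{u. (u, v) \<in> arcs \<omega> (Suc n)} = {u. (u, v) \<in> arcs \<omega> n} \<union> {u. (u, v) \<in> A n z}"
        and o: "{u. (v, u) \<in> arcs \<omega> (Suc n)} = {u. (v, u) \<in> arcs \<omega> n} \<union> {u. (v, u) \<in> A n z}"
        using only z(1) unfolding arcs_Suc by blast+
      have fin: "finite {u. (u, v) \<in> arcs \<omega> n}" "finite {u. (v, u) \<in> arcs \<omega> n}"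
        by (rule finite_subset[OF _ finite_nbrs[of v]], use Suc.IH in \<open>auto simp: undirected_pair_iff undirected_def insert_commute\<close>)+
      have finA: "finite {u. (u, v) \<in> A n z}" "finite {u. (v, u) \<in> A n z}"
        using finite_fibres props(1)[OF z(1)] unfolding flow_def by auto
      have "{u. (u, v) \<in> arcs \<omega> n} \<inter> {u. (u, v) \<in> A n z} = {}"
        "{u. (v, u) \<in> arcs \<omega> n} \<inter> {u. (v, u) \<in> A n z} = {}"
        using old_new[OF z(1)] by blast+
      then show ?thesis unfolding i o using fin finA Suc.IH props(1)[OF z(1)]
        by (simp add: card_Un_disjoint flow_def)
    qed
    show ?case using 1 2 3 4 by blast
  qed
  show "coverable (lev n) (F - undirected (arcs \<omega> n)) \<and> antisym_arcs (arcs \<omega> n) \<and> undirected (arcs \<omega> n) \<subseteq> F \<and>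
     (\<forall>v. card {u. (u, v) \<in> arcs \<omega> n} = card {u. (v, u) \<in> arcs \<omega> n})" by (rule inv)
  show "e \<in> undirected (arcs \<omega> (Suc n))"
    if z: "z \<in> centres \<omega> n" and e: "e \<in> F" "e \<subseteq> gball z (4 * lev n)"
  proof (cases "e \<in> undirected (arcs \<omega> n)")
    case False
    have "coverable (lev n) (H n)" using inv by (simp add: H_def)
    then have "{e \<in> H n. e \<subseteq> gball z (4 * lev n)} \<subseteq> undirected (A n z)" using A_props(3) z by blast
    then have "e \<in> undirected (A n z)" using False e by (auto simp: H_def)
    then show ?thesis unfolding undirected_Suc using z by blast
  qed (simp add: undirected_Un)
qed

end

section \<open>Dependence on the order of the labels\<close>

text \<open>
  All dependence on the labels is expressed by this relation: with an automorphism for \<open>\<gamma>\<close> it yields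
  equivariance, with the identity it yields locality and measurability.
\<close>

definition order_agrees :: "('a \<Rightarrow> 'a) \<Rightarrow> ('a \<Rightarrow> real) \<Rightarrow> ('a \<Rightarrow> real) \<Rightarrow> 'a set \<Rightarrow> bool" where
  "order_agrees \<gamma> \<omega> \<omega>' S \<longleftrightarrow> (\<forall>u\<in>S. \<forall>v\<in>S. \<omega> u < \<omega> v \<longleftrightarrow> \<omega>' (\<gamma> u) < \<omega>' (\<gamma> v))"

lemma order_agrees_subset: "order_agrees \<gamma> \<omega> \<omega>' S \<Longrightarrow> T \<subseteq> S \<Longrightarrow> order_agrees \<gamma> \<omega> \<omega>' T"
  by (auto simp: order_agrees_def)

lemma label_rank_transfer:
  assumes "order_agrees \<gamma> \<omega> \<omega>' A" "inj_on \<gamma> A" "u \<in> A"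
  shows "label_rank \<omega>' (\<gamma> ` A) (\<gamma> u) = label_rank \<omega> A u"
proof -
  have "{y \<in> \<gamma> ` A. \<omega>' y < \<omega>' (\<gamma> u)} = \<gamma> ` {y \<in> A. \<omega> y < \<omega> u}"
    using assms(1,3) by (auto simp: order_agrees_def)
  moreover have "inj_on \<gamma> {y \<in> A. \<omega> y < \<omega> u}" using assms(2) by (rule inj_on_subset) auto
  ultimately show ?thesis by (simp add: label_rank_def card_image)
qed

lemma local_arcs_transfer:
  assumes agr: "order_agrees \<gamma> \<omega> \<omega>' A" and inj: "inj_on \<gamma> A" and "B \<subseteq> A"
    and H: "\<And>u v. u \<in> A \<Longrightarrow> v \<in> A \<Longrightarrow> {u, v} \<in> H \<longleftrightarrow> {\<gamma> u, \<gamma> v} \<in> H'"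
    and pairs: "\<And>e. e \<in> H \<Longrightarrow> \<exists>x y. e = {x, y}" "\<And>e. e \<in> H' \<Longrightarrow> \<exists>x y. e = {x, y}"
    and xy: "x \<in> A" "y \<in> A"
  shows "(\<gamma> x, \<gamma> y) \<in> local_arcs H' (\<gamma> ` A) (\<gamma> ` B) \<omega>' \<longleftrightarrow> (x, y) \<in> local_arcs H A B \<omega>"
proof -
  note rk = label_rank_transfer[OF agr inj]
  have H_img: "{e \<in> H'. e \<subseteq> \<gamma> ` C} = image \<gamma> ` {e \<in> H. e \<subseteq> C}" if "C \<subseteq> A" for C
  proof (intro equalityI subsetI)
    fix e assume e: "e \<in> {e \<in> H'. e \<subseteq> \<gamma> ` C}"
    then obtain a b where ab: "e = {a, b}" using pairs(2) by blast
    then obtain u v where uv: "u \<in> C" "v \<in> C" "a = \<gamma> u" "b = \<gamma> v" using e by auto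
    then have "{u, v} \<in> H" using H e ab \<open>C \<subseteq> A\<close> by auto
    moreover have "e = \<gamma> ` {u, v}" using ab uv by simp
    ultimately show "e \<in> image \<gamma> ` {e \<in> H. e \<subseteq> C}" using uv by blast
  next
    fix e assume "e \<in> image \<gamma> ` {e \<in> H. e \<subseteq> C}"
    then obtain f where f: "f \<in> H" "f \<subseteq> C" "e = \<gamma> ` f" by blast
    then obtain u v where "f = {u, v}" using pairs(1) by blast
    then have "e \<in> H'" using f H \<open>C \<subseteq> A\<close> by auto
    then show "e \<in> {e \<in> H'. e \<subseteq> \<gamma> ` C}" using f by blast
  qed
  have rk_img: "image (label_rank \<omega>' (\<gamma> ` A)) ` {e \<in> H'. e \<subseteq> \<gamma> ` C} = image (label_rank \<omega> A) ` {e \<in> H. e \<subseteq> C}"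
    if "C \<subseteq> A" for C
  proof -
    have img: "label_rank \<omega>' (\<gamma> ` A) ` \<gamma> ` f = label_rank \<omega> A ` f" if "f \<subseteq> C" for f
      unfolding image_image by (rule image_cong) (use that \<open>C \<subseteq> A\<close> rk in auto)
    show ?thesis unfolding H_img[OF that]
      by (subst image_image, rule image_cong[OF refl], rule img) simp
  qed
  have "\<gamma> x \<in> \<gamma> ` A" "\<gamma> y \<in> \<gamma> ` A" using xy by auto
  then show ?thesis
    unfolding local_arcs_def rk_img[OF subset_refl] rk_img[OF assms(3)] using xy rk by simp
qed

context lf_graph begin

lemma aut_V:
  assumes "\<gamma> \<in> graph_Aut V F"
  shows "x \<in> V \<Longrightarrow> \<gamma> x \<in> V" "inj_on \<gamma> V" "\<gamma> ` V = V"
  using assms by (auto simp: graph_Aut_def bij_betw_def)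

lemma aut_edge: "\<gamma> \<in> graph_Aut V F \<Longrightarrow> x \<in> V \<Longrightarrow> y \<in> V \<Longrightarrow> {\<gamma> x, \<gamma> y} \<in> F \<longleftrightarrow> {x, y} \<in> F"
  by (auto simp: graph_Aut_def)

lemma aut_ball:
  assumes g: "\<gamma> \<in> graph_Aut V F" and "x \<in> V"
  shows "\<gamma> ` gball x R = gball (\<gamma> x) R"
proof (induction R)
  case (Suc R)
  have nb: "\<gamma> ` {z. {y, z} \<in> F} = {z. {\<gamma> y, z} \<in> F}" if "y \<in> V" for y
  proof (intro equalityI subsetI)
    fix z assume "z \<in> \<gamma> ` {z. {y, z} \<in> F}"
    then obtain w where w: "{y, w} \<in> F" "z = \<gamma> w" by blast
    then have "w \<in> V" using edge_in_V by blast
    then show "z \<in> {z. {\<gamma> y, z} \<in> F}" using w aut_edge[OF g that] by simp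
  next
    fix z assume z: "z \<in> {z. {\<gamma> y, z} \<in> F}"
    then have "z \<in> V" using edge_in_V by blast
    then obtain w where w: "w \<in> V" "z = \<gamma> w" using aut_V(3)[OF g] by blast
    then show "z \<in> \<gamma> ` {z. {y, z} \<in> F}" using z aut_edge[OF g that] by simp
  qed
  have "\<gamma> ` gball x (Suc R) = \<gamma> ` gball x R \<union> (\<Union>y\<in>gball x R. \<gamma> ` {z. {y, z} \<in> F})"
    unfolding ball_Suc image_Un image_UN ..
  also have "(\<Union>y\<in>gball x R. \<gamma> ` {z. {y, z} \<in> F}) = (\<Union>y\<in>gball x R. {z. {\<gamma> y, z} \<in> F})"
    by (rule SUP_cong) (use nb ball_subset_V[OF assms(2)] in auto)
  also have "\<dots> = (\<Union>y\<in>\<gamma> ` gball x R. {z. {y, z} \<in> F})" by simp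
  finally show ?case unfolding Suc.IH ball_Suc .
qed simp

lemma ball_subset_ball: "u \<in> gball x a \<Longrightarrow> a + b \<le> c \<Longrightarrow> gball u b \<subseteq> gball x c"
  using ball_trans_le by blast

lemma countable_V: "countable V"
proof -
  obtain x where x: "x \<in> V" using connected by (auto simp: connected_graph_def)
  have "V \<subseteq> (\<Union>R. gball x R)" using ball_connects[OF x] by blast
  then show ?thesis by (rule countable_subset) (intro countable_UN countableI_type countable_finite finite_ball)
qed

lemma countable_F: "countable F"
proof -
  have "F \<subseteq> (\<lambda>(x, y). {x, y}) ` (V \<times> V)" using edges by fast
  then show ?thesis using countable_V by (meson countable_SIGMA countable_image countable_subset)
qed

end

context coverable_graph begin

text \<open>
  Whether an arc at \<open>x\<close> is present after level \<open>n\<close> is decided by the order of the labels within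
  \<open>rad n\<close>. The new level inspects the balls of radius \<open>5 * lev n\<close> and \<open>12 * lev n\<close> around a centre at distance at most
  \<open>5 * lev n\<close>, and the earlier levels around the vertices of the smaller ball, at distance at most
  \<open>10 * lev n\<close>.
\<close>

primrec rad :: "nat \<Rightarrow> nat" where
  "rad 0 = 0"
| "rad (Suc n) = rad n + 22 * lev n"

lemma arcs_subset: "arcs \<omega> n \<subseteq> V \<times> V"
proof (induction n)
  case (Suc n)
  have "local_arcs H (gball z R) B \<omega> \<subseteq> V \<times> V" if "z \<in> centres \<omega> n" for H z R B
    using that ball_subset_V[of z R] by (auto simp: local_arcs_def centres_def)
  then show ?case using Suc by fastforce
qed simp

lemma centres_transfer:
  assumes g: "\<gamma> \<in> graph_Aut V F" and "z \<in> V"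
    and agr: "order_agrees \<gamma> \<omega> \<omega>' (gball z (12 * lev n))"
  shows "\<gamma> z \<in> centres \<omega>' n \<longleftrightarrow> z \<in> centres \<omega> n"
proof -
  have "(\<forall>y \<in> gball (\<gamma> z) (12 * lev n). \<not> \<omega>' (\<gamma> z) < \<omega>' y) \<longleftrightarrow>
      (\<forall>y \<in> gball z (12 * lev n). \<not> \<omega>' (\<gamma> z) < \<omega>' (\<gamma> y))"
    unfolding aut_ball[OF g assms(2), symmetric] by simp
  also have "\<dots> \<longleftrightarrow> (\<forall>y \<in> gball z (12 * lev n). \<not> \<omega> z < \<omega> y)"
    using agr ball_refl unfolding order_agrees_def by blast
  finally show ?thesis using aut_V(1)[OF g] assms(2) by (simp add: centres_def)
qed

lemma arcs_transfer:
  assumes g: "\<gamma> \<in> graph_Aut V F"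
  shows "x \<in> V \<Longrightarrow> y \<in> V \<Longrightarrow> order_agrees \<gamma> \<omega> \<omega>' (gball x (rad n)) \<Longrightarrow>
    (\<gamma> x, \<gamma> y) \<in> arcs \<omega>' n \<longleftrightarrow> (x, y) \<in> arcs \<omega> n"
proof (induction n arbitrary: x y)
  case (Suc n)
  note x = Suc.prems(1) and y = Suc.prems(2) and agr = Suc.prems(3)
  define H where "H = F - undirected (arcs \<omega> n)"
  define H' where "H' = F - undirected (arcs \<omega>' n)"
  define P where "P = (\<lambda>z. (x, y) \<in> local_arcs H (gball z (5 * lev n)) (gball z (4 * lev n)) \<omega>)"
  define P' where "P' = (\<lambda>z. (\<gamma> x, \<gamma> y) \<in> local_arcs H' (gball z (5 * lev n)) (gball z (4 * lev n)) \<omega>')"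
  have agr_sub: "order_agrees \<gamma> \<omega> \<omega>' (gball u b)" if "u \<in> gball x a" "a + b \<le> rad (Suc n)" for u a b
    by (rule order_agrees_subset[OF agr ball_subset_ball[OF that]])
  have old: "(\<gamma> x, \<gamma> y) \<in> arcs \<omega>' n \<longleftrightarrow> (x, y) \<in> arcs \<omega> n"
    by (rule Suc.IH[OF x y agr_sub[of x 0]]) auto
  have key: "(\<gamma> z \<in> centres \<omega>' n \<longleftrightarrow> z \<in> centres \<omega> n) \<and> (P' (\<gamma> z) \<longleftrightarrow> P z)"
    if z: "z \<in> V" and xz: "x \<in> gball z (5 * lev n)" for z
  proof
    have zx: "z \<in> gball x (5 * lev n)" by (rule ball_sym[OF xz])
    show "\<gamma> z \<in> centres \<omega>' n \<longleftrightarrow> z \<in> centres \<omega> n"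
      by (rule centres_transfer[OF g z agr_sub[OF zx]]) simp
    let ?A = "gball z (5 * lev n)" and ?B = "gball z (4 * lev n)"
    have AV: "?A \<subseteq> V" by (rule ball_subset_V[OF z])
    have HH: "{u, v} \<in> H \<longleftrightarrow> {\<gamma> u, \<gamma> v} \<in> H'" if uv: "u \<in> ?A" "v \<in> ?A" for u v
    proof -
      have V: "u \<in> V" "v \<in> V" using uv AV by auto
      have ux: "u \<in> gball x (10 * lev n)" "v \<in> gball x (10 * lev n)"
        using ball_trans_le[OF zx uv(1)] ball_trans_le[OF zx uv(2)] by auto
      have "(\<gamma> u, \<gamma> v) \<in> arcs \<omega>' n \<longleftrightarrow> (u, v) \<in> arcs \<omega> n"
        by (rule Suc.IH[OF V agr_sub[OF ux(1)]]) simp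
      moreover have "(\<gamma> v, \<gamma> u) \<in> arcs \<omega>' n \<longleftrightarrow> (v, u) \<in> arcs \<omega> n"
        by (rule Suc.IH[OF V(2,1) agr_sub[OF ux(2)]]) simp
      ultimately show ?thesis using aut_edge[OF g V] by (simp add: H_def H'_def undirected_pair_iff)
    qed
    have sub: "?B \<subseteq> ?A" by (rule ball_subset_ball[of z z 0]) auto
    have pairs: "\<exists>x y. e = {x, y}" if "e \<in> H \<or> e \<in> H'" for e
      using edges[of e] that unfolding H_def H'_def by blast
    show "P' (\<gamma> z) \<longleftrightarrow> P z"
    proof (cases "y \<in> ?A")
      case True
      show ?thesis unfolding P_def P'_def aut_ball[OF g z, symmetric]
        by (rule local_arcs_transfer[OF agr_sub[OF zx] inj_on_subset[OF aut_V(2)[OF g] AV] sub HH])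
          (use pairs xz True in auto)
    next
      case False
      have "\<gamma> y \<notin> \<gamma> ` ?A" using False y AV aut_V(2)[OF g] by (auto simp: inj_on_def)
      then show ?thesis using False unfolding P_def P'_def aut_ball[OF g z, symmetric] local_arcs_def by simp
    qed
  qed
  have new: "(\<exists>z \<in> centres \<omega>' n. P' z) \<longleftrightarrow> (\<exists>z \<in> centres \<omega> n. P z)"
  proof
    assume "\<exists>z \<in> centres \<omega>' n. P' z"
    then obtain z' where z': "z' \<in> centres \<omega>' n" "P' z'" by blast
    then have "z' \<in> V" by (simp add: centres_def)
    then obtain z where z: "z \<in> V" "z' = \<gamma> z" using aut_V(3)[OF g] by blast
    have "\<gamma> x \<in> gball z' (5 * lev n)" using z'(2) by (simp add: P'_def local_arcs_def)
    then have "\<gamma> x \<in> \<gamma> ` gball z (5 * lev n)" using z aut_ball[OF g] by simp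
    then have "x \<in> gball z (5 * lev n)"
      using x aut_V(2)[OF g] ball_subset_V[OF z(1)] by (auto simp: inj_on_def)
    then show "\<exists>z \<in> centres \<omega> n. P z" using key[OF z(1)] z' z(2) by blast
  next
    assume "\<exists>z \<in> centres \<omega> n. P z"
    then obtain z where z: "z \<in> centres \<omega> n" "P z" by blast
    then have "z \<in> V" by (simp add: centres_def)
    moreover have "x \<in> gball z (5 * lev n)" using z(2) by (simp add: P_def local_arcs_def)
    ultimately show "\<exists>z \<in> centres \<omega>' n. P' z" using key z by blast
  qed
  show ?case using old new by (simp add: P_def P'_def H_def H'_def)
qed simp

lemma id_aut: "(\<lambda>x. x) \<in> graph_Aut V F"
  by (auto simp: graph_Aut_def bij_betw_def)

lemma arcs_local:
  assumes "x \<in> V" "\<And>v. v \<in> gball x (rad n) \<Longrightarrow> \<omega>' v = \<omega> v"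
  shows "(x, y) \<in> arcs \<omega>' n \<longleftrightarrow> (x, y) \<in> arcs \<omega> n"
proof (cases "y \<in> V")
  case True
  show ?thesis by (rule arcs_transfer[OF id_aut assms(1) True]) (use assms(2) in \<open>auto simp: order_agrees_def\<close>)
qed (use arcs_subset in blast)

lemma arcs_mono: "m \<le> n \<Longrightarrow> arcs \<omega> m \<subseteq> arcs \<omega> n"
  by (rule lift_Suc_mono_le) auto

end

lemma space_iid: "space (iid_uniform V) = PiE V (\<lambda>_. {0..1})"
  by (simp add: iid_uniform_def space_PiM space_restrict_space)

lemma measurable_label:
  "v \<in> V \<Longrightarrow> (\<lambda>\<omega>. \<omega> v) \<in> borel_measurable (iid_uniform V)"
proof -
  assume "v \<in> V"
  then have "(\<lambda>\<omega>. \<omega> v) \<in> measurable (iid_uniform V) (restrict_space lborel {0..1::real})"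
    unfolding iid_uniform_def by (rule measurable_component_singleton)
  then show ?thesis by (simp add: measurable_restrict_space2_iff)
qed

text \<open>
  There are only finitely many order types of labels on \<open>S\<close>, and each of them is a measurable event.
\<close>

lemma order_determined_measurable:
  assumes S: "finite S" "S \<subseteq> V"
    and det: "\<And>\<omega> \<omega>'. order_agrees (\<lambda>x. x) \<omega> \<omega>' S \<Longrightarrow> Q \<omega> \<Longrightarrow> Q \<omega>'"
  shows "{\<omega> \<in> space (iid_uniform V). Q \<omega>} \<in> sets (iid_uniform V)"
proof -
  let ?M = "iid_uniform V"
  define G where "G = {P. P \<subseteq> S \<times> S \<and> (\<exists>\<omega>. Q \<omega> \<and> {(u, v) \<in> S \<times> S. \<omega> u < \<omega> v} = P)}"
  have "{\<omega> \<in> space ?M. Q \<omega>} = (\<Union>P\<in>G. {\<omega> \<in> space ?M. \<forall>u\<in>S. \<forall>v\<in>S. \<omega> u < \<omega> v \<longleftrightarrow> (u, v) \<in> P})"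
  proof (intro equalityI subsetI)
    fix \<omega> assume w: "\<omega> \<in> {\<omega> \<in> space ?M. Q \<omega>}"
    then have "{(u, v) \<in> S \<times> S. \<omega> u < \<omega> v} \<in> G" by (auto simp: G_def)
    then show "\<omega> \<in> (\<Union>P\<in>G. {\<omega> \<in> space ?M. \<forall>u\<in>S. \<forall>v\<in>S. \<omega> u < \<omega> v \<longleftrightarrow> (u, v) \<in> P})"
      using w by (intro UN_I) auto
  next
    fix \<omega> assume "\<omega> \<in> (\<Union>P\<in>G. {\<omega> \<in> space ?M. \<forall>u\<in>S. \<forall>v\<in>S. \<omega> u < \<omega> v \<longleftrightarrow> (u, v) \<in> P})"
    then obtain \<omega>' where w: "\<omega> \<in> space ?M" "Q \<omega>'"
      "\<forall>u\<in>S. \<forall>v\<in>S. \<omega> u < \<omega> v \<longleftrightarrow> (u, v) \<in> {(u, v) \<in> S \<times> S. \<omega>' u < \<omega>' v}"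
      by (auto simp: G_def)
    then have "order_agrees (\<lambda>x. x) \<omega>' \<omega> S" by (auto simp: order_agrees_def)
    then show "\<omega> \<in> {\<omega> \<in> space ?M. Q \<omega>}" using det w(1,2) by blast
  qed
  moreover have "finite G" by (rule finite_subset[of _ "Pow (S \<times> S)"]) (use S in \<open>auto simp: G_def\<close>)
  moreover have "{\<omega> \<in> space ?M. \<forall>u\<in>S. \<forall>v\<in>S. \<omega> u < \<omega> v \<longleftrightarrow> (u, v) \<in> P} \<in> sets ?M" for P
  proof -
    have "{\<omega> \<in> space ?M. \<omega> u < \<omega> v \<longleftrightarrow> (u, v) \<in> P} \<in> sets ?M" if "u \<in> S" "v \<in> S" for u v
    proof -
      have [measurable]: "(\<lambda>\<omega>. \<omega> u) \<in> borel_measurable ?M" "(\<lambda>\<omega>. \<omega> v) \<in> borel_measurable ?M"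
        by (rule measurable_label, use that S(2) in blast)+
      have "{\<omega> \<in> space ?M. \<omega> u < \<omega> v} \<in> sets ?M" by measurable
      moreover have "{\<omega> \<in> space ?M. \<not> \<omega> u < \<omega> v} \<in> sets ?M" by measurable
      ultimately show ?thesis by (cases "(u, v) \<in> P") (simp_all only: simp_thms)
    qed
    then show ?thesis by (intro sets.sets_Collect_finite_All S(1))
  qed
  ultimately show ?thesis by auto
qed

section \<open>The factor\<close>

context coverable_graph begin

text \<open>
  The domain of the factor: all vertices are distinguished, and every edge is caught at some level.
\<close>

definition good :: "('a \<Rightarrow> real) set" where
  "good = {\<omega> \<in> space (iid_uniform V). inj_on \<omega> V \<and> (\<forall>e\<in>F. \<exists>n. e \<in> undirected (arcs \<omega> n))}"

definition orient :: "('a \<Rightarrow> real) \<Rightarrow> 'a set \<Rightarrow> 'a" where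
  "orient \<omega> = (\<lambda>e\<in>F. THE y. \<exists>x n. e = {x, y} \<and> (x, y) \<in> arcs \<omega> n)"

lemma arcs_antisym:
  assumes "inj_on \<omega> V" "(x, y) \<in> arcs \<omega> m"
  shows "(y, x) \<notin> arcs \<omega> n"
proof
  assume "(y, x) \<in> arcs \<omega> n"
  then have "(y, x) \<in> arcs \<omega> (max m n)" "(x, y) \<in> arcs \<omega> (max m n)"
    using assms(2) arcs_mono[of m "max m n" \<omega>] arcs_mono[of n "max m n" \<omega>] by auto
  then show False using arcs_invariant(1)[OF assms(1), of "max m n"] by (auto simp: antisym_arcs_def)
qed

lemma arcs_edge: "inj_on \<omega> V \<Longrightarrow> (x, y) \<in> arcs \<omega> n \<Longrightarrow> {x, y} \<in> F"
proof -
  assume "inj_on \<omega> V" "(x, y) \<in> arcs \<omega> n"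
  then have "{x, y} \<in> undirected (arcs \<omega> n)" "undirected (arcs \<omega> n) \<subseteq> F"
    using arcs_invariant(1) by (auto simp: undirected_pair_iff)
  then show ?thesis by blast
qed

lemma orient_eq:
  assumes "inj_on \<omega> V" "(x, y) \<in> arcs \<omega> n"
  shows "orient \<omega> {x, y} = y"
proof -
  have "(THE z. \<exists>w k. {x, y} = {w, z} \<and> (w, z) \<in> arcs \<omega> k) = y"
  proof (rule the_equality)
    show "\<exists>w k. {x, y} = {w, y} \<and> (w, y) \<in> arcs \<omega> k" using assms(2) by blast
  next
    fix z assume "\<exists>w k. {x, y} = {w, z} \<and> (w, z) \<in> arcs \<omega> k"
    then obtain w k where w: "{x, y} = {w, z}" "(w, z) \<in> arcs \<omega> k" by blast
    then consider "w = x" "z = y" | "w = y" "z = x" by (auto simp: doubleton_eq_iff)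
    then show "z = y"
    proof cases
      case 2
      then show ?thesis using arcs_antisym[OF assms] w(2) by blast
    qed
  qed
  then show ?thesis using arcs_edge[OF assms] by (simp add: orient_def)
qed

lemma good_edge:
  assumes "\<omega> \<in> good" "e \<in> F"
  obtains x y n where "e = {x, y}" "(x, y) \<in> arcs \<omega> n"
proof -
  obtain n where "e \<in> undirected (arcs \<omega> n)" using assms unfolding good_def by blast
  then show ?thesis using that by (auto simp: undirected_def)
qed

lemma good_inj: "\<omega> \<in> good \<Longrightarrow> inj_on \<omega> V"
  by (simp add: good_def)

text \<open>
  A single level serves all edges at \<open>v\<close>, as there are finitely many of them and the arcs increase with the level.
\<close>

lemma good_level:
  assumes "\<omega> \<in> good" "v \<in> V"
  obtains N where "\<And>e. e \<in> F \<Longrightarrow> v \<in> e \<Longrightarrow> e \<in> undirected (arcs \<omega> N)"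
proof -
  have "\<exists>n. e \<in> undirected (arcs \<omega> n)" if "e \<in> {e \<in> F. v \<in> e}" for e
    using assms(1) that by (auto simp: good_def)
  then obtain k where k: "\<And>e. e \<in> {e \<in> F. v \<in> e} \<Longrightarrow> e \<in> undirected (arcs \<omega> (k e))" by metis
  have fin: "finite {e \<in> F. v \<in> e}" using locally_finite assms(2) by (simp add: locally_finite_graph_def)
  define N where "N = Max (insert 0 (k ` {e \<in> F. v \<in> e}))"
  have "e \<in> undirected (arcs \<omega> N)" if e: "e \<in> F" "v \<in> e" for e
  proof -
    have "k e \<le> N" unfolding N_def using fin e by (intro Max_ge) auto
    then have "undirected (arcs \<omega> (k e)) \<subseteq> undirected (arcs \<omega> N)" using arcs_mono unfolding undirected_def by blast
    then show ?thesis using k e by blast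
  qed
  then show ?thesis using that by blast
qed

lemma orient_in_space: "\<omega> \<in> good \<Longrightarrow> orient \<omega> \<in> space (orientations F)"
proof -
  assume g: "\<omega> \<in> good"
  have "orient \<omega> e \<in> e" if e: "e \<in> F" for e
  proof -
    obtain x y n where "e = {x, y}" "(x, y) \<in> arcs \<omega> n" by (rule good_edge[OF g e])
    then show ?thesis using orient_eq[OF good_inj[OF g]] by simp
  qed
  then show ?thesis by (auto simp: orientations_def space_PiM orient_def)
qed

lemma orient_balanced:
  assumes g: "\<omega> \<in> good"
  shows "balanced_orientation V F (orient \<omega>)"
  unfolding balanced_orientation_def
proof (intro conjI ballI)
  fix v assume v: "v \<in> V"
  note inj = good_inj[OF g]
  obtain N where N: "\<And>e. e \<in> F \<Longrightarrow> v \<in> e \<Longrightarrow> e \<in> undirected (arcs \<omega> N)" using good_level[OF g v] by blast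
  let ?A = "arcs \<omega> N"
  have ne: "x \<noteq> y" if "(x, y) \<in> ?A" for x y using arcs_edge[OF inj that] edge_in_V by blast
  have i: "{e \<in> F. v \<in> e \<and> orient \<omega> e = v} = (\<lambda>u. {u, v}) ` {u. (u, v) \<in> ?A}"
  proof (intro equalityI subsetI)
    fix e assume e: "e \<in> {e \<in> F. v \<in> e \<and> orient \<omega> e = v}"
    then obtain x y where xy: "e = {x, y}" "(x, y) \<in> ?A" using N[of e] by (auto simp: undirected_def)
    then have "y = v" using orient_eq[OF inj xy(2)] e by simp
    then show "e \<in> (\<lambda>u. {u, v}) ` {u. (u, v) \<in> ?A}" using xy by blast
  next
    fix e assume "e \<in> (\<lambda>u. {u, v}) ` {u. (u, v) \<in> ?A}"
    then obtain u where "e = {u, v}" "(u, v) \<in> ?A" by blast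
    then show "e \<in> {e \<in> F. v \<in> e \<and> orient \<omega> e = v}"
      using orient_eq[OF inj] arcs_edge[OF inj] by simp
  qed
  have o: "{e \<in> F. v \<in> e \<and> orient \<omega> e \<noteq> v} = (\<lambda>u. {v, u}) ` {u. (v, u) \<in> ?A}"
  proof (intro equalityI subsetI)
    fix e assume e: "e \<in> {e \<in> F. v \<in> e \<and> orient \<omega> e \<noteq> v}"
    then obtain x y where xy: "e = {x, y}" "(x, y) \<in> ?A" using N[of e] by (auto simp: undirected_def)
    then have "y \<noteq> v" using orient_eq[OF inj xy(2)] e by simp
    then have "x = v" using e xy by auto
    then show "e \<in> (\<lambda>u. {v, u}) ` {u. (v, u) \<in> ?A}" using xy by blast
  next
    fix e assume "e \<in> (\<lambda>u. {v, u}) ` {u. (v, u) \<in> ?A}"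
    then obtain u where "e = {v, u}" "(v, u) \<in> ?A" by blast
    then show "e \<in> {e \<in> F. v \<in> e \<and> orient \<omega> e \<noteq> v}"
      using orient_eq[OF inj] arcs_edge[OF inj] ne[of v u] by simp
  qed
  have "indegree F (orient \<omega>) v = card {u. (u, v) \<in> ?A}"
    unfolding indegree_def i by (rule card_image) (auto simp: inj_on_def doubleton_eq_iff)
  moreover have "outdegree F (orient \<omega>) v = card {u. (v, u) \<in> ?A}"
    unfolding outdegree_def o by (rule card_image) (auto simp: inj_on_def doubleton_eq_iff)
  ultimately show "indegree F (orient \<omega>) v = outdegree F (orient \<omega>) v"
    using arcs_invariant(1)[OF inj, of N] by simp
qed (rule orient_in_space[OF g])

lemma arc_event_measurable:
  "{\<omega> \<in> space (iid_uniform V). (x, y) \<in> arcs \<omega> n} \<in> sets (iid_uniform V)"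
proof (cases "x \<in> V \<and> y \<in> V")
  case True
  show ?thesis
    by (rule order_determined_measurable[OF finite_ball[of x "rad n"] ball_subset_V])
      (use True arcs_transfer[OF id_aut, of x y] in auto)
next
  case False
  then have "{\<omega> \<in> space (iid_uniform V). (x, y) \<in> arcs \<omega> n} = {}" using arcs_subset by blast
  then show ?thesis by (simp only: sets.empty_sets)
qed

lemma good_measurable: "good \<in> sets (iid_uniform V)"
proof -
  let ?M = "iid_uniform V"
  have 1: "{\<omega> \<in> space ?M. \<forall>u\<in>V. \<forall>v\<in>V. \<omega> u = \<omega> v \<longrightarrow> u = v} \<in> sets ?M"
  proof (intro sets.sets_Collect_countable_All' countable_V)
    fix u v assume uv: "u \<in> V" "v \<in> V"
    have "{\<omega> \<in> space ?M. \<omega> u \<noteq> \<omega> v} \<in> sets ?M"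
      by (rule borel_measurable_neq[OF measurable_label[OF uv(1)] measurable_label[OF uv(2)]])
    then show "{\<omega> \<in> space ?M. \<omega> u = \<omega> v \<longrightarrow> u = v} \<in> sets ?M" by (cases "u = v") simp_all
  qed
  have 2: "{\<omega> \<in> space ?M. \<forall>e\<in>F. \<exists>n. e \<in> undirected (arcs \<omega> n)} \<in> sets ?M"
  proof (intro sets.sets_Collect_countable_All' sets.sets_Collect_countable_Ex countable_F)
    fix e n assume "e \<in> F"
    then obtain x y where "e = {x, y}" using edges by blast
    then show "{\<omega> \<in> space ?M. e \<in> undirected (arcs \<omega> n)} \<in> sets ?M"
      unfolding \<open>e = {x, y}\<close> undirected_pair_iff
      by (intro sets.sets_Collect_disj arc_event_measurable)
  qed
  have "good = {\<omega> \<in> space ?M. \<forall>u\<in>V. \<forall>v\<in>V. \<omega> u = \<omega> v \<longrightarrow> u = v} \<inter> {\<omega> \<in> space ?M. \<forall>e\<in>F. \<exists>n. e \<in> undirected (arcs \<omega> n)}"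
    unfolding good_def inj_on_def by blast
  then show ?thesis using 1 2 by simp
qed

lemma orient_measurable:
  "orient \<in> measurable (restrict_space (iid_uniform V) good) (orientations F)"
proof -
  let ?N = "restrict_space (iid_uniform V) good"
  have sp: "space ?N = good"
    using sets.sets_into_space[OF good_measurable] by (auto simp: space_restrict_space)
  have "(\<lambda>\<omega> e. orient \<omega> e) \<in> measurable ?N (PiM F (\<lambda>e. count_space e))"
  proof (rule measurable_PiM_single')
    show "(\<lambda>\<omega> e. orient \<omega> e) \<in> space ?N \<rightarrow> (\<Pi>\<^sub>E e\<in>F. space (count_space e))"
      using orient_in_space unfolding sp by (auto simp: orientations_def space_PiM)
  next
    fix e assume e: "e \<in> F"
    obtain x y where xy: "e = {x, y}" using edges e by blast
    have "finite e" using xy by simp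
    show "(\<lambda>\<omega>. orient \<omega> e) \<in> measurable ?N (count_space e)"
      unfolding measurable_count_space_eq2[OF \<open>finite e\<close>] sp
    proof (intro conjI ballI)
      show "(\<lambda>\<omega>. orient \<omega> e) \<in> good \<rightarrow> e"
        using orient_in_space e by (auto simp: orientations_def space_PiM)
    next
      fix b assume "b \<in> e"
      then obtain a where a: "e = {a, b}" using xy by auto
      have "(\<lambda>\<omega>. orient \<omega> e) -` {b} \<inter> good = good \<inter> (\<Union>n. {\<omega> \<in> space (iid_uniform V). (a, b) \<in> arcs \<omega> n})"
      proof (intro equalityI subsetI)
        fix \<omega> assume w: "\<omega> \<in> (\<lambda>\<omega>. orient \<omega> e) -` {b} \<inter> good"
        then have g: "\<omega> \<in> good" "orient \<omega> e = b" by auto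
        obtain c d n where cd: "e = {c, d}" "(c, d) \<in> arcs \<omega> n" by (rule good_edge[OF g(1) e])
        then have "d = b" using orient_eq[OF good_inj[OF g(1)] cd(2)] g(2) by simp
        then have "c = a" using cd(1) a by (auto simp: doubleton_eq_iff)
        then show "\<omega> \<in> good \<inter> (\<Union>n. {\<omega> \<in> space (iid_uniform V). (a, b) \<in> arcs \<omega> n})"
          using cd(2) \<open>d = b\<close> g(1) by (auto simp: good_def)
      next
        fix \<omega> assume "\<omega> \<in> good \<inter> (\<Union>n. {\<omega> \<in> space (iid_uniform V). (a, b) \<in> arcs \<omega> n})"
        then obtain n where "\<omega> \<in> good" "(a, b) \<in> arcs \<omega> n" by blast
        then show "\<omega> \<in> (\<lambda>\<omega>. orient \<omega> e) -` {b} \<inter> good"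
          using orient_eq good_inj a by simp
      qed
      also have "\<dots> \<in> sets ?N"
        using good_measurable arc_event_measurable by (subst sets_restrict_space_iff) auto
      finally show "(\<lambda>\<omega>. orient \<omega> e) -` {b} \<inter> good \<in> sets ?N" .
    qed
  qed
  then show ?thesis by (simp add: orientations_def)
qed

lemma orient_equivariant:
  assumes g: "\<gamma> \<in> graph_Aut V F" and w: "\<omega> \<in> good"
  shows "act_labels V \<gamma> \<omega> \<in> good \<and> orient (act_labels V \<gamma> \<omega>) = act_orientation V F \<gamma> (orient \<omega>)"
proof -
  define \<omega>' where "\<omega>' = act_labels V \<gamma> \<omega>"
  note inj\<gamma> = aut_V(2)[OF g]
  have inv: "inv_into V \<gamma> (\<gamma> u) = u" if "u \<in> V" for u using inj\<gamma> that by (rule inv_into_f_f)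
  have w': "\<omega>' (\<gamma> u) = \<omega> u" if "u \<in> V" for u
    using that aut_V(1)[OF g] inv by (simp add: \<omega>'_def act_labels_def)
  have pull: "\<exists>u\<in>V. v = \<gamma> u" if "v \<in> V" for v using aut_V(3)[OF g] that by blast
  have arcs': "(\<gamma> x, \<gamma> y) \<in> arcs \<omega>' n \<longleftrightarrow> (x, y) \<in> arcs \<omega> n" if "x \<in> V" "y \<in> V" for x y n
    by (rule arcs_transfer[OF g that]) (use w' ball_subset_V[OF that(1)] in \<open>auto simp: order_agrees_def subset_iff\<close>)
  have inj': "inj_on \<omega>' V"
  proof (rule inj_onI)
    fix a b assume ab: "a \<in> V" "b \<in> V" "\<omega>' a = \<omega>' b"
    then obtain u v where "u \<in> V" "v \<in> V" "a = \<gamma> u" "b = \<gamma> v" using pull by metis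
    then show "a = b" using ab w' good_inj[OF w] by (auto simp: inj_on_def)
  qed
  have sp: "\<omega>' \<in> space (iid_uniform V)"
    unfolding space_iid
  proof (rule PiE_I)
    fix v assume "v \<in> V"
    then obtain u where "u \<in> V" "v = \<gamma> u" using pull by blast
    then show "\<omega>' v \<in> {0..1}" using w w' by (auto simp: good_def space_iid)
  qed (simp add: \<omega>'_def act_labels_def)
  have edge: "\<exists>a b n. e = {\<gamma> a, \<gamma> b} \<and> {a, b} \<in> F \<and> a \<in> V \<and> b \<in> V \<and> (a, b) \<in> arcs \<omega> n" if e: "e \<in> F" for e
  proof -
    obtain x y where xy: "e = {x, y}" "x \<in> V" "y \<in> V" using edges e by blast
    obtain u v where uv: "u \<in> V" "x = \<gamma> u" "v \<in> V" "y = \<gamma> v" using pull xy by metis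
    then have f: "{u, v} \<in> F" using e xy aut_edge[OF g uv(1,3)] by simp
    obtain a b n where ab: "{u, v} = {a, b}" "(a, b) \<in> arcs \<omega> n" by (rule good_edge[OF w f])
    have "e = \<gamma> ` {u, v}" using uv xy by simp
    then have "e = {\<gamma> a, \<gamma> b}" unfolding ab(1) by simp
    moreover have "{a, b} \<in> F" using f unfolding ab(1) .
    ultimately show ?thesis using ab(2) edge_in_V by blast
  qed
  have good': "\<omega>' \<in> good"
    unfolding good_def
  proof (intro CollectI conjI ballI sp inj')
    fix e assume "e \<in> F"
    then obtain a b n where "e = {\<gamma> a, \<gamma> b}" "a \<in> V" "b \<in> V" "(a, b) \<in> arcs \<omega> n" using edge by blast
    then show "\<exists>n. e \<in> undirected (arcs \<omega>' n)" using arcs' by (auto simp: undirected_pair_iff)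
  qed
  moreover have "orient \<omega>' = act_orientation V F \<gamma> (orient \<omega>)"
  proof
    fix e
    show "orient \<omega>' e = act_orientation V F \<gamma> (orient \<omega>) e"
    proof (cases "e \<in> F")
      case True
      then obtain a b n where ab: "e = {\<gamma> a, \<gamma> b}" "a \<in> V" "b \<in> V" "(a, b) \<in> arcs \<omega> n" using edge by blast
      have "inv_into V \<gamma> ` e = {a, b}" using ab inv by simp
      moreover have "orient \<omega> {a, b} = b" by (rule orient_eq[OF good_inj[OF w] ab(4)])
      moreover have "orient \<omega>' e = \<gamma> b" using orient_eq[OF inj', of "\<gamma> a" "\<gamma> b" n] arcs' ab by simp
      ultimately show ?thesis using True by (simp add: act_orientation_def)
    next
      case False
      then show ?thesis by (simp add: act_orientation_def orient_def)
    qed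
  qed
  ultimately show ?thesis by (simp add: \<omega>'_def)
qed

lemma orient_local:
  assumes w: "\<omega> \<in> good" and x: "x \<in> V"
  shows "\<exists>R. \<forall>\<omega>'\<in>good. (\<forall>v \<in> V \<inter> gball x R. \<omega>' v = \<omega> v) \<longrightarrow>
               (\<forall>e\<in>F. x \<in> e \<longrightarrow> orient \<omega>' e = orient \<omega> e)"
proof -
  obtain N where N: "\<And>e. e \<in> F \<Longrightarrow> x \<in> e \<Longrightarrow> e \<in> undirected (arcs \<omega> N)" using good_level[OF w x] by blast
  have "orient \<omega>' e = orient \<omega> e"
    if w': "\<omega>' \<in> good" and agr: "\<forall>v \<in> V \<inter> gball x (1 + rad N). \<omega>' v = \<omega> v" and e: "e \<in> F" "x \<in> e" for \<omega>' e
  proof -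
    obtain a b where ab: "e = {a, b}" "(a, b) \<in> arcs \<omega> N" using N[OF e] by (auto simp: undirected_def)
    have aV: "a \<in> V" using edge_in_V e ab by blast
    have "a \<in> gball x 1" using ball_edge'[OF e] ab by blast
    then have "gball a (rad N) \<subseteq> V \<inter> gball x (1 + rad N)"
      using ball_subset_V[OF aV] ball_subset_ball by blast
    then have "(a, b) \<in> arcs \<omega>' N" using arcs_local[OF aV, of N \<omega>' \<omega> b] agr ab(2) by blast
    then show ?thesis using orient_eq good_inj w w' ab by metis
  qed
  then show ?thesis by blast
qed

theorem factor_if_AE_good:
  assumes "AE \<omega> in iid_uniform V. \<omega> \<in> good"
  shows "Aut_factor V F good orient \<and> finitary_factor V F good orient \<and>
    (AE \<omega> in iid_uniform V. balanced_orientation V F (orient \<omega>))"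
proof (intro conjI)
  have sub: "good \<subseteq> space (iid_uniform V)" by (auto simp: good_def)
  have "{\<omega> \<in> space (iid_uniform V). \<omega> \<notin> good} = space (iid_uniform V) - good" by auto
  then have null: "space (iid_uniform V) - good \<in> null_sets (iid_uniform V)"
    using assms good_measurable by (subst (asm) AE_iff_null) auto
  show "Aut_factor V F good orient"
    unfolding Aut_factor_def using sub null orient_measurable orient_equivariant by blast
  show "finitary_factor V F good orient"
    unfolding finitary_factor_def
  proof
    fix x assume x: "x \<in> V"
    show "AE \<omega> in iid_uniform V. \<omega> \<in> good \<and>
        (\<exists>R. \<forall>\<omega>'\<in>good. (\<forall>v \<in> V \<inter> gball x R. \<omega>' v = \<omega> v) \<longrightarrow>
               (\<forall>e\<in>F. x \<in> e \<longrightarrow> orient \<omega>' e = orient \<omega> e))"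
      using assms by (rule AE_mp) (auto intro!: AE_I2 orient_local[OF _ x])
  qed
  show "AE \<omega> in iid_uniform V. balanced_orientation V F (orient \<omega>)"
    using assms by (rule AE_mp) (auto intro!: AE_I2 orient_balanced)
qed

end

section \<open>Labels that peak in the inner part of a shell\<close>

abbreviation unit_measure :: "real measure" where
  "unit_measure \<equiv> restrict_space lborel {0..1}"

lemma prob_space_unit: "prob_space unit_measure"
  by (rule prob_spaceI) (simp add: space_restrict_space emeasure_restrict_space)

lemma product_prob_space_unit: "product_prob_space (\<lambda>_. unit_measure)"
  by (intro product_prob_spaceI prob_space_unit)

lemma prob_space_iid: "prob_space (iid_uniform V)"
  unfolding iid_uniform_def by (intro prob_space_PiM prob_space_unit)

lemma measure_unit_interval:
  assumes "0 \<le> a" "a \<le> b" "b \<le> 1"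
  shows "measure unit_measure {a..b} = b - a"
  using assms by (subst measure_restrict_space) auto

lemma interval_sets_unit:
  assumes "0 \<le> a" "b \<le> 1"
  shows "{a..b} \<in> sets unit_measure"
  using assms by (auto simp: sets_restrict_space_iff)

lemma measure_iid_box:
  assumes "finite J" "J \<subseteq> V" "\<And>j. j \<in> J \<Longrightarrow> X j \<in> sets unit_measure"
  shows "measure (iid_uniform V) {\<omega> \<in> space (iid_uniform V). \<forall>j\<in>J. \<omega> j \<in> X j} = (\<Prod>j\<in>J. measure unit_measure (X j))"
proof -
  interpret product_prob_space "\<lambda>_. unit_measure" V by (rule product_prob_space_unit)
  have "emeasure (PiM V (\<lambda>_. unit_measure)) {\<omega> \<in> space (PiM V (\<lambda>_. unit_measure)). \<forall>j\<in>J. \<omega> j \<in> X j}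
      = (\<Prod>j\<in>J. emeasure unit_measure (X j))"
    by (rule emeasure_PiM_Collect) (use assms in auto)
  also have "\<dots> = ennreal (\<Prod>j\<in>J. measure unit_measure (X j))"
    by (simp add: M.emeasure_eq_measure prod_ennreal measure_nonneg)
  finally show ?thesis
    by (simp add: iid_uniform_def measure_def prod_nonneg measure_nonneg)
qed

lemma box_measurable:
  assumes "finite J" "J \<subseteq> V" "\<And>j. j \<in> J \<Longrightarrow> X j \<in> sets unit_measure"
  shows "{\<omega> \<in> space (iid_uniform V). \<forall>j\<in>J. \<omega> j \<in> X j} \<in> sets (iid_uniform V)"
proof (intro sets.sets_Collect_finite_All assms(1))
  fix j assume j: "j \<in> J"
  then have "(\<lambda>\<omega>. \<omega> j) \<in> measurable (iid_uniform V) unit_measure"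
    unfolding iid_uniform_def using assms(2) by (intro measurable_component_singleton) auto
  from measurable_sets[OF this assms(3)[OF j]]
  show "{\<omega> \<in> space (iid_uniform V). \<omega> j \<in> X j} \<in> sets (iid_uniform V)"
    by (simp add: vimage_def Int_def conj_commute)
qed

text \<open>
  The diagonal of the unit square is covered by \<open>n\<close> squares of side \<open>1 / n\<close>, of total area \<open>1 / n\<close>.
\<close>

lemma AE_labels_distinct:
  assumes uv: "u \<in> V" "v \<in> V" "u \<noteq> v"
  shows "AE \<omega> in iid_uniform V. \<omega> u \<noteq> \<omega> v"
proof -
  let ?M = "iid_uniform V"
  interpret prob_space ?M by (rule prob_space_iid)
  let ?E = "{\<omega> \<in> space ?M. \<omega> u = \<omega> v}"
  have E: "?E \<in> sets ?M"
    by (rule borel_measurable_eq[OF measurable_label[OF uv(1)] measurable_label[OF uv(2)]])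
  have bound: "prob ?E \<le> 1 / real (Suc k)" for k
  proof -
    define n where "n = Suc k"
    have n: "n > 0" by (simp add: n_def)
    define X where "X = (\<lambda>i. {real i / real n .. real (Suc i) / real n})"
    define B where "B = (\<lambda>i. {\<omega> \<in> space ?M. \<forall>j\<in>{u, v}. \<omega> j \<in> X i})"
    have Xs: "X i \<in> sets unit_measure" if "i < n" for i
      unfolding X_def by (rule interval_sets_unit) (use that n in \<open>auto simp: field_simps\<close>)
    have Xm: "measure unit_measure (X i) = 1 / real n" if "i < n" for i
      unfolding X_def by (subst measure_unit_interval) (use that n in \<open>auto simp: field_simps\<close>)
    have Bs: "B i \<in> sets ?M" if "i < n" for i
      unfolding B_def by (rule box_measurable) (use uv Xs that in auto)
    have Bm: "prob (B i) = 1 / real n * (1 / real n)" if "i < n" for i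
      unfolding B_def by (subst measure_iid_box) (use uv Xs Xm that in auto)
    have "?E \<subseteq> (\<Union>i<n. B i)"
    proof
      fix \<omega> assume w: "\<omega> \<in> ?E"
      then have range: "0 \<le> \<omega> u" "\<omega> u \<le> 1" using uv(1) by (auto simp: space_iid PiE_iff)
      have "\<exists>i<n. \<omega> u \<in> X i"
      proof (cases "\<omega> u = 1")
        case True
        then show ?thesis using n by (intro exI[of _ k]) (auto simp: X_def n_def)
      next
        case False
        let ?i = "nat \<lfloor>\<omega> u * real n\<rfloor>"
        have nn: "0 \<le> \<omega> u * real n" using range by simp
        have lt: "\<omega> u * real n < real n" using False range n by simp
        have i: "real ?i \<le> \<omega> u * real n" "\<omega> u * real n \<le> real (Suc ?i)"
          using nn by linarith+
        then have "?i < n" using lt by linarith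
        moreover have "\<omega> u \<in> X ?i"
          using i n by (simp add: X_def pos_divide_le_eq pos_le_divide_eq)
        ultimately show ?thesis by blast
      qed
      then show "\<omega> \<in> (\<Union>i<n. B i)" using w by (auto simp: B_def)
    qed
    then have "prob ?E \<le> prob (\<Union>i<n. B i)" using Bs by (intro finite_measure_mono) auto
    also have "\<dots> \<le> (\<Sum>i<n. prob (B i))" using Bs by (intro finite_measure_subadditive_finite) auto
    also have "\<dots> = (\<Sum>i<n. 1 / real n * (1 / real n))" using Bm by (intro sum.cong) auto
    also have "\<dots> = 1 / real n" using n by simp
    finally show ?thesis by (simp add: n_def)
  qed
  have "prob ?E = 0"
  proof (rule ccontr)
    assume "prob ?E \<noteq> 0"
    then have "0 < prob ?E" using measure_nonneg[of ?M ?E] by linarith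
    then obtain k where "inverse (real (Suc k)) < prob ?E" using reals_Archimedean by blast
    then show False using bound[of k] by (simp add: inverse_eq_divide)
  qed
  then show ?thesis using E by (subst AE_iff_measurable[OF E]) (auto simp: emeasure_eq_measure)
qed

lemma AE_inj_on:
  assumes "countable V"
  shows "AE \<omega> in iid_uniform V. inj_on \<omega> V"
proof -
  have "AE \<omega> in iid_uniform V. \<forall>u\<in>V. \<forall>v\<in>V. u \<noteq> v \<longrightarrow> \<omega> u \<noteq> \<omega> v"
    unfolding AE_ball_countable[OF assms]
  proof (intro ballI)
    fix u v assume "u \<in> V" "v \<in> V"
    then show "AE \<omega> in iid_uniform V. u \<noteq> v \<longrightarrow> \<omega> u \<noteq> \<omega> v"
      using AE_labels_distinct[of u V v] by (cases "u = v") auto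
  qed
  then show ?thesis by (rule AE_mp) (auto simp: inj_on_def)
qed

lemma indep_labels:
  assumes "V \<noteq> {}"
  shows "prob_space.indep_vars (iid_uniform V) (\<lambda>_. unit_measure) (\<lambda>v \<omega>. \<omega> v) V"
proof -
  interpret prob_space "iid_uniform V" by (rule prob_space_iid)
  interpret P: product_prob_space "\<lambda>_. unit_measure" V by (rule product_prob_space_unit)
  have rv: "random_variable unit_measure (\<lambda>\<omega>. \<omega> v)" if "v \<in> V" for v
    unfolding iid_uniform_def using that by (rule measurable_component_singleton)
  have "distr (iid_uniform V) (PiM V (\<lambda>_. unit_measure)) (\<lambda>\<omega>. \<lambda>v\<in>V. \<omega> v)
      = distr (iid_uniform V) (PiM V (\<lambda>_. unit_measure)) (\<lambda>\<omega>. \<omega>)"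
    by (rule distr_cong) (auto simp: space_iid)
  also have "\<dots> = iid_uniform V" unfolding iid_uniform_def by (rule distr_id2) simp
  also have "\<dots> = PiM V (\<lambda>v. distr (iid_uniform V) unit_measure (\<lambda>\<omega>. \<omega> v))"
    unfolding iid_uniform_def by (rule PiM_cong) (simp_all add: P.PiM_component)
  finally show ?thesis using indep_vars_iff_distr_eq_PiM'[OF assms rv] by simp
qed

text \<open>
  This forces the largest label of \<open>J\<close> to occur in \<open>I\<close>. Comparing with a fixed threshold makes the
  event a difference of two boxes. With the threshold at \<open>1 - 1 / (2 * card J)\<close>, each of the two conditions has a
  probability of the right order.
\<close>

definition peak :: "'a set \<Rightarrow> 'a set \<Rightarrow> ('a \<Rightarrow> real) \<Rightarrow> bool" where
  "peak J I \<omega> \<longleftrightarrow> (\<forall>a\<in>J - I. \<omega> a \<le> 1 - 1 / (2 * real (card J))) \<and> (\<exists>b\<in>I. 1 - 1 / (2 * real (card J)) < \<omega> b)"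

lemma prob_peak:
  fixes C :: nat
  assumes J: "finite J" "J \<subseteq> V" and I: "I \<subseteq> J" and C: "card J \<le> C * card I" and ne: "I \<noteq> {}"
  shows "{\<omega> \<in> space (iid_uniform V). peak J I \<omega>} \<in> sets (iid_uniform V)"
    and "1 / (8 * real C) \<le> measure (iid_uniform V) {\<omega> \<in> space (iid_uniform V). peak J I \<omega>}"
proof -
  let ?M = "iid_uniform V"
  interpret prob_space ?M by (rule prob_space_iid)
  define k where "k = card J"
  define i where "i = card I"
  have i: "0 < i" "i \<le> k" using I J(1) ne by (auto simp: i_def k_def card_mono card_gt_0_iff intro: finite_subset)
  have C0: "C > 0" using C i by (auto simp: i_def k_def intro: Nat.gr0I)
  define t where "t = 1 - 1 / (2 * real k)"
  have t: "0 \<le> t" "t \<le> 1" using i by (auto simp: t_def field_simps)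
  define box where "box = (\<lambda>S. {\<omega> \<in> space ?M. \<forall>j\<in>S. \<omega> j \<in> {0..t}})"
  have bs: "box S \<in> sets ?M" and bm: "prob (box S) = t ^ card S" if "S \<subseteq> J" for S
  proof -
    have S: "finite S" "S \<subseteq> V" using that J by (auto intro: finite_subset)
    have ts: "{0..t} \<in> sets unit_measure" by (rule interval_sets_unit) (use t in auto)
    show "box S \<in> sets ?M" unfolding box_def by (rule box_measurable[OF S ts])
    show "prob (box S) = t ^ card S" unfolding box_def
      by (subst measure_iid_box[OF S ts]) (use t in \<open>simp_all add: measure_unit_interval\<close>)
  qed
  have eq: "{\<omega> \<in> space ?M. peak J I \<omega>} = box (J - I) - box J"
  proof -
    have "0 \<le> \<omega> j" if "\<omega> \<in> space ?M" "j \<in> J" for \<omega> j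
      using that J(2) by (auto simp: space_iid PiE_iff)
    then show ?thesis using I unfolding peak_def box_def t_def k_def by fastforce
  qed
  show "{\<omega> \<in> space ?M. peak J I \<omega>} \<in> sets ?M" unfolding eq using bs by auto
  \<comment> \<open>By the Bernoulli inequality, since \<open>t\<close> misses 1 by \<open>1 / (2 * k)\<close> only.\<close>
  have half: "1 / 2 \<le> t ^ n" if "n \<le> k" for n
  proof -
    have "1 + real k * (- 1 / (2 * real k)) \<le> (1 + (- 1 / (2 * real k))) ^ k"
      using i by (intro Bernoulli_inequality) (auto simp: field_simps)
    then have "1 / 2 \<le> t ^ k" using i by (simp add: t_def)
    also have "t ^ k \<le> t ^ n" using t that by (intro power_decreasing) auto
    finally show ?thesis .
  qed
  have "prob {\<omega> \<in> space ?M. peak J I \<omega>} = prob (box (J - I)) - prob (box J)"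
    unfolding eq by (rule finite_measure_Diff) (use bs in \<open>auto simp: box_def\<close>)
  also have "\<dots> = t ^ (k - i) - t ^ k"
    using bm[of "J - I"] bm[of J] I J(1) by (simp add: k_def i_def card_Diff_subset finite_subset)
  also have "\<dots> = t ^ (k - i) * (1 - t ^ i)"
    using i by (simp add: algebra_simps flip: power_add)
  also have "1 - t ^ i = (1 - t) * (\<Sum>j<i. t ^ j)" by (rule one_diff_power_eq)
  finally have p: "prob {\<omega> \<in> space ?M. peak J I \<omega>} = t ^ (k - i) * ((1 - t) * (\<Sum>j<i. t ^ j))" .
  have "real i * (1 / 2) \<le> (\<Sum>j<i. t ^ j)"
    using sum_mono[of "{..<i}" "\<lambda>_. 1 / 2" "\<lambda>j. t ^ j"] half i by auto
  then have "1 / 2 * ((1 - t) * (real i * (1 / 2))) \<le> t ^ (k - i) * ((1 - t) * (\<Sum>j<i. t ^ j))"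
    using t half[of "k - i"] by (intro mult_mono mult_nonneg_nonneg) auto
  moreover have "1 / 2 * ((1 - t) * (real i * (1 / 2))) = real i / (8 * real k)"
    using i by (simp add: t_def)
  moreover have "1 / (8 * real C) \<le> real i / (8 * real k)"
  proof -
    have "real k \<le> real C * real i" using C by (simp add: k_def i_def flip: of_nat_mult)
    then show ?thesis using i C0 by (simp add: field_simps)
  qed
  ultimately show "1 / (8 * real C) \<le> prob {\<omega> \<in> space ?M. peak J I \<omega>}" using p by linarith
qed

text \<open>
  The events for different \<open>n\<close> depend on disjoint sets of labels, so they are independent, and their
  probabilities are bounded below.
\<close>

theorem AE_exists_peak:
  fixes J I :: "nat \<Rightarrow> 'a set" and C :: nat
  assumes J: "\<And>n. finite (J n)" "\<And>n. J n \<subseteq> V" and I: "\<And>n. I n \<subseteq> J n" "\<And>n. I n \<noteq> {}"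
    and C: "\<And>n. card (J n) \<le> C * card (I n)" and disj: "disjoint_family J"
  shows "AE \<omega> in iid_uniform V. \<exists>n. peak (J n) (I n) \<omega>"
proof -
  let ?M = "iid_uniform V"
  interpret prob_space ?M by (rule prob_space_iid)
  have V: "V \<noteq> {}" using I[of 0] J(2)[of 0] by blast
  have Isub: "I n \<subseteq> V" for n using I J by blast
  define bad where "bad = (\<lambda>n. {\<omega> \<in> space ?M. \<not> peak (J n) (I n) \<omega>})"
  have ind: "indep_vars (\<lambda>n. PiM (J n) (\<lambda>_. unit_measure)) (\<lambda>n \<omega>. restrict \<omega> (J n)) UNIV"
    using indep_vars_restrict[OF indep_labels[OF V], of UNIV J] J(2) disj by simp
  have "indep_events (\<lambda>n. {\<omega> \<in> space ?M. \<not> peak (J n) (I n) (restrict \<omega> (J n))}) UNIV"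
  proof (rule indep_eventsI_indep_vars[OF ind])
    fix n
    have "{\<omega> \<in> space (iid_uniform (J n)). peak (J n) (I n) \<omega>} \<in> sets (iid_uniform (J n))"
      by (rule prob_peak(1)[OF J(1) subset_refl I(1) C I(2)])
    then have "space (iid_uniform (J n)) - {\<omega> \<in> space (iid_uniform (J n)). peak (J n) (I n) \<omega>} \<in> sets (iid_uniform (J n))"
      by auto
    moreover have "space (iid_uniform (J n)) - {\<omega> \<in> space (iid_uniform (J n)). peak (J n) (I n) \<omega>}
       = {\<omega> \<in> space (iid_uniform (J n)). \<not> peak (J n) (I n) \<omega>}" by auto
    ultimately show "{\<omega> \<in> space (PiM (J n) (\<lambda>_. unit_measure)). \<not> peak (J n) (I n) \<omega>} \<in> sets (PiM (J n) (\<lambda>_. unit_measure))"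
      by (simp add: iid_uniform_def)
  qed
  moreover have "peak (J n) (I n) (restrict \<omega> (J n)) \<longleftrightarrow> peak (J n) (I n) \<omega>" for n \<omega>
    using I(1)[of n] by (auto simp: peak_def subset_iff)
  ultimately have indep: "indep_events bad UNIV" by (simp add: bad_def)
  then have bad_sets: "bad n \<in> sets ?M" for n by (auto simp: indep_events_def)
  have C0: "C > 0" using C[of 0] I(2)[of 0] I(1)[of 0] J(1)[of 0]
    by (metis card_gt_0_iff finite_subset gr0I mult_0 leD subset_empty)
  define c where "c = 1 / (8 * real C)"
  have c: "0 < c" "c \<le> 1" using C0 by (auto simp: c_def)
  have bad_prob: "prob (bad n) \<le> 1 - c" for n
  proof -
    have p: "{\<omega> \<in> space ?M. peak (J n) (I n) \<omega>} \<in> sets ?M" "c \<le> prob {\<omega> \<in> space ?M. peak (J n) (I n) \<omega>}"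
      using prob_peak[OF J(1) J(2) I(1) C I(2)] by (auto simp: c_def)
    have "bad n = space ?M - {\<omega> \<in> space ?M. peak (J n) (I n) \<omega>}" by (auto simp: bad_def)
    then show ?thesis using prob_compl[OF p(1)] p(2) by simp
  qed
  let ?B = "\<Inter>n. bad n"
  have bound: "prob ?B \<le> (1 - c) ^ Suc N" for N
  proof -
    have "prob ?B \<le> prob (\<Inter>n\<in>{..N}. bad n)" using bad_sets by (intro finite_measure_mono) auto
    also have "\<dots> = (\<Prod>n\<in>{..N}. prob (bad n))" using indep by (auto simp: indep_events_def)
    also have "\<dots> \<le> (\<Prod>n\<in>{..N}. 1 - c)" using bad_prob by (intro prod_mono) auto
    also have "\<dots> = (1 - c) ^ Suc N" by simp
    finally show ?thesis .
  qed
  have "(\<lambda>N. (1 - c) ^ Suc N) \<longlonglongrightarrow> 0"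
    using c by (intro LIMSEQ_Suc LIMSEQ_power_zero) auto
  then have "prob ?B \<le> 0" using bound by (intro LIMSEQ_le_const) auto
  then have "prob ?B = 0" using measure_nonneg[of ?M ?B] by linarith
  moreover have "?B \<in> sets ?M" using bad_sets by auto
  moreover have "{\<omega> \<in> space ?M. \<not> (\<exists>n. peak (J n) (I n) \<omega>)} = ?B" by (auto simp: bad_def)
  ultimately show ?thesis by (subst AE_iff_measurable[of ?B]) (auto simp: emeasure_eq_measure)
qed

section \<open>Almost surely every edge is caught\<close>

context lf_graph begin

lemma ball_shell:
  assumes "infinite V" "x \<in> V"
  shows "\<exists>y\<in>V. y \<in> gball x (Suc R) \<and> y \<notin> gball x R"
proof (rule ccontr)
  assume "\<not> ?thesis"
  then have step: "gball x (Suc R) \<subseteq> gball x R" using ball_subset_V[OF assms(2)] by blast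
  have "gball x n \<subseteq> gball x R" for n
  proof (induction n)
    case (Suc n)
    have "gball x (Suc n) \<subseteq> gball x (Suc R)"
      using Suc.IH unfolding ball_Suc by blast
    then show ?case using step by blast
  qed (simp)
  then have "V \<subseteq> gball x R" using ball_connects[OF assms(2)] by blast
  then show False using assms(1) finite_subset finite_ball by blast
qed

end

context coverable_graph begin

lemma lev_gap: "m < n \<Longrightarrow> 12 * lev m \<le> lev n"
proof -
  assume "m < n"
  then have "(12::nat) ^ Suc m \<le> 12 ^ n" by (intro power_increasing) auto
  then show ?thesis by (simp add: lev_def)
qed

text \<open>
  The vertex \<open>z\<close> with the largest label in \<open>gball x (16 * lev (Suc n))\<close> lies within \<open>4 * lev (Suc n) - 1\<close>
  of \<open>x\<close>: the peak excludes the outer part of the shell, and the inner ball is small enough anyway. So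
  \<open>z\<close> is a centre of level \<open>Suc n\<close>, and its ball of radius \<open>4 * lev (Suc n)\<close> contains the edges at \<open>x\<close>.
  Working with shells rather than balls makes the levels independent.
\<close>

lemma peak_covers:
  assumes inj: "inj_on \<omega> V" and x: "x \<in> V"
    and peak: "peak (gball x (192 * lev n) - gball x (16 * lev n)) (gball x (48 * lev n - 1) - gball x (16 * lev n)) \<omega>"
    and e: "e \<in> F" "x \<in> e"
  shows "e \<in> undirected (arcs \<omega> (Suc (Suc n)))"
proof -
  let ?W = "gball x (192 * lev n)" and ?J = "gball x (192 * lev n) - gball x (16 * lev n)"
    and ?I = "gball x (48 * lev n - 1) - gball x (16 * lev n)"
  obtain b where b: "b \<in> ?I" "\<And>a. a \<in> ?J - ?I \<Longrightarrow> \<omega> a < \<omega> b"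
    using peak unfolding peak_def by force
  have pos: "lev n \<ge> 1" by (rule lev_pos)
  have inner: "gball x (16 * lev n) \<subseteq> gball x (48 * lev n - 1)"
    by (rule ball_subset_ball[of x x 0]) (use pos in auto)
  have mid: "gball x (48 * lev n - 1) \<subseteq> ?W" by (rule ball_subset_ball[of x x 0]) auto
  have finW: "finite (\<omega> ` ?W)" by simp
  then have "Max (\<omega> ` ?W) \<in> \<omega> ` ?W" by (intro Max_in) (use ball_refl in blast)+
  then obtain z where z: "z \<in> ?W" "\<omega> z = Max (\<omega> ` ?W)" by auto
  have zmax: "\<omega> y \<le> \<omega> z" if "y \<in> ?W" for y unfolding z(2) using finW that by (intro Max_ge) auto
  have zI: "z \<in> gball x (48 * lev n - 1)"
  proof (rule ccontr)
    assume "z \<notin> gball x (48 * lev n - 1)"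
    then have "z \<in> ?J - ?I" using z(1) inner by blast
    then have "\<omega> z < \<omega> b" by (rule b(2))
    moreover have "b \<in> ?W" using b(1) mid by blast
    ultimately show False using zmax[of b] by linarith
  qed
  have "z \<in> V" using z(1) ball_subset_V[OF x] by blast
  moreover have "gball z (12 * lev (Suc n)) \<subseteq> ?W"
    by (rule ball_subset_ball[OF zI]) (simp add: lev_Suc)
  ultimately have "z \<in> centres \<omega> (Suc n)" using zmax by (fastforce simp: centres_def)
  moreover have "e \<subseteq> gball z (4 * lev (Suc n))"
  proof -
    have "gball x 1 \<subseteq> gball z (4 * lev (Suc n))"
      by (rule ball_subset_ball[OF ball_sym[OF zI]]) (use pos in \<open>simp add: lev_Suc\<close>)
    then show ?thesis using ball_edge'[OF e] by blast
  qed
  ultimately show ?thesis using arcs_invariant(2)[OF inj] e(1) by blast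
qed

text \<open>
  The factor 192 is the ratio between the outer radius of the shell of \<open>peak_covers\<close> and the radius of a
  ball \<open>gball y (lev n)\<close> that fits into the inner part of the shell.
\<close>

theorem AE_good:
  assumes inf: "infinite V"
    and growth: "\<And>x y r. x \<in> V \<Longrightarrow> y \<in> V \<Longrightarrow> r \<ge> 1 \<Longrightarrow> card (gball x (192 * r)) \<le> C * card (gball y r)"
  shows "AE \<omega> in iid_uniform V. \<omega> \<in> good"
proof -
  define J where "J = (\<lambda>x n. gball x (192 * lev n) - gball x (16 * lev n))"
  define I where "I = (\<lambda>x n. gball x (48 * lev n - 1) - gball x (16 * lev n))"
  have "AE \<omega> in iid_uniform V. \<exists>n. peak (J x n) (I x n) \<omega>" if x: "x \<in> V" for x
  proof (rule AE_exists_peak)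
    fix n
    have pos: "lev n \<ge> 1" by (rule lev_pos)
    show "finite (J x n)" by (simp add: J_def)
    show "J x n \<subseteq> V" using ball_subset_V[OF x] by (auto simp: J_def)
    have "gball x (48 * lev n - 1) \<subseteq> gball x (192 * lev n)" by (rule ball_subset_ball[of x x 0]) auto
    then show IJ: "I x n \<subseteq> J x n" by (auto simp: I_def J_def)
    obtain y where y: "y \<in> V" "y \<in> gball x (Suc (17 * lev n))" "y \<notin> gball x (17 * lev n)"
      using ball_shell[OF inf x] by blast
    have yI: "gball y (lev n) \<subseteq> I x n"
    proof
      fix u assume u: "u \<in> gball y (lev n)"
      have "u \<in> gball x (48 * lev n - 1)" by (rule ball_trans_le[OF y(2) u]) (use pos in auto)
      moreover have "u \<notin> gball x (16 * lev n)"
      proof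
        assume "u \<in> gball x (16 * lev n)"
        then have "y \<in> gball x (17 * lev n)" by (rule ball_trans_le[OF _ ball_sym[OF u]]) simp
        then show False using y(3) by blast
      qed
      ultimately show "u \<in> I x n" by (simp add: I_def)
    qed
    then show "I x n \<noteq> {}" using ball_refl by blast
    have "card (J x n) \<le> card (gball x (192 * lev n))" by (intro card_mono) (auto simp: J_def)
    also have "\<dots> \<le> C * card (gball y (lev n))" by (rule growth[OF x y(1) pos])
    also have "card (gball y (lev n)) \<le> card (I x n)" using yI by (intro card_mono) (auto simp: I_def)
    finally show "card (J x n) \<le> C * card (I x n)" by simp
  next
    have "J x m \<inter> J x n = {}" if "m < n" for m n
    proof -
      have "gball x (192 * lev m) \<subseteq> gball x (16 * lev n)"
        by (rule ball_subset_ball[of x x 0]) (use lev_gap[OF that] in auto)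
      then show ?thesis by (auto simp: J_def)
    qed
    then show "disjoint_family (J x)" unfolding disjoint_family_on_def by (metis Int_commute linorder_neqE_nat)
  qed
  then have "AE \<omega> in iid_uniform V. \<forall>x\<in>V. \<exists>n. peak (J x n) (I x n) \<omega>"
    by (intro AE_ball_countable[OF countable_V, THEN iffD2] ballI)
  moreover have "AE \<omega> in iid_uniform V. \<omega> \<in> space (iid_uniform V)" by (rule AE_space)
  ultimately show ?thesis using AE_inj_on[OF countable_V]
  proof eventually_elim
    case (elim \<omega>)
    have "\<exists>n. e \<in> undirected (arcs \<omega> n)" if e: "e \<in> F" for e
    proof -
      obtain x where x: "x \<in> V" "x \<in> e" using edges[OF e] by blast
      then obtain n where "peak (J x n) (I x n) \<omega>" using elim(1) by blast
      then show ?thesis using peak_covers[OF elim(3) x(1) _ e x(2)] unfolding J_def I_def by blast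
    qed
    then show ?case using elim by (simp add: good_def)
  qed
qed

end

section \<open>The graph underlying a planar lattice\<close>

text \<open>
  Removing an interior point disconnects an arc. If \<open>p\<close> is the starting point of some parametrisation \<open>h\<close>,
  however, what remains of the arc without \<open>p\<close> is the image of a half-open interval and thus connected.
\<close>

lemma arc_ends_eq:
  assumes "arc g" "path_image g = e"
  shows "arc_ends e = {pathstart g, pathfinish g}"
proof
  show "{pathstart g, pathfinish g} \<subseteq> arc_ends e"
  proof -
    have "arc (reversepath g)" "path_image (reversepath g) = e" "pathstart (reversepath g) = pathfinish g"
      using assms by (auto simp: arc_reversepath)
    then show ?thesis using assms unfolding arc_ends_def by force
  qed
  show "arc_ends e \<subseteq> {pathstart g, pathfinish g}"
  proof
    fix p assume "p \<in> arc_ends e"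
    then obtain h where h: "arc h" "path_image h = e" "p = h 0" by (auto simp: arc_ends_def pathstart_def)
    obtain k where k: "homeomorphism {0..1} e g k" using homeomorphism_arc[OF assms(1)] assms(2) by blast
    have img: "h ` {0<..1} = e - {p}"
    proof -
      have "inj_on h {0..1}" using h(1) by (simp add: arc_def)
      then have "h ` ({0..1} - {0}) = h ` {0..1} - h ` {0}" by (intro inj_on_image_set_diff) auto
      moreover have "{0..1} - {0::real} = {0<..1}" by auto
      ultimately show ?thesis using h by (simp add: path_image_def)
    qed
    have p_e: "p \<in> e" using h by (auto simp: path_image_def)
    have "connected (h ` {0<..1})"
      using h(1) by (intro connected_continuous_image)
        (auto simp: arc_def path_def intro: continuous_on_subset)
    then have "connected (k ` (e - {p}))"
      unfolding img using k by (intro connected_continuous_image)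
        (auto simp: homeomorphism_def intro: continuous_on_subset)
    moreover have "k ` (e - {p}) = {0..1} - {k p}"
    proof -
      have "inj_on k e" using k by (metis homeomorphism_def inj_on_def)
      then have "k ` (e - {p}) = k ` e - k ` {p}" using p_e by (intro inj_on_image_set_diff) auto
      then show ?thesis using k by (simp add: homeomorphism_def)
    qed
    ultimately have con: "connected ({0..1} - {k p})" by simp
    have kp: "k p \<in> {0..1}" "g (k p) = p" using k p_e by (auto simp: homeomorphism_def)
    have "k p = 0 \<or> k p = 1"
    proof (rule ccontr)
      assume ne: "\<not> (k p = 0 \<or> k p = 1)"
      then have "0 \<in> {0..1} - {k p}" "1 \<in> {0..1} - {k p}" by auto
      then have "k p \<in> {0..1} - {k p}"
        by (rule connectedD_interval[OF con]) (use kp(1) in auto)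
      then show False by simp
    qed
    then show "p \<in> {pathstart g, pathfinish g}" using kp(2) by (auto simp: pathstart_def pathfinish_def)
  qed
qed

lemma arc_ends_pair: "is_arc e \<Longrightarrow> \<exists>x y. x \<noteq> y \<and> arc_ends e = {x, y}"
  using arc_ends_eq arc_distinct_ends unfolding is_arc_def by metis

lemma lf_graph_planar_lattice:
  assumes "planar_lattice V E"
  shows "lf_graph V (abs_edges E)"
proof
  fix f assume "f \<in> abs_edges E"
  then obtain e where e: "e \<in> E" "f = arc_ends e" by (auto simp: abs_edges_def)
  then have "is_arc e" "arc_ends e \<subseteq> V" using assms by (auto simp: planar_lattice_def plane_graph_def)
  then show "\<exists>x\<in>V. \<exists>y\<in>V. x \<noteq> y \<and> f = {x, y}" using arc_ends_pair[of e] e(2) by auto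
qed (use assms in \<open>auto simp: planar_lattice_def\<close>)

section \<open>Periodic graphs in the plane\<close>

locale periodic_graph = lf_graph V F for V :: "complex set" and F +
  fixes a b :: complex
  assumes ab: "a \<noteq> b" "independent {a, b}"
    and shift_a: "(\<lambda>z. z + a) \<in> graph_Aut V F" and shift_b: "(\<lambda>z. z + b) \<in> graph_Aut V F"
    and discrete: "\<And>z. \<not> z islimpt V"
begin

lemma coordinates_unique:
  assumes "s *\<^sub>R a + t *\<^sub>R b = 0"
  shows "s = 0 \<and> t = 0"
proof -
  have nb: "b \<noteq> 0" using ab(2) dependent_zero by auto
  have na: "a \<notin> span {b}" using ab by (simp add: independent_insert)
  have "s = 0"
  proof (rule ccontr)
    assume s: "s \<noteq> 0"
    have "s *\<^sub>R a = (- t) *\<^sub>R b" using assms by (simp add: eq_neg_iff_add_eq_0)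
    then have "(1 / s) *\<^sub>R (s *\<^sub>R a) = (1 / s) *\<^sub>R ((- t) *\<^sub>R b)" by simp
    then have "a = (- t / s) *\<^sub>R b" using s by simp
    then have "a \<in> span {b}" by (metis insertI1 span_base span_scale)
    then show False using na by simp
  qed
  then show ?thesis using assms nb by simp
qed

lemma coordinates_exist: "\<exists>s t. z = s *\<^sub>R a + t *\<^sub>R b"
proof -
  have "UNIV \<subseteq> span {a, b}"
    by (rule card_ge_dim_independent) (use ab in \<open>auto simp: dim_UNIV\<close>)
  then have "z \<in> span {a, b}" by blast
  then obtain s where "z - s *\<^sub>R a \<in> span {b}" by (auto simp: span_insert)
  then obtain t where "z - s *\<^sub>R a = t *\<^sub>R b" by (auto simp: span_singleton)
  then show ?thesis by (intro exI[of _ s] exI[of _ t]) (simp add: algebra_simps)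
qed

definition period :: "complex \<Rightarrow> bool" where
  "period w \<longleftrightarrow> (\<forall>z. z + w \<in> V \<longleftrightarrow> z \<in> V) \<and> (\<forall>x y. {x + w, y + w} \<in> F \<longleftrightarrow> {x, y} \<in> F)"

text \<open>
  An automorphism only constrains what happens on \<open>V\<close>. As translations are injective on the whole plane,
  the equivalences hold for all points, and periods form a group.
\<close>

lemma period_if_aut:
  assumes "(\<lambda>z. z + w) \<in> graph_Aut V F"
  shows "period w"
proof -
  have V: "z + w \<in> V \<longleftrightarrow> z \<in> V" for z
  proof
    assume "z + w \<in> V"
    then obtain u where "u \<in> V" "z + w = u + w" using aut_V(3)[OF assms] by blast
    then show "z \<in> V" by simp
  qed (rule aut_V(1)[OF assms])
  moreover have "{x + w, y + w} \<in> F \<longleftrightarrow> {x, y} \<in> F" for x y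
  proof (cases "x \<in> V \<and> y \<in> V")
    case True
    then show ?thesis using aut_edge[OF assms] by simp
  next
    case False
    then show ?thesis using edge_in_V[of x y] edge_in_V[of "x + w" "y + w"] V by blast
  qed
  ultimately show ?thesis by (simp add: period_def)
qed

lemma period_add: "period v \<Longrightarrow> period w \<Longrightarrow> period (v + w)"
  unfolding period_def by (simp add: add.assoc[symmetric])

lemma period_minus: "period w \<Longrightarrow> period (- w)"
proof -
  assume w: "period w"
  have "z + - w \<in> V \<longleftrightarrow> z \<in> V" for z using w[unfolded period_def, THEN conjunct1, rule_format, of "z - w"] by simp
  moreover have "{x + - w, y + - w} \<in> F \<longleftrightarrow> {x, y} \<in> F" for x y
    using w[unfolded period_def, THEN conjunct2, rule_format, of "x - w" "y - w"] by simp
  ultimately show ?thesis unfolding period_def by blast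
qed

lemma period_multiple: "period w \<Longrightarrow> period (real_of_int k *\<^sub>R w)"
proof (induction k rule: int_induct[of _ 0])
  case base
  then show ?case by (simp add: period_def)
next
  case (step1 i)
  then have "period (real_of_int i *\<^sub>R w + w)" using period_add by blast
  then show ?case by (simp add: algebra_simps)
next
  case (step2 i)
  then have "period (real_of_int i *\<^sub>R w + - w)" using period_add period_minus by blast
  then show ?case by (simp add: algebra_simps)
qed

definition tr :: "int \<Rightarrow> int \<Rightarrow> complex" where
  "tr k l = real_of_int k *\<^sub>R a + real_of_int l *\<^sub>R b"

lemma period_tr: "period (tr k l)"
  unfolding tr_def by (intro period_add period_multiple period_if_aut shift_a shift_b)

lemma tr_add: "tr k l + tr m n = tr (k + m) (l + n)"
  by (simp add: tr_def algebra_simps)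

lemma tr_0 [simp]: "tr 0 0 = 0"
  by (simp add: tr_def)

lemma tr_eq_iff: "tr k l = tr m n \<longleftrightarrow> k = m \<and> l = n"
proof
  assume "tr k l = tr m n"
  then have "(real_of_int k - real_of_int m) *\<^sub>R a + (real_of_int l - real_of_int n) *\<^sub>R b = 0"
    by (simp add: tr_def algebra_simps)
  then show "k = m \<and> l = n" using coordinates_unique by fastforce
qed simp

lemma tr_V: "z + tr k l \<in> V \<longleftrightarrow> z \<in> V" and tr_F: "{x + tr k l, y + tr k l} \<in> F \<longleftrightarrow> {x, y} \<in> F"
  using period_tr[of k l] unfolding period_def by auto

lemma tr_ball: "y \<in> gball x R \<Longrightarrow> y + tr k l \<in> gball (x + tr k l) R"
proof (induction R arbitrary: y)
  case (Suc R)
  from Suc.prems consider "y \<in> gball x R" | w where "w \<in> gball x R" "{w, y} \<in> F" unfolding ball_Suc by blast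
  then show ?case
  proof cases
    case 2
    then have "w + tr k l \<in> gball (x + tr k l) R" "{w + tr k l, y + tr k l} \<in> F"
      using Suc.IH tr_F by auto
    then show ?thesis unfolding ball_Suc by blast
  qed (use Suc.IH in \<open>auto simp: ball_Suc\<close>)
qed simp

text \<open>
  Representatives are found in a closed fundamental parallelogram, which is compact and contains finitely many vertices.
\<close>

lemma finite_orbits: "\<exists>Q. finite Q \<and> Q \<subseteq> V \<and> (\<forall>v\<in>V. \<exists>q\<in>Q. \<exists>k l. v = q + tr k l)"
proof -
  let ?K = "(\<lambda>(s, t). s *\<^sub>R a + t *\<^sub>R b) ` ({0..1::real} \<times> {0..1::real})"
  have "compact ?K"
    by (intro compact_continuous_image compact_Times) (auto simp: case_prod_unfold intro!: continuous_intros)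
  then have fin: "finite (?K \<inter> V)" using discrete by (intro finite_not_islimpt_in_compact)
  have "\<exists>q\<in>?K \<inter> V. \<exists>k l. v = q + tr k l" if v: "v \<in> V" for v
  proof -
    obtain s t where st: "v = s *\<^sub>R a + t *\<^sub>R b" using coordinates_exist by blast
    let ?q = "frac s *\<^sub>R a + frac t *\<^sub>R b"
    have eq: "v = ?q + tr \<lfloor>s\<rfloor> \<lfloor>t\<rfloor>" by (simp add: st tr_def frac_def algebra_simps)
    then have "?q \<in> V" using v tr_V by metis
    moreover have "frac s \<in> {0..1}" "frac t \<in> {0..1}"
      using frac_ge_0[of s] frac_lt_1[of s] frac_ge_0[of t] frac_lt_1[of t] by (auto simp: less_imp_le)
    then have "?q \<in> ?K" by (intro image_eqI[of _ _ "(frac s, frac t)"]) auto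
    ultimately show ?thesis using eq by blast
  qed
  then show ?thesis using fin by (intro exI[of _ "?K \<inter> V"]) blast
qed

lemma bounded_displacement: "\<exists>c. \<forall>v\<in>V. v + tr k l \<in> gball v c"
proof -
  obtain Q where Q: "finite Q" "Q \<subseteq> V" "\<forall>v\<in>V. \<exists>q\<in>Q. \<exists>k l. v = q + tr k l"
    using finite_orbits by blast
  have "\<forall>q\<in>Q. \<exists>R. q + tr k l \<in> gball q R"
  proof
    fix q assume "q \<in> Q"
    then have "q \<in> V" "q + tr k l \<in> V" using Q(2) by (auto simp: tr_V)
    then show "\<exists>R. q + tr k l \<in> gball q R" by (rule ball_connects)
  qed
  then obtain R where R: "\<forall>q\<in>Q. q + tr k l \<in> gball q (R q)" by (rule bchoice[THEN exE])
  have "v + tr k l \<in> gball v (sum R Q)" if vV: "v \<in> V" for v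
  proof -
    obtain q m n where q: "q \<in> Q" "v = q + tr m n" using Q(3)[rule_format, OF vV] by blast
    have "R q \<le> sum R Q" using Q(1) q(1) by (intro member_le_sum) auto
    then have "q + tr k l \<in> gball q (sum R Q)" using ball_mono[OF R[rule_format, OF q(1)]] by simp
    then have "q + tr k l + tr m n \<in> gball (q + tr m n) (sum R Q)" by (rule tr_ball)
    then show ?thesis using q(2) by (simp add: ac_simps)
  qed
  then show ?thesis by blast
qed

lemma V_nonempty: "V \<noteq> {}"
  using connected by (simp add: connected_graph_def)

lemma infinite_V: "infinite V"
proof
  assume "finite V"
  obtain v where v: "v \<in> V" using V_nonempty by blast
  have "range (\<lambda>k. v + tr k 0) \<subseteq> V" using v tr_V by auto
  moreover have "inj (\<lambda>k. v + tr k 0)" by (auto simp: inj_def tr_eq_iff)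
  ultimately show False using \<open>finite V\<close> finite_subset finite_imageD infinite_UNIV_int by blast
qed

text \<open>
  Different multiples of the second period give disjoint lines in the direction of the first one.
\<close>

lemma some_line_avoids:
  assumes "finite U"
  shows "\<exists>v\<in>V. \<forall>k. v + tr k 0 \<notin> U"
proof (rule ccontr)
  assume neg: "\<not> ?thesis"
  obtain v where v: "v \<in> V" using V_nonempty by blast
  have "\<exists>k. v + tr 0 j + tr k 0 \<in> U" for j
  proof -
    have "v + tr 0 j \<in> V" using v by (simp add: tr_V)
    then show ?thesis using neg by blast
  qed
  then obtain k where k: "\<And>j. v + tr 0 j + tr (k j) 0 \<in> U" by metis
  have "inj (\<lambda>j. v + tr 0 j + tr (k j) 0)" by (auto simp: inj_def add.assoc tr_add tr_eq_iff)
  moreover have "range (\<lambda>j. v + tr 0 j + tr (k j) 0) \<subseteq> U" using k by auto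
  ultimately show False using assms finite_subset finite_imageD infinite_UNIV_int by blast
qed

lemma coverable_periodic:
  assumes "\<And>x. x \<in> V \<Longrightarrow> even (card {e \<in> F. x \<in> e})"
  shows "\<exists>L\<ge>1. coverable L F"
proof -
  obtain c where c: "\<And>v. v \<in> V \<Longrightarrow> v + tr 1 0 \<in> gball v c" using bounded_displacement by blast
  have "coverable (2 * (c + 1)) F"
  proof (rule coverable_if_translation[where T = "\<lambda>k v. v + tr k 0"])
    show "\<exists>v\<in>V. \<forall>k. v + tr k 0 \<notin> U" if "finite U" for U by (rule some_line_avoids[OF that])
  qed (use assms c in \<open>simp_all add: tr_V tr_F tr_eq_iff add.assoc tr_add add.commute\<close>)
  then show ?thesis by (intro exI[of _ "2 * (c + 1)"]) simp
qed

text \<open>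
  One step in the graph changes the lattice coordinates by a bounded amount, as there are finitely many edges up to translation.
\<close>

lemma ball_coordinates:
  assumes Q: "Q \<subseteq> V" and step: "\<And>q w. q \<in> Q \<Longrightarrow> {q, w} \<in> F \<Longrightarrow>
      \<exists>q'\<in>Q. \<exists>k l. \<bar>k\<bar> \<le> int c \<and> \<bar>l\<bar> \<le> int c \<and> w = q' + tr k l"
    and "q0 \<in> Q"
  shows "y \<in> gball (q0 + tr k0 l0) n \<Longrightarrow>
    \<exists>q\<in>Q. \<exists>k l. \<bar>k - k0\<bar> \<le> int (c * n) \<and> \<bar>l - l0\<bar> \<le> int (c * n) \<and> y = q + tr k l"
proof (induction n arbitrary: y)
  case 0
  then show ?case using assms(3) by auto
next
  case (Suc n)
  from Suc.prems consider "y \<in> gball (q0 + tr k0 l0) n" | w where "w \<in> gball (q0 + tr k0 l0) n" "{w, y} \<in> F"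
    unfolding ball_Suc by blast
  then show ?case
  proof cases
    case 1
    then obtain q k l where "q \<in> Q" "\<bar>k - k0\<bar> \<le> int (c * n)" "\<bar>l - l0\<bar> \<le> int (c * n)" "y = q + tr k l"
      using Suc.IH by blast
    then show ?thesis by (intro bexI[of _ q] exI[of _ k] exI[of _ l]) auto
  next
    case 2
    obtain q k l where q: "q \<in> Q" "\<bar>k - k0\<bar> \<le> int (c * n)" "\<bar>l - l0\<bar> \<le> int (c * n)" "w = q + tr k l"
      using Suc.IH[OF 2(1)] by blast
    have "(y - tr k l) + tr k l = y" by simp
    then have "{q, y - tr k l} \<in> F" using tr_F[of q k l "y - tr k l"] 2(2) q(4) by simp
    then obtain q' k' l' where q': "q' \<in> Q" "\<bar>k'\<bar> \<le> int c" "\<bar>l'\<bar> \<le> int c" "y - tr k l = q' + tr k' l'"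
      using step[OF q(1)] by blast
    have "y = q' + (tr k' l' + tr k l)" using q'(4) by (simp add: algebra_simps)
    then have "y = q' + tr (k' + k) (l' + l)" by (simp add: tr_add)
    then show ?thesis using q' q(2,3)
      by (intro bexI[of _ q'] exI[of _ "k' + k"] exI[of _ "l' + l"]) auto
  qed
qed

lemma ball_upper: "\<exists>C. \<forall>x\<in>V. \<forall>n\<ge>1. card (gball x n) \<le> C * n\<^sup>2"
proof -
  obtain Q where Q: "finite Q" "Q \<subseteq> V" "\<forall>v\<in>V. \<exists>q\<in>Q. \<exists>k l. v = q + tr k l"
    using finite_orbits by blast
  define P where "P = (SIGMA q:Q. {w. {q, w} \<in> F})"
  have finP: "finite P" unfolding P_def by (intro finite_SigmaI Q(1) finite_nbrs)
  have "\<forall>p\<in>P. \<exists>n. \<exists>q'\<in>Q. \<exists>k l. \<bar>k\<bar> \<le> int n \<and> \<bar>l\<bar> \<le> int n \<and> snd p = q' + tr k l"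
  proof
    fix p assume "p \<in> P"
    then have "snd p \<in> V" using edge_in_V by (auto simp: P_def)
    then obtain q' k l where "q' \<in> Q" "snd p = q' + tr k l" using Q(3) by blast
    then show "\<exists>n. \<exists>q'\<in>Q. \<exists>k l. \<bar>k\<bar> \<le> int n \<and> \<bar>l\<bar> \<le> int n \<and> snd p = q' + tr k l"
      by (intro exI[of _ "nat (\<bar>k\<bar> + \<bar>l\<bar>)"] bexI[of _ q'] exI[of _ k] exI[of _ l]) auto
  qed
  then obtain f where f: "\<And>p. p \<in> P \<Longrightarrow> \<exists>q'\<in>Q. \<exists>k l. \<bar>k\<bar> \<le> int (f p) \<and> \<bar>l\<bar> \<le> int (f p) \<and> snd p = q' + tr k l"
    by metis
  define c where "c = 1 + sum f P"
  have step: "\<exists>q'\<in>Q. \<exists>k l. \<bar>k\<bar> \<le> int c \<and> \<bar>l\<bar> \<le> int c \<and> w = q' + tr k l"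
    if "q \<in> Q" "{q, w} \<in> F" for q w
  proof -
    have p: "(q, w) \<in> P" using that by (simp add: P_def)
    have "f (q, w) \<le> c" unfolding c_def using member_le_sum[OF p _ finP, of f] by simp
    moreover obtain q' k l where "q' \<in> Q" "\<bar>k\<bar> \<le> int (f (q, w))" "\<bar>l\<bar> \<le> int (f (q, w))" "w = q' + tr k l"
      using f[OF p] by auto
    ultimately show ?thesis by (intro bexI[of _ q'] exI[of _ k] exI[of _ l]) auto
  qed
  have "card (gball x n) \<le> card Q * (9 * c\<^sup>2) * n\<^sup>2" if x: "x \<in> V" and n: "n \<ge> 1" for x n
  proof -
    obtain q0 k0 l0 where q0: "q0 \<in> Q" "x = q0 + tr k0 l0" using Q(3)[rule_format, OF x] by blast
    let ?K = "{k0 - int (c * n) .. k0 + int (c * n)}" and ?L = "{l0 - int (c * n) .. l0 + int (c * n)}"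
    have "gball x n \<subseteq> (\<lambda>(q, k, l). q + tr k l) ` (Q \<times> ?K \<times> ?L)"
    proof
      fix y assume y: "y \<in> gball x n"
      have "\<exists>q\<in>Q. \<exists>k l. \<bar>k - k0\<bar> \<le> int (c * n) \<and> \<bar>l - l0\<bar> \<le> int (c * n) \<and> y = q + tr k l"
        by (rule ball_coordinates[OF Q(2) _ q0(1)]) (use step y q0(2) in simp_all)
      then obtain q k l where "q \<in> Q" "\<bar>k - k0\<bar> \<le> int (c * n)" "\<bar>l - l0\<bar> \<le> int (c * n)" "y = q + tr k l"
        by blast
      then show "y \<in> (\<lambda>(q, k, l). q + tr k l) ` (Q \<times> ?K \<times> ?L)"
        by (intro image_eqI[of _ _ "(q, k, l)"]) (auto simp: abs_le_iff)
    qed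
    moreover have fin: "finite (Q \<times> ?K \<times> ?L)" using Q(1) by simp
    ultimately have "card (gball x n) \<le> card (Q \<times> ?K \<times> ?L)"
      by (meson card_image_le card_mono finite_imageI le_trans)
    also have "\<dots> = card Q * ((2 * (c * n) + 1) * (2 * (c * n) + 1))"
      by (simp add: card_cartesian_product nat_add_distrib nat_mult_distrib)
    also have "\<dots> \<le> card Q * ((3 * (c * n)) * (3 * (c * n)))"
    proof -
      have "1 \<le> c * n" using n by (simp add: c_def)
      then show ?thesis by (intro mult_le_mono) auto
    qed
    also have "\<dots> = card Q * (9 * c\<^sup>2) * n\<^sup>2" by (simp add: power2_eq_square)
    finally show ?thesis .
  qed
  then show ?thesis by blast
qed

lemma ball_lower: "\<exists>c. \<forall>y\<in>V. \<forall>n. n\<^sup>2 \<le> c * card (gball y n)"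
proof -
  obtain c1 where c1: "\<And>v. v \<in> V \<Longrightarrow> v + tr 1 0 \<in> gball v c1" using bounded_displacement by blast
  obtain c2 where c2: "\<And>v. v \<in> V \<Longrightarrow> v + tr 0 1 \<in> gball v c2" using bounded_displacement by blast
  define c where "c = 1 + c1 + c2"
  have ca: "v + tr 1 0 \<in> gball v c" and cb: "v + tr 0 1 \<in> gball v c" if "v \<in> V" for v
    using ball_mono[OF c1[OF that], of c] ball_mono[OF c2[OF that], of c] by (auto simp: c_def)
  have line_a: "v + tr (int i) 0 \<in> gball v (i * c)" if "v \<in> V" for v i
  proof (induction i)
    case (Suc i)
    have "v + tr (int i) 0 \<in> V" using that tr_V by simp
    from ball_trans[OF Suc.IH ca[OF this]] show ?case
      by (simp add: add.assoc tr_add add.commute[of "1::int"] add.commute[of c])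
  qed simp
  have line_b: "v + tr 0 (int i) \<in> gball v (i * c)" if "v \<in> V" for v i
  proof (induction i)
    case (Suc i)
    have "v + tr 0 (int i) \<in> V" using that tr_V by simp
    from ball_trans[OF Suc.IH cb[OF this]] show ?case
      by (simp add: add.assoc tr_add add.commute[of "1::int"] add.commute[of c])
  qed simp
  have "n\<^sup>2 \<le> (2 * c)\<^sup>2 * card (gball y n)" if y: "y \<in> V" for y n
  proof -
    define m where "m = n div (2 * c)"
    have m: "m * (2 * c) \<le> n" "n \<le> (m + 1) * (2 * c)"
      using div_times_less_eq_dividend[of n "2 * c"] dividend_less_div_times[of "2 * c" n]
      by (auto simp: m_def c_def algebra_simps)
    let ?S = "{..m} \<times> {..m}" and ?p = "\<lambda>(i, j). y + tr (int i) (int j)"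
    have "?p ` ?S \<subseteq> gball y n"
    proof safe
      fix i j assume ij: "i \<le> m" "j \<le> m"
      have "y + tr (int i) 0 \<in> V" using y tr_V by simp
      from ball_trans[OF line_a[OF y] line_b[OF this]]
      have "y + tr (int i) (int j) \<in> gball y (i * c + j * c)" by (simp add: add.assoc tr_add)
      moreover have "i * c + j * c \<le> n"
      proof -
        have "i * c + j * c \<le> m * c + m * c" using ij by (intro add_mono mult_le_mono) auto
        then show ?thesis using m(1) by simp
      qed
      ultimately show "y + tr (int i) (int j) \<in> gball y n" by (rule ball_mono)
    qed
    then have "card (?p ` ?S) \<le> card (gball y n)" by (intro card_mono) auto
    moreover have "card (?p ` ?S) = card ?S" by (rule card_image) (auto simp: inj_on_def tr_eq_iff)
    ultimately have card: "(m + 1)\<^sup>2 \<le> card (gball y n)"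
      by (simp add: power2_eq_square)
    have "n\<^sup>2 \<le> ((m + 1) * (2 * c))\<^sup>2" using m(2) by (intro power_mono) auto
    also have "\<dots> = (2 * c)\<^sup>2 * (m + 1)\<^sup>2" by (simp only: power_mult_distrib mult.commute)
    also have "\<dots> \<le> (2 * c)\<^sup>2 * card (gball y n)" using card by (intro mult_le_mono) auto
    finally show ?thesis .
  qed
  then show ?thesis by blast
qed

lemma ball_doubling: "\<exists>C. \<forall>x\<in>V. \<forall>y\<in>V. \<forall>r\<ge>1. card (gball x (192 * r)) \<le> C * card (gball y r)"
proof -
  obtain C1 where C1: "\<And>x n. x \<in> V \<Longrightarrow> n \<ge> 1 \<Longrightarrow> card (gball x n) \<le> C1 * n\<^sup>2" using ball_upper by blast
  obtain C2 where C2: "\<And>y n. y \<in> V \<Longrightarrow> n\<^sup>2 \<le> C2 * card (gball y n)" using ball_lower by blast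
  have "card (gball x (192 * r)) \<le> C1 * 192\<^sup>2 * C2 * card (gball y r)" if "x \<in> V" "y \<in> V" "r \<ge> 1" for x y r
  proof -
    have "card (gball x (192 * r)) \<le> C1 * (192 * r)\<^sup>2" by (rule C1) (use that in auto)
    also have "\<dots> = C1 * 192\<^sup>2 * r\<^sup>2" by (simp add: power_mult_distrib)
    also have "\<dots> \<le> C1 * 192\<^sup>2 * (C2 * card (gball y r))" using C2[OF that(2)] by (intro mult_le_mono) auto
    finally show ?thesis by (simp only: mult.assoc)
  qed
  then show ?thesis by blast
qed

end

theorem theorem3p9:
  fixes V :: "complex set" and E :: "complex set set" and m :: nat
  assumes "planar_lattice V E"
    and "m \<ge> 2"
    and "fold_symmetric m V E"
    and "\<forall>x\<in>V. even (vdegree (abs_edges E) x)"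
  shows "\<exists>D \<Phi>. Aut_factor V (abs_edges E) D \<Phi> \<and>
           finitary_factor V (abs_edges E) D \<Phi> \<and>
           (AE \<omega> in iid_uniform V. balanced_orientation V (abs_edges E) (\<Phi> \<omega>))"
proof -
  let ?F = "abs_edges E"
  interpret lf_graph V ?F by (rule lf_graph_planar_lattice[OF assms(1)])
  obtain v1 v2 where v: "v1 \<noteq> v2" "independent {v1, v2}"
    "(\<lambda>z. z + v1) \<in> graph_Aut V ?F" "(\<lambda>z. z + v2) \<in> graph_Aut V ?F"
    using assms(1) unfolding planar_lattice_def by blast
  have "\<not> z islimpt V" for z using assms(1) unfolding planar_lattice_def by blast
  then interpret periodic_graph V ?F v1 v2 using v by unfold_locales
  have "even (card {e \<in> ?F. x \<in> e})" if "x \<in> V" for x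
    using assms(4) that by (simp add: vdegree_def)
  then obtain L where L: "L \<ge> 1" "coverable L ?F" using coverable_periodic by blast
  interpret coverable_graph V ?F L using L by unfold_locales
  obtain C where "\<And>x y r. x \<in> V \<Longrightarrow> y \<in> V \<Longrightarrow> r \<ge> 1 \<Longrightarrow> card (gball x (192 * r)) \<le> C * card (gball y r)"
    using ball_doubling by blast
  then have "AE \<omega> in iid_uniform V. \<omega> \<in> good" by (rule AE_good[OF infinite_V])
  then show ?thesis using factor_if_AE_good by blast
qed

end
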